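(* Let $k,l\ge 2$ be integers, let $G$ be a uniform graph of type $(k,l)$ with $n$ edges, and let $\beta$ be its clean Belyi function. Then there exists a rational function $\psi$ such that $\beta=\beta_{k,l}\circ\psi$. In particular, $n$ is divisible by $n(k,l)$.
   Context: "Graph" means a finite connected plane graph (embedded in the sphere $\mathbb{CP}^1$) with at least one edge, possibly with multiple edges and loops, considered up to orientation-preserving isotopy equivalence. Vertex degrees count loops twice; the degree of a face is the length of its boundary walk (an edge having the same face on both sides is counted twice). For $k,l\ge2$, a graph is uniform of type $(k,l)$ if all vertex degrees are divisible by $k$ and all face degrees are divisible by $l$. By Euler's formula such a graph can exist only if, up to interchanging $k$ and $l$, $(k,l)$ is one of $(2,r)$ with $r\ge2$, $(3,3)$, $(3,4)$, $(3,5)$; for these pairs there is a unique graph, the Platonic graph of type $(k,l)$, with all vertices of degree exactly $k$ and all faces of degree exactly $l$, and $n(k,l)=\frac{2kl}{2k+2l-kl}$ denotes its number of edges. A Belyi function is a rational function $\beta:\mathbb{CP}^1\to\mathbb{CP}^1$ all of whose critical values lie in $\{0,1,\infty\}$. It is clean if its multiplicity at every point of $\beta^{-1}(1)$ is exactly $2$. A clean Belyi function $\beta$ of degree $2n$ defines a graph $G_\beta$ with $n$ edges: it is the set $\beta^{-1}([0,1])$, with vertices the points of $\beta^{-1}(0)$ and with open edges the connected components of $\beta^{-1}((0,1])$. The degree of a vertex is the multiplicity of $\beta$ there; each face contains exactly one pole, whose multiplicity is the degree of the face. The map $\beta\mapsto G_\beta$ induces a bijection between clean Belyi functions of degree $2n$,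 up to precomposition with Möbius transformations, and connected plane graphs with $n$ edges up to equivalence; the clean Belyi function of $G$ is any $\beta$ with $G_\beta$ equivalent to $G$. The function $\beta_{k,l}$ is the clean Belyi function of the Platonic graph of type $(k,l)$. *)

theory Defs
  imports "HOL-Complex_Analysis.Complex_Analysis" "HOL-Computational_Algebra.Polynomial"
begin

section \<open>The Riemann sphere and rational functions\<close>

text \<open>The sphere is the one-point compactification of the complex plane; \<open>None\<close> is the point
  \<open>\<infinity>\<close> and \<open>Some z\<close> is the finite point \<open>z\<close>.\<close>

type_synonym sphere = "complex option"

definition CP1 :: "sphere topology" where
  "CP1 = Alexandroff_compactification euclidean"

text \<open>The map of the sphere induced by the fraction \<open>p/q\<close>, for coprime \<open>p\<close> and \<open>q\<close> with \<open>q \<noteq> 0\<close>.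
  If \<open>degree p < degree q\<close> then \<open>coeff p (degree q) = 0\<close>, so the value at infinity is 0.\<close>

definition rat_map :: "complex poly \<Rightarrow> complex poly \<Rightarrow> sphere \<Rightarrow> sphere" where
  "rat_map p q x = (case x of
      Some z \<Rightarrow> if poly q z = 0 then None else Some (poly p z / poly q z)
    | None \<Rightarrow> if degree p > degree q then None else Some (coeff p (degree q) / lead_coeff q))"

definition rational_function :: "(sphere \<Rightarrow> sphere) \<Rightarrow> bool" where
  "rational_function f \<longleftrightarrow> (\<exists>p q. q \<noteq> 0 \<and> coprime p q \<and> f = rat_map p q)"

text \<open>The involution \<open>z \<mapsto> 1/z\<close>, exchanging 0 and infinity.\<close>

definition sphere_inv :: "sphere \<Rightarrow> sphere" where
  "sphere_inv x = (case x of None \<Rightarrow> Some 0 | Some z \<Rightarrow> if z = 0 then None else Some (inverse z))"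

text \<open>The multiplicity (ramification index) of a nonconstant rational function \<open>f\<close> at \<open>x\<close>: write
  \<open>f\<close> in the chart \<open>z\<close> or \<open>1/z\<close> around \<open>x\<close> and around \<open>f x\<close> (using \<open>1/z\<close> exactly at infinity), and
  take the order of vanishing of the resulting holomorphic germ minus its value. Near the point in
  question the germ has finite values, so \<open>the\<close> is only applied to elements of the form \<open>Some w\<close>.\<close>

definition mult_at :: "(sphere \<Rightarrow> sphere) \<Rightarrow> sphere \<Rightarrow> int" where
  "mult_at f x =
    (let g = (if f x = None then sphere_inv \<circ> f else f);
         h = (if x = None then g \<circ> sphere_inv else g);
         a = (case x of None \<Rightarrow> 0 | Some z \<Rightarrow> z)
     in zorder (\<lambda>w. the (h (Some w)) - the (h (Some a))) a)"

definition critical_value :: "(sphere \<Rightarrow> sphere) \<Rightarrow> sphere \<Rightarrow> bool" where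
  "critical_value f y \<longleftrightarrow> (\<exists>x. f x = y \<and> mult_at f x \<ge> 2)"

definition belyi :: "(sphere \<Rightarrow> sphere) \<Rightarrow> bool" where
  "belyi f \<longleftrightarrow> rational_function f \<and> (\<nexists>c. \<forall>x. f x = c) \<and>
     (\<forall>y. critical_value f y \<longrightarrow> y \<in> {Some 0, Some 1, None})"

definition clean_belyi :: "(sphere \<Rightarrow> sphere) \<Rightarrow> bool" where
  "clean_belyi f \<longleftrightarrow> belyi f \<and> (\<forall>x. f x = Some 1 \<longrightarrow> mult_at f x = 2)"


section \<open>Plane graphs\<close>

text \<open>A graph drawn on the sphere is given by its set of vertices and its set of open edges
  (edges without their end points, as subsets of the sphere).\<close>

record pgraph =
  verts :: "sphere set"
  edges :: "sphere set set"

definition support :: "pgraph \<Rightarrow> sphere set" where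
  "support G = verts G \<union> \<Union>(edges G)"

text \<open>The values \<open>\<gamma> 0\<close> and \<open>\<gamma> 1\<close> may coincide (loops), and distinct edges may have the same end
  points. Since \<open>e\<close> avoids the vertices, \<open>\<gamma>\<close> meets its end points only at 0 and 1.\<close>

definition open_edge :: "sphere set \<Rightarrow> sphere set \<Rightarrow> bool" where
  "open_edge V e \<longleftrightarrow> e \<inter> V = {} \<and>
     (\<exists>\<gamma>. pathin CP1 \<gamma> \<and> \<gamma> 0 \<in> V \<and> \<gamma> 1 \<in> V \<and> inj_on \<gamma> {0<..<1} \<and> e = \<gamma> ` {0<..<1})"

definition plane_graph :: "pgraph \<Rightarrow> bool" where
  "plane_graph G \<longleftrightarrow>
     finite (verts G) \<and> finite (edges G) \<and> edges G \<noteq> {} \<and>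
     (\<forall>e\<in>edges G. open_edge (verts G) e) \<and>
     disjoint (edges G) \<and>
     connectedin CP1 (support G)"

definition edge_ends :: "sphere set \<Rightarrow> sphere set" where
  "edge_ends e = CP1 closure_of e - e"

text \<open>An edge with a single end point is a loop and counts twice.\<close>

definition vertex_degree :: "pgraph \<Rightarrow> sphere \<Rightarrow> nat" where
  "vertex_degree G v =
     (\<Sum>e | e \<in> edges G \<and> v \<in> edge_ends e. if edge_ends e = {v} then 2 else 1)"

definition faces :: "pgraph \<Rightarrow> sphere set set" where
  "faces G = connected_components_of (subtopology CP1 (topspace CP1 - support G))"

text \<open>The length of the boundary walk of a face: every edge on its boundary counts once if there is
  another face along this edge, and twice if the face lies on both sides of it.\<close>

definition face_degree :: "pgraph \<Rightarrow> sphere set \<Rightarrow> nat" where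
  "face_degree G F =
     (\<Sum>e | e \<in> edges G \<and> e \<subseteq> CP1 closure_of F.
        if \<exists>F'\<in>faces G. F' \<noteq> F \<and> e \<subseteq> CP1 closure_of F' then 1 else 2)"

text \<open>Ambient isotopy: one graph is carried to the other by the end of an isotopy of
  homeomorphisms of the sphere starting at the identity. In particular the final homeomorphism
  preserves the orientation.\<close>

definition pgraph_equiv :: "pgraph \<Rightarrow> pgraph \<Rightarrow> bool" where
  "pgraph_equiv G H \<longleftrightarrow>
     (\<exists>h. homotopic_with (homeomorphic_map CP1 CP1) CP1 CP1 id h \<and>
          h ` verts G = verts H \<and> (\<lambda>e. h ` e) ` edges G = edges H)"

definition uniform_graph :: "nat \<Rightarrow> nat \<Rightarrow> pgraph \<Rightarrow> bool" where
  "uniform_graph k l G \<longleftrightarrow> plane_graph G \<and>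
     (\<forall>v\<in>verts G. k dvd vertex_degree G v) \<and> (\<forall>F\<in>faces G. l dvd face_degree G F)"

definition platonic_graph :: "nat \<Rightarrow> nat \<Rightarrow> pgraph \<Rightarrow> bool" where
  "platonic_graph k l G \<longleftrightarrow> plane_graph G \<and>
     (\<forall>v\<in>verts G. vertex_degree G v = k) \<and> (\<forall>F\<in>faces G. face_degree G F = l)"

text \<open>The number of edges of the Platonic graph of type \<open>(k,l)\<close>, as a real quotient so that no
  truncating subtraction or division is involved.\<close>

definition platonic_edges :: "nat \<Rightarrow> nat \<Rightarrow> real" where
  "platonic_edges k l = 2 * real k * real l / (2 * real k + 2 * real l - real k * real l)"


section \<open>The graph of a clean Belyi function\<close>

definition belyi_graph :: "(sphere \<Rightarrow> sphere) \<Rightarrow> pgraph" where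
  "belyi_graph f =
     \<lparr> verts = {x. f x = Some 0},
       edges = connected_components_of
         (subtopology CP1 {x. \<exists>t::real. 0 < t \<and> t \<le> 1 \<and> f x = Some (of_real t)}) \<rparr>"

text \<open>The clean Belyi function of a graph is unique only up to precomposition with Moebius
  transformations, hence the following are relations.\<close>

definition clean_belyi_function_of :: "pgraph \<Rightarrow> (sphere \<Rightarrow> sphere) \<Rightarrow> bool" where
  "clean_belyi_function_of G f \<longleftrightarrow> clean_belyi f \<and> pgraph_equiv (belyi_graph f) G"

definition platonic_belyi :: "nat \<Rightarrow> nat \<Rightarrow> (sphere \<Rightarrow> sphere) \<Rightarrow> bool" where
  "platonic_belyi k l f \<longleftrightarrow> (\<exists>P. platonic_graph k l P \<and> clean_belyi_function_of P f)"

end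

theory Submission
  imports Defs "HOL-Computational_Algebra.Fundamental_Theorem_Algebra"
begin

text \<open>
  Let \<open>f\<close> and \<open>g\<close> be nonconstant rational functions. A continuous \<open>\<psi>\<close> with \<open>f \<circ> \<psi> = g\<close> is a
  lift of \<open>g\<close> through the branched covering \<open>f\<close>. If at every point \<open>x\<close> the multiplicities of \<open>f\<close>
  at all points over \<open>g x\<close> divide the multiplicity of \<open>g\<close> at \<open>x\<close>, then a lift exists near \<open>x\<close>,
  through any prescribed point over \<open>g x'\<close> for any prescribed \<open>x'\<close> near \<open>x\<close>: in local
  coordinates \<open>f\<close> is \<open>u^m\<close> and \<open>g\<close> is \<open>z^(m*k)\<close>, and the lifts are \<open>u = \<zeta> * z^k\<close> with
  \<open>\<zeta>^m = 1\<close>. So lifts form a locally constant system, even across the branch points, and on a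
  simply connected domain local lifts continue to global ones (\<open>lift_convex\<close>). On the whole plane
  the lift converges at infinity (\<open>lift_limit\<close>), so it is a continuous self-map of the sphere,
  holomorphic off a finite set, and therefore rational (\<open>rational_functionI\<close>, \<open>factorization\<close>).

  If \<open>\<beta>\<close> belongs to a uniform graph of type \<open>(k,l)\<close> and \<open>\<beta>\<^sub>k\<^sub>l\<close> to the Platonic one, then the
  multiplicities of \<open>\<beta>\<^sub>k\<^sub>l\<close> over \<open>0\<close>, \<open>\<infinity>\<close>, \<open>1\<close> are exactly \<open>k\<close>, \<open>l\<close>, \<open>2\<close>, those of \<open>\<beta>\<close> are
  multiples of them, and everywhere else \<open>\<beta>\<^sub>k\<^sub>l\<close> is unramified. The criterion above applies and
  yields \<open>\<psi>\<close>.

  This uses that the topologically defined vertex and face degrees of the graph of a clean Belyi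
  function are multiplicities (\<open>vertex_degree_eq_mul\<close>, \<open>face_degree_eq_mul\<close>). Again this is a
  matter of lifts, now of the identity: over a convex domain that avoids \<open>0\<close> and \<open>1\<close> the function
  has as many continuous sections as its degree. The sections over \<open>]0,1[\<close> are the half-edges, and
  the number of them that end at a vertex is the multiplicity of the vertex. The sections over the
  upper half-plane are tiles, one on a fixed side of each half-edge, and each tile tends to one pole
  at infinity. A face contains exactly one pole (\<open>pole_unique_in_face\<close>), the number of tiles at
  this pole is its multiplicity, and two half-edges that meet over \<open>1\<close> see the same two faces with
  sides interchanged, so that counting tiles is counting sides of edges.

  For the divisibility of the number of edges, the Riemann--Hurwitz inequality first shows
  \<open>k*l < 2*k + 2*l\<close>. In each of these cases a classical identity \<open>a*A^k - b*B^l = c*C^2\<close> between the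
  invariant polynomials of a polyhedral group gives a rational function of degree \<open>2*n(k,l)\<close> with
  multiplicities divisible by \<open>k\<close>, \<open>l\<close>, \<open>2\<close> over \<open>0\<close>, \<open>\<infinity>\<close>, \<open>1\<close>. At this degree
  Riemann--Hurwitz leaves no room for larger multiplicities (\<open>exact_typeI\<close>), so \<open>\<beta>\<close> factors through
  it, and degrees are multiplicative. The degree of \<open>\<beta>\<close> is twice the number of edges.
\<close>

section \<open>The sphere as a topological space\<close>

text \<open>With this instance \<open>CP1\<close> is the Euclidean topology of the type \<open>sphere\<close>, so that the notions
  of limit, continuity, closure and component for type classes apply.\<close>

instantiation option :: (topological_space) topological_space
begin
definition open_option :: "'a option set \<Rightarrow> bool" where
  "open_option U \<longleftrightarrow> openin (Alexandroff_compactification euclidean) U"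
instance
proof
  show "open (UNIV :: 'a option set)"
    unfolding open_option_def
    by (metis openin_topspace topspace_Alexandroff_compactification topspace_euclidean UNIV_option_conv)
qed (auto simp: open_option_def)
end

lemma CP1_eq_euclidean: "CP1 = euclidean"
proof -
  have "openin CP1 U \<longleftrightarrow> openin euclidean U" for U
    by (simp add: CP1_def open_option_def flip: open_openin)
  thus ?thesis by (simp add: topology_eq)
qed

lemma open_option_iff:
  fixes U :: "'a::heine_borel option set"
  shows "open U \<longleftrightarrow> open (Some -` U) \<and> (None \<in> U \<longrightarrow> bounded (- (Some -` U)))"
proof -
  have 1: "open U \<longleftrightarrow> (\<exists>V. open V \<and> U = Some ` V) \<or> (\<exists>C. compact C \<and> U = insert None (Some ` (- C)))"
    unfolding open_option_def openin_Alexandroff_compactification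
    by (auto simp: compact_imp_closed Compl_eq_Diff_UNIV)
  have a: "Some -` (Some ` V) = V" for V :: "'a set" by auto
  have b: "Some -` (insert None (Some ` V)) = V" for V :: "'a set" by auto
  show ?thesis
  proof
    assume "open U"
    thus "open (Some -` U) \<and> (None \<in> U \<longrightarrow> bounded (- (Some -` U)))"
      unfolding 1
      by (auto simp: a b compact_imp_closed compact_imp_bounded open_Compl)
  next
    assume *: "open (Some -` U) \<and> (None \<in> U \<longrightarrow> bounded (- (Some -` U)))"
    show "open U"
    proof (cases "None \<in> U")
      case True
      hence "compact (- (Some -` U))" using * True by (simp add: compact_eq_bounded_closed closed_Compl)
      moreover have "U = insert None (Some ` (- (- (Some -` U))))"
        using True by (force simp: image_iff)
      ultimately show ?thesis unfolding 1 by blast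
    next
      case False
      hence "U = Some ` (Some -` U)" by (auto simp: image_iff) (metis not_Some_eq)
      thus ?thesis unfolding 1 using * by blast
    qed
  qed
qed

lemma open_image_Some: "open (Some ` U) \<longleftrightarrow> open U" for U :: "'a::topological_space set"
  by (simp add: open_option_def)

lemma compact_UNIV_sphere: "compact (UNIV :: sphere set)"
proof -
  have "compact_space CP1" unfolding CP1_def by simp
  thus ?thesis unfolding CP1_eq_euclidean
    by (simp add: compact_space_def)
qed

instance option :: (heine_borel) t2_space
proof
  fix x y :: "'a option"
  assume xy: "x \<noteq> y"
  have sep: "\<exists>U V. open U \<and> open V \<and> None \<in> U \<and> Some a \<in> V \<and> U \<inter> V = {}" for a :: 'a
  proof (intro exI conjI)
    have "Some -` (insert None (Some ` (- cball a 1))) = - cball a 1" by auto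
    thus "open (insert None (Some ` (- cball a 1)))"
      by (simp add: open_option_iff open_Compl)
    show "open (Some ` ball a 1)" by (simp add: open_image_Some)
  qed auto
  show "\<exists>U V. open U \<and> open V \<and> x \<in> U \<and> y \<in> V \<and> U \<inter> V = {}"
  proof (cases x)
    case None
    thus ?thesis using xy sep by (metis not_Some_eq)
  next
    case (Some a)
    show ?thesis
    proof (cases y)
      case None
      thus ?thesis using sep[of a] Some by (metis Int_commute)
    next
      case (Some b)
      with xy \<open>x = Some a\<close> have "a \<noteq> b" by simp
      then obtain U V where "open U" "open V" "a \<in> U" "b \<in> V" "U \<inter> V = {}"
        using hausdorff by metis
      hence "open (Some ` U)" "open (Some ` V)" "x \<in> Some ` U" "y \<in> Some ` V" "Some ` U \<inter> Some ` V = {}"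
        using \<open>x = Some a\<close> Some by (auto simp: open_image_Some)
      thus ?thesis by blast
    qed
  qed
qed

lemma tendsto_Some: "((\<lambda>x. Some (f x)) \<longlongrightarrow> Some l) F \<longleftrightarrow> (f \<longlongrightarrow> l) F"
  for l :: "'a::heine_borel"
proof
  assume *: "((\<lambda>x. Some (f x)) \<longlongrightarrow> Some l) F"
  show "(f \<longlongrightarrow> l) F"
  proof (rule topological_tendstoI)
    fix U assume "open U" "l \<in> U"
    with topological_tendstoD[OF *, of "Some ` U"] show "\<forall>\<^sub>F x in F. f x \<in> U"
      by (auto simp: open_image_Some elim: eventually_mono)
  qed
next
  assume *: "(f \<longlongrightarrow> l) F"
  show "((\<lambda>x. Some (f x)) \<longlongrightarrow> Some l) F"
  proof (rule topological_tendstoI)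
    fix U assume "open U" "Some l \<in> U"
    hence "open (Some -` U)" "l \<in> Some -` U" by (auto simp: open_option_iff)
    from topological_tendstoD[OF * this] show "\<forall>\<^sub>F x in F. Some (f x) \<in> U" by simp
  qed
qed

lemma tendsto_Some_None: "((\<lambda>x. Some (f x)) \<longlongrightarrow> None) F \<longleftrightarrow> filterlim f at_infinity F"
  for f :: "'b \<Rightarrow> 'a::{heine_borel,real_normed_vector}"
proof
  assume *: "((\<lambda>x. Some (f x)) \<longlongrightarrow> None) F"
  show "filterlim f at_infinity F"
    unfolding filterlim_at_infinity[OF order.refl]
  proof (intro allI impI)
    fix r :: real assume "r > 0"
    have "Some -` (insert None (Some ` (- cball (0::'a) r))) = - cball 0 r" by auto
    hence "open (insert None (Some ` (- cball (0::'a) r)))" by (simp add: open_option_iff open_Compl)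
    from topological_tendstoD[OF * this] have "\<forall>\<^sub>F x in F. f x \<in> - cball 0 r" 
      by (simp add: inj_image_mem_iff)
    thus "\<forall>\<^sub>F x in F. r \<le> norm (f x)" by eventually_elim auto
  qed
next
  assume *: "filterlim f at_infinity F"
  show "((\<lambda>x. Some (f x)) \<longlongrightarrow> None) F"
  proof (rule topological_tendstoI)
    fix U :: "'a option set" assume "open U" "None \<in> U"
    hence "bounded (- (Some -` U))" by (simp add: open_option_iff)
    then obtain r where r: "r > 0" "- (Some -` U) \<subseteq> ball 0 r"
      by (meson bounded_subset_ballD)
    have "\<forall>\<^sub>F x in F. r \<le> norm (f x)" using * r(1) filterlim_at_infinity[OF order.refl] by blast
    thus "\<forall>\<^sub>F x in F. Some (f x) \<in> U"
    proof eventually_elim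
      case (elim x)
      thus ?case using r(2) by (auto simp: subset_iff)
    qed
  qed
qed

lemma continuous_on_Some [continuous_intros]:
  "continuous_on S f \<Longrightarrow> continuous_on S (\<lambda>x. Some (f x))"
  for f :: "'b::topological_space \<Rightarrow> 'a::heine_borel"
  unfolding continuous_on_def tendsto_Some by simp

lemma tendsto_the:
  fixes l :: "'a::heine_borel"
  assumes "(f \<longlongrightarrow> Some l) F" shows "((\<lambda>x. the (f x)) \<longlongrightarrow> l) F" "\<forall>\<^sub>F x in F. f x \<noteq> None"
proof -
  have "open (range (Some :: 'a \<Rightarrow> _))" by (simp add: open_image_Some)
  from topological_tendstoD[OF assms this] show 1: "\<forall>\<^sub>F x in F. f x \<noteq> None" 
    by (auto elim: eventually_mono)
  have "\<forall>\<^sub>F x in F. f x = Some (the (f x))" using 1 by eventually_elim auto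
  hence "((\<lambda>x. Some (the (f x))) \<longlongrightarrow> Some l) F" using assms by (simp cong: tendsto_cong)
  thus "((\<lambda>x. the (f x)) \<longlongrightarrow> l) F" by (simp add: tendsto_Some)
qed

section \<open>Charts of the sphere\<close>

text \<open>The charts in which multiplicities are measured: \<open>1/z\<close> around infinity and translations around
  finite points. The chart around \<open>a\<close> covers the sphere without \<open>antipode a\<close>, and \<open>unchart a\<close> is its
  inverse.\<close>

definition chart :: "sphere \<Rightarrow> sphere \<Rightarrow> complex" where
  "chart a u = (case a of None \<Rightarrow> the (sphere_inv u) | Some c \<Rightarrow> the u - c)"

definition unchart :: "sphere \<Rightarrow> complex \<Rightarrow> sphere" where
  "unchart a w = (case a of None \<Rightarrow> sphere_inv (Some w) | Some c \<Rightarrow> Some (w + c))"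

definition antipode :: "sphere \<Rightarrow> sphere" where
  "antipode a = (case a of None \<Rightarrow> Some 0 | Some c \<Rightarrow> None)"

lemma sphere_inv_simps [simp]: "sphere_inv None = Some 0" "sphere_inv (Some 0) = None"
  "z \<noteq> 0 \<Longrightarrow> sphere_inv (Some z) = Some (inverse z)"
  by (auto simp: sphere_inv_def)

lemma continuous_sphere_inv: "continuous_on UNIV sphere_inv"
  unfolding continuous_on_open_vimage[OF open_UNIV]
proof (intro allI impI)
  fix U :: "sphere set" assume U: "open U"
  have "open (Some -` (sphere_inv -` U)) \<and> (None \<in> sphere_inv -` U \<longrightarrow> bounded (- (Some -` (sphere_inv -` U))))"
  proof
    have "open (- {0::complex} \<inter> (\<lambda>z. inverse z) -` (Some -` U))" 
      by (rule continuous_open_preimage)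
        (use U in \<open>auto intro!: continuous_intros simp: open_option_iff open_Compl\<close>)
    hence 1: "open ((\<lambda>z. inverse z) -` (Some -` U) \<inter> (- {0::complex}))" by (simp add: Int_commute)
    have 2: "\<exists>e>0. ball 0 e \<subseteq> Some -` (sphere_inv -` U)" if "None \<in> U"
    proof -
      have "bounded (- (Some -` U))" using U that by (simp add: open_option_iff)
      then obtain r where r: "r > 0" "- (Some -` U) \<subseteq> ball 0 r"
        by (meson bounded_subset_ballD)
      have "z \<in> Some -` (sphere_inv -` U)" if "z \<in> ball 0 (1/r)" for z
      proof (cases "z = 0")
        case False
        have "norm (inverse z) > r" using that False r by (simp add: norm_inverse norm_divide field_simps)
        hence "inverse z \<in> Some -` U" using r(2) by (auto simp: subset_iff)
        thus ?thesis using False by simp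
      qed (use \<open>None \<in> U\<close> in simp)
      thus ?thesis using r(1) by (intro exI[of _ "1/r"]) auto
    qed
    show "open (Some -` (sphere_inv -` U))"
    proof -
      have "\<exists>T. open T \<and> z \<in> T \<and> T \<subseteq> Some -` (sphere_inv -` U)" if z: "z \<in> Some -` (sphere_inv -` U)" for z
      proof (cases "z = 0")
        case True
        with z 2 obtain e where "e>0" "ball 0 e \<subseteq> Some -` (sphere_inv -` U)" by auto
        thus ?thesis using True by (intro exI[of _ "ball 0 e"]) auto
      next
        case False
        thus ?thesis using 1 z 
          by (intro exI[of _ "(\<lambda>z. inverse z) -` (Some -` U) \<inter> (- {0::complex})"]) auto
      qed
      thus ?thesis using open_subopen by blast
    qed
    show "None \<in> sphere_inv -` U \<longrightarrow> bounded (- (Some -` (sphere_inv -` U)))"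
    proof
      assume "None \<in> sphere_inv -` U"
      hence "0 \<in> Some -` U" "open (Some -` U)" using U by (auto simp: open_option_iff)
      then obtain e where e: "e>0" "ball 0 e \<subseteq> Some -` U" using open_contains_ball by blast
      have "- (Some -` (sphere_inv -` U)) \<subseteq> cball 0 (1/e)"
      proof
        fix z assume z: "z \<in> - (Some -` (sphere_inv -` U))"
        show "z \<in> cball 0 (1/e)"
        proof (rule ccontr)
          assume "z \<notin> cball 0 (1/e)"
          hence gt: "norm z > 1/e" by simp
          moreover have "1/e > 0" using e(1) by simp
          ultimately have "z \<noteq> 0" by (metis norm_zero less_asym)
          with gt have nz: "z \<noteq> 0" "norm (inverse z) < e" using e by (auto simp: norm_inverse norm_divide field_simps)
          hence "inverse z \<in> Some -` U" using e(2) by auto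
          with z nz show False by simp
        qed
      qed
      thus "bounded (- (Some -` (sphere_inv -` U)))" using bounded_subset bounded_cball by blast
    qed
  qed
  thus "open (sphere_inv -` U \<inter> UNIV)" by (simp add: open_option_iff)
qed

lemma unchart_0 [simp]: "unchart a 0 = a" and chart_self [simp]: "chart a a = 0"
  by (cases a; simp add: unchart_def chart_def)+

lemma chart_unchart [simp]: "chart a (unchart a w) = w"
  by (cases a; cases "w = 0"; simp add: unchart_def chart_def)

lemma unchart_chart: "u \<noteq> antipode a \<Longrightarrow> unchart a (chart a u) = u"
  by (cases a; cases u) (auto simp: unchart_def chart_def antipode_def)

lemma unchart_neq_antipode: "unchart a w \<noteq> antipode a"
  by (cases a; cases "w = 0"; simp add: unchart_def antipode_def)

lemma antipode_neq: "antipode a \<noteq> a"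
  by (cases a) (auto simp: antipode_def)

lemma unchart_eq_iff [simp]: "unchart a w = unchart a w' \<longleftrightarrow> w = w'"
  by (metis chart_unchart)

lemma continuous_on_unchart: "continuous_on S (unchart a)"
proof (cases a)
  case None
  have "continuous_on S (\<lambda>w. sphere_inv (Some w))"
    by (rule continuous_on_compose2[OF continuous_sphere_inv]) (auto intro!: continuous_intros)
  thus ?thesis using None by (simp add: unchart_def[abs_def])
next
  case (Some c)
  thus ?thesis by (auto simp: unchart_def[abs_def] intro!: continuous_intros)
qed

lemma continuous_on_chart: "continuous_on (- {antipode a}) (chart a)"
proof -
  have the: "continuous_on (- {None}) (the :: sphere \<Rightarrow> complex)"
    unfolding continuous_on_def
  proof
    fix x :: sphere assume "x \<in> - {None}"
    then obtain c where "x = Some c" by auto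
    thus "(the \<longlongrightarrow> the x) (at x within - {None})"
      using tendsto_the[OF tendsto_ident_at[of "Some c" "-{None}"]] by simp
  qed
  show ?thesis
  proof (cases a)
    case None
    have "continuous_on (- {Some 0}) (\<lambda>x. the (sphere_inv x))"
    proof (rule continuous_on_compose2[OF the])
      show "continuous_on (- {Some 0}) sphere_inv" using continuous_sphere_inv continuous_on_subset by blast
      show "sphere_inv ` (- {Some 0}) \<subseteq> - {None}"
        by (auto simp: sphere_inv_def split: option.splits if_splits)
    qed
    thus ?thesis using None by (simp add: chart_def[abs_def] antipode_def)
  next
    case (Some c)
    thus ?thesis using the by (auto simp: chart_def[abs_def] antipode_def intro!: continuous_intros)
  qed
qed

lemma open_image_unchart: "open (unchart a ` U)" if "open U"
proof -
  have "unchart a ` U = chart a -` U \<inter> (- {antipode a})"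
    using unchart_chart unchart_neq_antipode by (auto simp: image_iff) metis
  thus ?thesis using continuous_open_preimage[OF continuous_on_chart _ that] by (simp add: open_Compl Int_commute)
qed

section \<open>Rational functions and their multiplicities\<close>

lemma order_sum_le_degree:
  fixes W :: "complex poly"
  assumes "W \<noteq> 0" "finite A"
  shows "(\<Sum>z\<in>A. order z W) \<le> degree W"
proof -
  have fin: "finite {z. poly W z = 0}" using assms poly_roots_finite by blast
  have "(\<Sum>z\<in>A. order z W) = (\<Sum>z\<in>A \<inter> {z. poly W z = 0}. order z W)"
    by (rule sum.mono_neutral_right) (use assms order_root in auto)
  also have "\<dots> \<le> (\<Sum>z\<in>{z. poly W z = 0}. order z W)"
    by (rule sum_mono2) (use fin in auto)
  also have "\<dots> = size (proots W)"
    by (simp add: size_multiset_overloaded_eq assms)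
  finally show ?thesis by (simp add: size_proots_complex)
qed

lemma order_sum_eq_degree:
  fixes W :: "complex poly"
  assumes "W \<noteq> 0"
  shows "(\<Sum>z | poly W z = 0. order z W) = degree W"
proof -
  have "(\<Sum>z | poly W z = 0. order z W) = size (proots W)"
    by (simp add: size_multiset_overloaded_eq assms)
  thus ?thesis by (simp add: size_proots_complex)
qed

lemma positive_degree_root:
  fixes W :: "complex poly"
  assumes "degree W > 0"
  obtains z where "poly W z = 0"
proof -
  have "W \<noteq> 0" using assms by auto
  hence "(\<Sum>z | poly W z = 0. order z W) \<noteq> 0" using order_sum_eq_degree[of W] assms by simp
  hence "{z. poly W z = 0} \<noteq> {}" by (metis sum.empty)
  thus ?thesis using that by blast
qed

lemma linear_power_dvd_pderiv:
  fixes p :: "complex poly"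
  assumes "[:- z, 1:] ^ Suc n dvd p"
  shows "[:- z, 1:] ^ n dvd pderiv p"
proof -
  obtain r where r: "p = [:- z, 1:] ^ Suc n * r" using assms by (rule dvdE)
  have "pderiv p = [:- z, 1:] ^ n * ([:- z, 1:] * pderiv r + smult (of_nat (Suc n)) r * pderiv [:- z, 1:])"
    unfolding r pderiv_mult pderiv_power_Suc by (simp add: algebra_simps)
  thus ?thesis by (rule dvdI)
qed

lemma is_unit_degree_0: "is_unit r \<Longrightarrow> degree r = 0" for r :: "complex poly"
  using dvd_imp_degree_le[of r 1] by simp

text \<open>The bound on the degrees says that \<open>p/q\<close> is not constant.\<close>

locale ratfun =
  fixes p q :: "complex poly"
  assumes coprime: "coprime p q" and deg_pos: "max (degree p) (degree q) > 0"
begin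

abbreviation f where "f \<equiv> rat_map p q"
definition N where "N = max (degree p) (degree q)"

text \<open>For all \<open>y\<close> the function \<open>p/q\<close> read in the chart around \<open>y\<close> is \<open>fibpoly y / denpoly y\<close>. Hence the
  finite points over \<open>y\<close> are the roots of \<open>fibpoly y\<close>, and \<open>N\<close> minus its degree is the multiplicity of
  infinity if infinity lies over \<open>y\<close>.\<close>

definition fibpoly where "fibpoly y = (case y of None \<Rightarrow> q | Some c \<Rightarrow> p - smult c q)"
definition denpoly where "denpoly y = (case y of None \<Rightarrow> p | Some c \<Rightarrow> q)"

definition mul :: "sphere \<Rightarrow> nat" where
  "mul x = (case x of Some z \<Rightarrow> order z (fibpoly (f x)) | None \<Rightarrow> N - degree (fibpoly (f x)))"

lemma N_pos: "N > 0" using deg_pos by (simp add: N_def)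

lemma q_nz: "q \<noteq> 0"
  using coprime deg_pos is_unit_degree_0[of p] by auto

lemma no_common_root: "\<not> (poly p z = 0 \<and> poly q z = 0)"
  using coprime coprime_poly_0 by blast

lemma coprime_fib_den: "coprime (fibpoly y) (denpoly y)"
proof (cases y)
  case None
  thus ?thesis using coprime by (simp add: fibpoly_def denpoly_def coprime_commute)
next
  case (Some c)
  have "coprime (p - smult c q) q"
  proof (rule coprimeI)
    fix r assume r: "r dvd p - smult c q" "r dvd q"
    hence "r dvd (p - smult c q) + smult c q" by (intro dvd_add dvd_smult) auto
    hence "r dvd p" by simp
    with r coprime show "is_unit r" by (meson coprime_common_divisor)
  qed
  thus ?thesis using Some by (simp add: fibpoly_def denpoly_def)
qed

lemma max_deg_fib_den: "max (degree (fibpoly y)) (degree (denpoly y)) = N"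
proof (cases y)
  case None
  thus ?thesis by (simp add: fibpoly_def denpoly_def N_def)
next
  case (Some c)
  have "max (degree (p - smult c q)) (degree q) = N"
  proof (cases "degree p > degree q")
    case True
    hence "degree (p - smult c q) = degree p"
      by (metis degree_smult_le diff_conv_add_uminus degree_add_eq_left degree_minus le_less_trans)
    thus ?thesis using True by (simp add: N_def)
  next
    case False
    hence "degree (p - smult c q) \<le> degree q" 
      by (meson degree_diff_le degree_smult_le linorder_not_less)
    thus ?thesis using False by (simp add: N_def)
  qed
  thus ?thesis using Some by (simp add: fibpoly_def denpoly_def)
qed

lemma fib_nz: "fibpoly y \<noteq> 0"
proof
  assume "fibpoly y = 0"
  hence "is_unit (denpoly y)" using coprime_fib_den[of y] by simp
  hence "degree (denpoly y) = 0" by (rule is_unit_degree_0)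
  with \<open>fibpoly y = 0\<close> max_deg_fib_den[of y] N_pos show False by simp
qed

lemma f_Some_iff: "f (Some z) = y \<longleftrightarrow> poly (fibpoly y) z = 0"
proof (cases y)
  case None
  thus ?thesis by (simp add: rat_map_def fibpoly_def)
next
  case (Some c)
  thus ?thesis using no_common_root[of z]
    by (auto simp: rat_map_def fibpoly_def field_simps)
qed

lemma f_None_iff: "f None = y \<longleftrightarrow> degree (fibpoly y) < N"
proof (cases y)
  case None
  thus ?thesis by (auto simp: rat_map_def fibpoly_def N_def)
next
  case (Some c)
  have le: "degree (p - smult c q) \<le> N" using max_deg_fib_den[of y] Some by (simp add: fibpoly_def)
  show ?thesis
  proof (cases "degree p > degree q")
    case True
    hence "degree (p - smult c q) = degree p"
      by (metis degree_smult_le diff_conv_add_uminus degree_add_eq_left degree_minus le_less_trans)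
    thus ?thesis using True Some by (simp add: rat_map_def fibpoly_def N_def)
  next
    case False
    hence N: "N = degree q" by (simp add: N_def)
    have "degree (p - smult c q) < N \<longleftrightarrow> coeff (p - smult c q) N = 0"
      using le N_pos by (metis coeff_eq_0 leading_coeff_0_iff degree_0 le_neq_implies_less)
    also have "\<dots> \<longleftrightarrow> coeff p N / lead_coeff q = c" using q_nz N by (auto simp: field_simps)
    finally show ?thesis using False Some N by (simp add: rat_map_def fibpoly_def)
  qed
qed

lemma mul_pos: "mul x > 0"
proof (cases x)
  case None
  thus ?thesis using f_None_iff[of "f x"] by (simp add: mul_def)
next
  case (Some z)
  hence "poly (fibpoly (f x)) z = 0" using f_Some_iff by blast
  thus ?thesis using Some fib_nz order_root[of "fibpoly (f x)" z] by (simp add: mul_def)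
qed

lemma finite_fibre: "finite {x. f x = y}"
proof -
  have "finite {z. poly (fibpoly y) z = 0}" using fib_nz poly_roots_finite by blast
  moreover have "{x. f x = y} \<subseteq> insert None (Some ` {z. poly (fibpoly y) z = 0})"
  proof
    fix x assume "x \<in> {x. f x = y}"
    thus "x \<in> insert None (Some ` {z. poly (fibpoly y) z = 0})"
      using f_Some_iff by (cases x) auto
  qed
  ultimately show ?thesis using finite_subset by blast
qed

text \<open>Over the complex numbers the orders of the roots of \<open>fibpoly y\<close> add up to its degree, and the
  point at infinity makes up for the difference to \<open>N\<close>.\<close>

lemma sum_mul_fibre: "(\<Sum>x | f x = y. mul x) = N"
proof -
  let ?R = "{z. poly (fibpoly y) z = 0}"
  have fin: "finite ?R" using fib_nz poly_roots_finite by blast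
  have S: "(\<Sum>x\<in>Some ` ?R. mul x) = degree (fibpoly y)"
  proof -
    have "(\<Sum>x\<in>Some ` ?R. mul x) = (\<Sum>z\<in>?R. mul (Some z))"
      by (subst sum.reindex) auto
    also have "\<dots> = (\<Sum>z\<in>?R. order z (fibpoly y))"
      using f_Some_iff[of _ y, THEN iffD2] by (intro sum.cong) (simp_all add: mul_def)
    finally show ?thesis using order_sum_eq_degree[OF fib_nz] by simp
  qed
  have le: "degree (fibpoly y) \<le> N" using max_deg_fib_den[of y] by simp
  show ?thesis
  proof (cases "f None = y")
    case True
    have "{x. f x = y} = insert None (Some ` ?R)"
      using True f_Some_iff by (auto simp: image_iff) (metis not_Some_eq)
    thus ?thesis using S fin le True by (simp add: mul_def)
  next
    case False
    have "{x. f x = y} = Some ` ?R"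
      using False f_Some_iff by (auto simp: image_iff) (metis not_Some_eq)
    thus ?thesis using S False f_None_iff[of y] le by simp
  qed
qed

lemma surj_f: "\<exists>x. f x = y"
proof (rule ccontr)
  assume "\<not> ?thesis"
  hence "{x. f x = y} = {}" by auto
  with sum_mul_fibre[of y] N_pos show False by simp
qed

lemma f_Some_quot:
  assumes "poly (denpoly y) z \<noteq> 0"
  shows "f (Some z) \<noteq> antipode y" "chart y (f (Some z)) = poly (fibpoly y) z / poly (denpoly y) z"
  using assms by (cases y; auto simp: antipode_def rat_map_def denpoly_def fibpoly_def chart_def sphere_inv_def field_simps)+

text \<open>The local form of a rational function in the two charts. At a finite point the power of the
  coordinate is split off \<open>fibpoly\<close>; at infinity it appears when numerator and denominator are
  replaced by their reflected polynomials.\<close>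

lemma local_quotient:
  obtains A B where "poly A 0 \<noteq> 0" "poly B 0 \<noteq> 0"
    "\<And>w. poly B w \<noteq> 0 \<Longrightarrow> f (unchart x w) \<noteq> antipode (f x)"
    "\<And>w. poly B w \<noteq> 0 \<Longrightarrow> chart (f x) (f (unchart x w)) = w ^ mul x * poly A w / poly B w"
proof (cases x)
  case (Some a)
  let ?y = "f x"
  obtain B where B: "fibpoly ?y = [:- a, 1:] ^ order a (fibpoly ?y) * B" "\<not> [:- a, 1:] dvd B"
    using order_decomp[OF fib_nz[of ?y], of a] by blast
  have r: "poly (fibpoly ?y) a = 0" using f_Some_iff Some by blast
  hence d: "poly (denpoly ?y) a \<noteq> 0"
    using coprime_fib_den[of ?y] coprime_poly_0 by blast
  show ?thesis
  proof (rule that[of "pcompose B [:a, 1:]" "pcompose (denpoly ?y) [:a, 1:]"])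
    show "poly (pcompose B [:a, 1:]) 0 \<noteq> 0" using B(2) by (simp add: poly_pcompose poly_eq_0_iff_dvd)
    show "poly (pcompose (denpoly ?y) [:a, 1:]) 0 \<noteq> 0" using d by (simp add: poly_pcompose)
    fix w assume w: "poly (pcompose (denpoly ?y) [:a, 1:]) w \<noteq> 0"
    hence w': "poly (denpoly ?y) (w + a) \<noteq> 0" by (simp add: poly_pcompose add.commute)
    show "f (unchart x w) \<noteq> antipode (f x)" using f_Some_quot(1)[OF w'] Some by (simp add: unchart_def)
    have "poly (fibpoly ?y) (w + a) = w ^ mul x * poly B (w + a)"
      by (subst B(1)) (simp add: Some mul_def)
    thus "chart (f x) (f (unchart x w)) = w ^ mul x * poly (pcompose B [:a, 1:]) w / poly (pcompose (denpoly ?y) [:a, 1:]) w"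
      using f_Some_quot(2)[OF w'] Some by (simp add: unchart_def poly_pcompose add.commute)
  qed
next
  case None
  let ?y = "f x"
  have lt: "degree (fibpoly ?y) < N" using f_None_iff None by blast
  hence dN: "degree (denpoly ?y) = N" using max_deg_fib_den[of ?y] by linarith
  show ?thesis
  proof (rule that[of "reflect_poly (fibpoly ?y)" "reflect_poly (denpoly ?y)"])
    show "poly (reflect_poly (fibpoly ?y)) 0 \<noteq> 0" using fib_nz by (simp add: reflect_poly_at_0_eq_0_iff)
    show "poly (reflect_poly (denpoly ?y)) 0 \<noteq> 0" using dN N_pos by (metis degree_0 less_irrefl reflect_poly_at_0_eq_0_iff)
    fix w assume w: "poly (reflect_poly (denpoly ?y)) w \<noteq> 0"
    show "f (unchart x w) \<noteq> antipode (f x)"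
    proof (cases "w = 0")
      case False
      hence "poly (denpoly ?y) (inverse w) \<noteq> 0" using w by (simp add: poly_reflect_poly_nz)
      from f_Some_quot(1)[OF this] None False show ?thesis by (simp add: unchart_def)
    qed (use antipode_neq[of "f x", symmetric] in simp)
    show "chart (f x) (f (unchart x w)) = w ^ mul x * poly (reflect_poly (fibpoly ?y)) w / poly (reflect_poly (denpoly ?y)) w"
    proof (cases "w = 0")
      case True
      thus ?thesis using mul_pos[of x] by simp
    next
      case False
      hence nz: "poly (denpoly ?y) (inverse w) \<noteq> 0" using w by (simp add: poly_reflect_poly_nz)
      have "w ^ mul x * w ^ degree (fibpoly ?y) = w ^ N"
        using lt None by (simp add: mul_def flip: power_add)
      thus ?thesis using f_Some_quot(2)[OF nz] None False nz dN
        by (simp add: unchart_def poly_reflect_poly_nz divide_simps) (simp add: mult_ac)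
    qed
  qed
qed

lemma mult_at_eq_mul: "mult_at f x = int (mul x)"
proof -
  define a where "a = (case x of None \<Rightarrow> 0 | Some z \<Rightarrow> z)"
  have eq: "mult_at f x = zorder (\<lambda>w. chart (f x) (f (unchart x (w - a)))) a"
    unfolding mult_at_def Let_def
    by (cases x; cases "f x"; simp add: a_def chart_def unchart_def o_def)
  obtain A B where AB: "poly A 0 \<noteq> 0" "poly B 0 \<noteq> 0"
    "\<And>w. poly B w \<noteq> 0 \<Longrightarrow> chart (f x) (f (unchart x w)) = w ^ mul x * poly A w / poly B w"
    using local_quotient[of x] by metis
  show ?thesis unfolding eq
  proof (rule zorder_eqI[where S = "{w. poly B (w - a) \<noteq> 0}" and g = "\<lambda>w. poly A (w - a) / poly B (w - a)"])
    show "open {w. poly B (w - a) \<noteq> 0}" by (intro open_Collect_neq continuous_intros)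
    show "(\<lambda>w. poly A (w - a) / poly B (w - a)) holomorphic_on {w. poly B (w - a) \<noteq> 0}"
      by (auto intro!: holomorphic_intros)
  qed (use AB in auto)
qed

lemma continuous_f: "continuous_on UNIV f"
proof -
  have "\<exists>U. open U \<and> x \<in> U \<and> continuous_on U f" for x
  proof -
    obtain A B where AB: "poly B 0 \<noteq> 0"
      "\<And>w. poly B w \<noteq> 0 \<Longrightarrow> f (unchart x w) \<noteq> antipode (f x)"
      "\<And>w. poly B w \<noteq> 0 \<Longrightarrow> chart (f x) (f (unchart x w)) = w ^ mul x * poly A w / poly B w"
      using local_quotient[of x] by metis
    let ?O = "{w. poly B w \<noteq> 0}"
    let ?h = "\<lambda>w. w ^ mul x * poly A w / poly B w"
    have op: "open ?O" by (intro open_Collect_neq continuous_intros)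
    have "continuous_on (unchart x ` ?O) (\<lambda>u. unchart (f x) (?h (chart x u)))"
    proof (rule continuous_on_compose2[OF continuous_on_unchart[of UNIV]])
      have "continuous_on (unchart x ` ?O) (chart x)"
        by (intro continuous_on_subset[OF continuous_on_chart]) (use unchart_neq_antipode in fastforce)
      moreover have "continuous_on ?O ?h" by (auto intro!: continuous_intros)
      ultimately show "continuous_on (unchart x ` ?O) (\<lambda>u. ?h (chart x u))"
        using continuous_on_compose2[of ?O ?h "unchart x ` ?O" "chart x"] by fastforce
    qed auto
    moreover have "unchart (f x) (?h (chart x u)) = f u" if "u \<in> unchart x ` ?O" for u
      using that AB by (auto simp: unchart_chart simp flip: AB(3))
    ultimately have "continuous_on (unchart x ` ?O) f" by (simp cong: continuous_on_cong)
    moreover have "x \<in> unchart x ` ?O" using AB(1) by (auto intro!: image_eqI[of _ _ 0])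
    ultimately show ?thesis using open_image_unchart[OF op] by blast
  qed
  then obtain U where U: "\<And>x. open (U x)" "\<And>x. x \<in> U x" "\<And>x. continuous_on (U x) f" by metis
  have "continuous_on (\<Union>x\<in>UNIV. U x) f" by (rule continuous_on_open_UN) (use U in auto)
  moreover have "(\<Union>x\<in>UNIV. U x) = UNIV" using U(2) by auto
  ultimately show ?thesis by simp
qed

section \<open>The Riemann--Hurwitz inequality\<close>

text \<open>The numerator of the derivative of \<open>p/q\<close>; up to sign it does not change when \<open>p/q\<close> is read in
  another chart of the target. A point of multiplicity \<open>m\<close> is a root of order at least \<open>m - 1\<close>, and
  ramification at infinity lowers the degree.\<close>

definition wronskian where "wronskian = pderiv p * q - p * pderiv q"

lemma wronskian_fib:
  "pderiv (fibpoly y) * denpoly y - fibpoly y * pderiv (denpoly y) = wronskian \<or>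
   pderiv (fibpoly y) * denpoly y - fibpoly y * pderiv (denpoly y) = - wronskian"
  by (cases y) (auto simp: fibpoly_def denpoly_def wronskian_def pderiv_diff pderiv_smult algebra_simps)

lemma wronskian_nz: "wronskian \<noteq> 0"
proof
  assume 0: "wronskian = 0"
  let ?y = "f (Some 0)"
  let ?F = "fibpoly ?y" and ?D = "denpoly ?y"
  have e: "pderiv ?F * ?D = ?F * pderiv ?D" using wronskian_fib[of ?y] 0 by auto
  have r: "poly ?F 0 = 0" using f_Some_iff by blast
  hence D: "poly ?D 0 \<noteq> 0" using coprime_fib_den[of ?y] coprime_poly_0 by blast
  hence D0: "?D \<noteq> 0" by auto
  have F': "pderiv ?F \<noteq> 0"
  proof
    assume "pderiv ?F = 0"
    then obtain c where "?F = [:c:]" using pderiv_iszero by blast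
    with r fib_nz[of ?y] show False by simp
  qed
  hence nz: "pderiv ?F * ?D \<noteq> 0" using D0 by simp
  have "order 0 (pderiv ?F * ?D) = order 0 (pderiv ?F) + order 0 ?D" by (rule order_mult[OF nz])
  also have "order 0 ?D = 0" using D by (simp add: order_root)
  finally have 1: "order 0 (pderiv ?F * ?D) < order 0 ?F" using order_pderiv[OF fib_nz r] by simp
  have "order 0 (?F * pderiv ?D) = order 0 ?F + order 0 (pderiv ?D)" using order_mult nz e by metis
  with 1 e show False by simp
qed

lemma degree_wronskian: "degree wronskian + mul None + 1 \<le> 2 * N"
proof -
  let ?y = "f None"
  let ?F = "fibpoly ?y" and ?D = "denpoly ?y"
  have lt: "degree ?F < N" using f_None_iff by blast
  have dN: "degree ?D = N" using max_deg_fib_den[of ?y] lt by linarith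
  have "degree (pderiv ?F * ?D) \<le> degree ?F + N - 1"
  proof (cases "degree ?F = 0")
    case True
    hence "pderiv ?F = 0" by (simp add: pderiv_eq_0_iff)
    thus ?thesis by simp
  next
    case False
    thus ?thesis using degree_mult_le[of "pderiv ?F" ?D] dN by (simp add: degree_pderiv)
  qed
  moreover have "degree (?F * pderiv ?D) \<le> degree ?F + N - 1"
    using degree_mult_le[of ?F "pderiv ?D"] dN N_pos by (simp add: degree_pderiv)
  ultimately have "degree (pderiv ?F * ?D - ?F * pderiv ?D) \<le> degree ?F + N - 1"
    by (rule degree_diff_le)
  hence "degree wronskian \<le> degree ?F + N - 1"
    using wronskian_fib[of ?y] by auto
  thus ?thesis using lt by (simp add: mul_def)
qed

lemma order_wronskian: "mul (Some z) - 1 \<le> order z wronskian"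
proof -
  let ?y = "f (Some z)"
  let ?F = "fibpoly ?y" and ?D = "denpoly ?y"
  define n where "n = mul (Some z) - 1"
  have m: "mul (Some z) = Suc n" using mul_pos[of "Some z"] by (simp add: n_def)
  have "[:- z, 1:] ^ Suc n dvd ?F" using m order_1[of z ?F] by (simp add: mul_def)
  hence "[:- z, 1:] ^ n dvd pderiv ?F" "[:- z, 1:] ^ n dvd ?F"
    by (rule linear_power_dvd_pderiv, rule power_le_dvd) simp
  hence "[:- z, 1:] ^ n dvd (pderiv ?F * ?D - ?F * pderiv ?D)"
    by (intro dvd_diff dvd_mult2)
  hence "[:- z, 1:] ^ n dvd wronskian" using wronskian_fib[of ?y] by auto
  thus ?thesis unfolding n_def[symmetric] using wronskian_nz by (simp add: order_divides)
qed

lemma riemann_hurwitz_le: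
  assumes "finite A"
  shows "(\<Sum>x\<in>A. mul x - 1) \<le> 2 * N - 2"
proof -
  define B where "B = Some -` A"
  have finB: "finite B" using assms by (simp add: B_def finite_vimageI)
  have "(\<Sum>x\<in>A. mul x - 1) \<le> (\<Sum>x\<in>insert None (Some ` B). mul x - 1)"
  proof (rule sum_mono2)
    show "A \<subseteq> insert None (Some ` B)"
    proof
      fix x assume "x \<in> A"
      thus "x \<in> insert None (Some ` B)" by (cases x) (auto simp: B_def)
    qed
  qed (use finB in auto)
  also have "\<dots> = mul None - 1 + (\<Sum>z\<in>B. mul (Some z) - 1)"
    using finB by (simp add: sum.reindex)
  finally have 1: "(\<Sum>x\<in>A. mul x - 1) \<le> mul None - 1 + (\<Sum>z\<in>B. mul (Some z) - 1)" .
  have "(\<Sum>z\<in>B. mul (Some z) - 1) \<le> (\<Sum>z\<in>B. order z wronskian)"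
    by (intro sum_mono order_wronskian)
  also have "\<dots> \<le> degree wronskian" by (rule order_sum_le_degree[OF wronskian_nz finB])
  finally show ?thesis using 1 degree_wronskian mul_pos[of None] by linarith
qed

lemma finite_ramified: "finite {x. mul x \<noteq> 1}"
proof (rule ccontr)
  assume "infinite {x. mul x \<noteq> 1}"
  then obtain A where A: "finite A" "card A = 2 * N - 1" "A \<subseteq> {x. mul x \<noteq> 1}"
    using infinite_arbitrarily_large by blast
  have "card A = (\<Sum>x\<in>A. 1)" by simp
  also have "\<dots> \<le> (\<Sum>x\<in>A. mul x - 1)"
  proof (rule sum_mono)
    fix x assume "x \<in> A"
    hence "mul x \<noteq> 1" using A(3) by auto
    thus "1 \<le> mul x - 1" using mul_pos[of x] by simp
  qed
  also have "\<dots> \<le> 2 * N - 2" by (rule riemann_hurwitz_le[OF A(1)])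
  finally show False using A(2) N_pos by simp
qed

end

section \<open>Local structure of rational functions\<close>

lemma separate_finite_t2:
  fixes X :: "'a::t2_space set"
  assumes "finite X"
  obtains T where "\<And>x. x \<in> X \<Longrightarrow> open (T x) \<and> x \<in> T x" 
    "\<And>x y. x \<in> X \<Longrightarrow> y \<in> X \<Longrightarrow> x \<noteq> y \<Longrightarrow> T x \<inter> T y = {}"
proof -
  \<comment> \<open>the neighbourhood of a point is the intersection of those separating it from each other point\<close>
  have "\<exists>U V. x \<noteq> y \<longrightarrow> open U \<and> open V \<and> x \<in> U \<and> y \<in> V \<and> U \<inter> V = {}" for x y :: 'a
    using hausdorff by metis
  then obtain U V where UV: "\<And>x y :: 'a. x \<noteq> y \<Longrightarrow> open (U x y) \<and> open (V x y) \<and> x \<in> U x y \<and> y \<in> V x y \<and> U x y \<inter> V x y = {}"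
    by metis
  show ?thesis
  proof (rule that[of "\<lambda>x. (\<Inter>y\<in>X - {x}. U x y \<inter> V y x)"])
    fix x assume "x \<in> X"
    show "open (\<Inter>y\<in>X - {x}. U x y \<inter> V y x) \<and> x \<in> (\<Inter>y\<in>X - {x}. U x y \<inter> V y x)"
    proof
      show "open (\<Inter>y\<in>X - {x}. U x y \<inter> V y x)"
        using assms UV by (intro open_INT ballI open_Int) auto
      show "x \<in> (\<Inter>y\<in>X - {x}. U x y \<inter> V y x)"
      proof
        fix y assume "y \<in> X - {x}"
        thus "x \<in> U x y \<inter> V y x" using UV[of x y] UV[of y x] by blast
      qed
    qed
  next
    fix x y assume xy: "x \<in> X" "y \<in> X" "x \<noteq> y"
    have "(\<Inter>z\<in>X - {x}. U x z \<inter> V z x) \<subseteq> U x y" using xy by blast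
    moreover have "(\<Inter>z\<in>X - {y}. U y z \<inter> V z y) \<subseteq> V x y" using xy by blast
    ultimately show "(\<Inter>z\<in>X - {x}. U x z \<inter> V z x) \<inter> (\<Inter>z\<in>X - {y}. U y z \<inter> V z y) = {}"
      using UV[OF xy(3)] by blast
  qed
qed

lemma connected_subset_disjoint_opens:
  fixes C :: "'a::topological_space set"
  assumes "connected C" "C \<subseteq> (\<Union>x\<in>X. T x)" "\<And>x. x \<in> X \<Longrightarrow> open (T x)"
    and disj: "\<And>x y. x \<in> X \<Longrightarrow> y \<in> X \<Longrightarrow> x \<noteq> y \<Longrightarrow> T x \<inter> T y = {}"
    and "x \<in> X" "C \<inter> T x \<noteq> {}"
  shows "C \<subseteq> T x"
proof -
  have "open (T x)" "open (\<Union>y\<in>X - {x}. T y)" using assms by auto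
  moreover have "T x \<inter> (\<Union>y\<in>X - {x}. T y) \<inter> C = {}" using disj \<open>x \<in> X\<close> by blast
  moreover have "C \<subseteq> T x \<union> (\<Union>y\<in>X - {x}. T y)" using assms(2) by blast
  ultimately have "T x \<inter> C = {} \<or> (\<Union>y\<in>X - {x}. T y) \<inter> C = {}"
    using connectedD[OF \<open>connected C\<close>] by blast
  thus ?thesis using assms(2,6) by blast
qed

context ratfun begin

text \<open>The complement of the neighbourhoods is compact, so its image is closed and misses a
  neighbourhood of \<open>y\<close>.\<close>

lemma near_fibre:
  assumes "\<And>x. f x = y \<Longrightarrow> open (T x) \<and> x \<in> T x"
  shows "\<forall>\<^sub>F w in nhds y. \<forall>u. f u = w \<longrightarrow> (\<exists>x. f x = y \<and> u \<in> T x)"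
proof -
  define K where "K = - (\<Union>x\<in>{x. f x = y}. T x)"
  have "closed K" unfolding K_def using assms by (intro closed_Compl open_UN) auto
  hence "compact K" using compact_UNIV_sphere compact_Int_closed[of UNIV K] by simp
  hence "compact (f ` K)" using continuous_f by (meson compact_continuous_image continuous_on_subset subset_UNIV)
  hence "closed (f ` K)" by (rule compact_imp_closed)
  moreover have "y \<notin> f ` K" using assms by (auto simp: K_def)
  ultimately have "\<forall>\<^sub>F w in nhds y. w \<notin> f ` K" 
    using eventually_nhds[of "\<lambda>w. w \<notin> f ` K" y] by (metis ComplD ComplI open_Compl)
  thus ?thesis by eventually_elim (auto simp: K_def)
qed

text \<open>If \<open>f \<circ> \<psi>\<close> tends to \<open>y\<close>, then \<open>\<psi>\<close> eventually stays in a union of small disjoint neighbourhoods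
  of the finitely many points over \<open>y\<close>. A connected set on which this holds is mapped into one of
  them, and this one does not change when the neighbourhoods shrink.\<close>

lemma lift_limit:
  fixes F :: "'a::topological_space filter"
  assumes "F \<noteq> bot" and lim: "((\<lambda>a. f (\<psi> a)) \<longlongrightarrow> y) F"
    and basis: "\<And>P. eventually P F \<Longrightarrow> \<exists>C. connected C \<and> eventually (\<lambda>a. a \<in> C) F \<and> (\<forall>a\<in>C. P a)"
    and cont: "continuous_on S \<psi>" "\<forall>\<^sub>F a in F. a \<in> S"
  obtains x where "f x = y" "(\<psi> \<longlongrightarrow> x) F"
proof -
  let ?X = "{x. f x = y}"
  obtain T where T: "\<And>x. x \<in> ?X \<Longrightarrow> open (T x) \<and> x \<in> T x" 
    "\<And>x y. x \<in> ?X \<Longrightarrow> y \<in> ?X \<Longrightarrow> x \<noteq> y \<Longrightarrow> T x \<inter> T y = {}"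
    using separate_finite_t2[OF finite_fibre[of y]] by metis
  have key: "\<exists>x\<in>?X. \<forall>\<^sub>F a in F. \<psi> a \<in> T' x" 
    if T': "\<And>x. x \<in> ?X \<Longrightarrow> open (T' x) \<and> x \<in> T' x \<and> T' x \<subseteq> T x" for T'
  proof -
    have "\<forall>\<^sub>F w in nhds y. \<forall>u. f u = w \<longrightarrow> (\<exists>x. f x = y \<and> u \<in> T' x)"
      using near_fibre[of y T'] T' by blast
    hence "\<forall>\<^sub>F a in F. \<exists>x. f x = y \<and> \<psi> a \<in> T' x"
      using lim unfolding filterlim_iff by (smt (verit) eventually_mono)
    hence "\<forall>\<^sub>F a in F. (\<exists>x. f x = y \<and> \<psi> a \<in> T' x) \<and> a \<in> S" using cont(2) by (rule eventually_conj)
    from basis[OF this] obtain C where C: "connected C" "eventually (\<lambda>a. a \<in> C) F"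
      "\<And>a. a \<in> C \<Longrightarrow> (\<exists>x. f x = y \<and> \<psi> a \<in> T' x) \<and> a \<in> S" by auto
    have "connected (\<psi> ` C)" 
      using C by (intro connected_continuous_image continuous_on_subset[OF cont(1)]) auto
    moreover obtain a where "a \<in> C" using C(2) \<open>F \<noteq> bot\<close> eventually_happens by blast
    with C(3) obtain x where x: "f x = y" "\<psi> a \<in> T' x" by blast
    have disj: "T' x \<inter> T' y = {}" if "x \<in> ?X" "y \<in> ?X" "x \<noteq> y" for x y 
      using T' T(2) that by blast
    have "\<psi> ` C \<subseteq> T' x"
    proof (rule connected_subset_disjoint_opens[where X = ?X and T = T'])
      show "connected (\<psi> ` C)" by fact
      show "\<psi> ` C \<subseteq> (\<Union>x\<in>?X. T' x)" using C(3) by blast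
      show "\<psi> ` C \<inter> T' x \<noteq> {}" using x(2) \<open>a \<in> C\<close> by blast
    qed (use T' disj x(1) in auto)
    hence "\<forall>\<^sub>F a in F. \<psi> a \<in> T' x" by (intro eventually_mono[OF C(2)]) blast
    thus ?thesis using x by blast
  qed
  obtain x where x: "x \<in> ?X" "\<forall>\<^sub>F a in F. \<psi> a \<in> T x" using key[of T] T by blast
  show ?thesis
  proof (rule that[of x])
    show "f x = y" using x by simp
    show "(\<psi> \<longlongrightarrow> x) F"
    proof (rule topological_tendstoI)
      fix U assume U: "open U" "x \<in> U"
      obtain x' where x': "x' \<in> ?X" "\<forall>\<^sub>F a in F. \<psi> a \<in> (if x' = x then T x \<inter> U else T x')"
      proof -
        have "\<exists>x'\<in>?X. \<forall>\<^sub>F a in F. \<psi> a \<in> (if x' = x then T x \<inter> U else T x')"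
          by (rule key) (use T(1) U in \<open>auto split: if_splits\<close>)
        thus ?thesis using that by blast
      qed
      have "\<forall>\<^sub>F a in F. \<psi> a \<in> T x \<and> \<psi> a \<in> (if x' = x then T x \<inter> U else T x')"
        using x(2) x'(2) by (rule eventually_conj)
      hence "\<exists>a. \<psi> a \<in> T x \<and> \<psi> a \<in> (if x' = x then T x \<inter> U else T x')"
        using \<open>F \<noteq> bot\<close> eventually_happens by blast
      hence "x' = x" using T(2)[OF x'(1) x(1)] by (auto split: if_splits)
      thus "\<forall>\<^sub>F a in F. \<psi> a \<in> U" using x'(2) by (auto elim: eventually_mono)
    qed
  qed
qed

text \<open>The nonvanishing factor in \<open>local_quotient\<close> has a holomorphic root of order \<open>mul x\<close>, so that \<open>f\<close> is
  the power of a function with nonzero derivative, which is then used as local coordinate.\<close>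

lemma normal_form:
  assumes "open T" "x \<in> T"
  obtains U \<phi> \<phi>' r where "r > 0" "open U" "x \<in> U" "U \<subseteq> T"
    "homeomorphism U (ball 0 r) \<phi> \<phi>'" "\<phi> x = (0::complex)"
    "\<And>u. u \<in> U \<Longrightarrow> f u \<noteq> antipode (f x)"
    "\<And>u. u \<in> U \<Longrightarrow> chart (f x) (f u) = \<phi> u ^ mul x"
proof -
  obtain A B where AB: "poly A 0 \<noteq> 0" "poly B 0 \<noteq> 0"
      "\<And>w. poly B w \<noteq> 0 \<Longrightarrow> f (unchart x w) \<noteq> antipode (f x)"
      "\<And>w. poly B w \<noteq> 0 \<Longrightarrow> chart (f x) (f (unchart x w)) = w ^ mul x * poly A w / poly B w"
    using local_quotient[of x] by metis
  have "open ({w. poly B w \<noteq> 0} \<inter> {w. poly A w \<noteq> 0} \<inter> unchart x -` T)"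
    by (intro open_Int open_Collect_neq continuous_intros open_vimage assms continuous_on_unchart)
  moreover have "0 \<in> {w. poly B w \<noteq> 0} \<inter> {w. poly A w \<noteq> 0} \<inter> unchart x -` T" using AB assms by simp
  ultimately obtain e where e: "e > 0" "ball 0 e \<subseteq> {w. poly B w \<noteq> 0} \<inter> {w. poly A w \<noteq> 0} \<inter> unchart x -` T"
    using open_contains_ball by blast
  have hol: "(\<lambda>w. poly A w / poly B w) holomorphic_on ball 0 e"
    using e by (auto intro!: holomorphic_intros)
  have "contractible (ball (0::complex) e)" by (simp add: convex_imp_contractible)
  then obtain L where L: "L holomorphic_on ball 0 e" "\<And>z. z \<in> ball 0 e \<Longrightarrow> poly A z / poly B z = exp (L z)"
  proof (rule contractible_imp_holomorphic_log[OF hol])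
    fix z :: complex assume "z \<in> ball 0 e"
    thus "poly A z / poly B z \<noteq> 0" using e(2) by auto
  qed blast
  define k where "k = (\<lambda>w. w * exp (L w / of_nat (mul x)))"
  have khol: "k holomorphic_on ball 0 e" unfolding k_def using L(1) mul_pos[of x] by (auto intro!: holomorphic_intros)
  have kpow: "k w ^ mul x = w ^ mul x * poly A w / poly B w" if "w \<in> ball 0 e" for w
  proof -
    have "exp (L w / of_nat (mul x)) ^ mul x = exp (L w)"
      using mul_pos[of x] by (simp flip: exp_of_nat_mult)
    thus ?thesis using L(2)[OF that] by (simp add: k_def power_mult_distrib flip: times_divide_eq_right)
  qed
  have "(k has_field_derivative 0 * deriv (\<lambda>w. exp (L w / of_nat (mul x))) 0 + 1 * exp (L 0 / of_nat (mul x))) (at 0)"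
  proof -
    have "(\<lambda>w. exp (L w / of_nat (mul x))) holomorphic_on ball 0 e" using L(1) mul_pos[of x] by (auto intro!: holomorphic_intros)
    hence "((\<lambda>w. exp (L w / of_nat (mul x))) has_field_derivative deriv (\<lambda>w. exp (L w / of_nat (mul x))) 0) (at 0)"
      using e(1) by (intro holomorphic_derivI[of _ "ball 0 e"]) auto
    from DERIV_mult[OF DERIV_ident this] show ?thesis unfolding k_def by (simp add: mult.commute)
  qed
  hence "deriv k 0 \<noteq> 0" by (simp add: DERIV_imp_deriv)
  then obtain s where s: "s > 0" "ball (0::complex) s \<subseteq> ball 0 e" "open (k ` ball 0 s)" "inj_on k (ball 0 s)"
    by (rule has_complex_derivative_locally_invertible[OF khol _ open_ball, of 0, rotated]) (use e(1) in auto)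
  have "k holomorphic_on ball 0 s" using khol s(2) holomorphic_on_subset by blast
  then obtain g where g: "g holomorphic_on k ` ball 0 s" "\<And>z. z \<in> ball 0 s \<Longrightarrow> g (k z) = z"
    by (rule holomorphic_has_inverse[OF _ open_ball s(4)]) blast
  have "k 0 = 0" by (simp add: k_def)
  hence "0 \<in> k ` ball 0 s" using s(1) by (metis centre_in_ball imageI)
  then obtain r where r: "r > 0" "ball 0 r \<subseteq> k ` ball 0 s" using s(3) open_contains_ball by blast
  define V where "V = ball 0 s \<inter> k -` ball 0 r"
  have "open V" unfolding V_def
    by (rule continuous_open_preimage) (use \<open>k holomorphic_on ball 0 s\<close> holomorphic_on_imp_continuous_on in auto)
  have kV: "k ` V = ball 0 r" using r(2) unfolding V_def by auto
  have VB: "poly B w \<noteq> 0 \<and> unchart x w \<in> T \<and> w \<in> ball 0 e \<and> w \<in> ball 0 s" if "w \<in> V" for w 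
    using that e(2) s(2) by (auto simp: V_def)
  show ?thesis
  proof (rule that[of r "unchart x ` V" "\<lambda>u. k (chart x u)" "\<lambda>z. unchart x (g z)"])
    show "open (unchart x ` V)" by (rule open_image_unchart) fact
    show "x \<in> unchart x ` V" using s(1) r(1) \<open>k 0 = 0\<close> by (intro image_eqI[of _ _ 0]) (auto simp: V_def)
    show "unchart x ` V \<subseteq> T" using VB by auto
    show "homeomorphism (unchart x ` V) (ball 0 r) (\<lambda>u. k (chart x u)) (\<lambda>z. unchart x (g z))"
    proof (rule homeomorphismI)
      have "continuous_on V k" using khol VB by (intro holomorphic_on_imp_continuous_on holomorphic_on_subset[OF khol]) auto
      moreover have "continuous_on (unchart x ` V) (chart x)"
        by (intro continuous_on_subset[OF continuous_on_chart]) (use unchart_neq_antipode in fastforce)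
      ultimately show "continuous_on (unchart x ` V) (\<lambda>u. k (chart x u))"
        using continuous_on_compose2[of V k "unchart x ` V" "chart x"] by fastforce
      have "continuous_on (ball 0 r) g" using g(1) r(2) holomorphic_on_imp_continuous_on continuous_on_subset by blast
      thus "continuous_on (ball 0 r) (\<lambda>z. unchart x (g z))"
        using continuous_on_compose2[OF continuous_on_unchart[of UNIV x]] by blast
      show "(\<lambda>u. k (chart x u)) ` unchart x ` V \<subseteq> ball 0 r" using kV by (auto simp: image_image)
      show "(\<lambda>z. unchart x (g z)) ` ball 0 r \<subseteq> unchart x ` V"
        unfolding kV[symmetric] using g(2) VB by auto
      show "unchart x (g (k (chart x u))) = u" if "u \<in> unchart x ` V" for u
        using that g(2) VB by auto
      show "k (chart x (unchart x (g z))) = z" if "z \<in> ball 0 r" for z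
        using that g(2) VB unfolding kV[symmetric] by auto
    qed
  qed (use r(1) \<open>k 0 = 0\<close> VB AB(3) AB(4) kpow in auto)
qed

lemma eventually_card_fibre:
  assumes "open T" "x \<in> T"
  obtains U where "open U" "x \<in> U" "U \<subseteq> T" 
    "\<forall>\<^sub>F w in at (f x). card {u\<in>U. f u = w} = mul x"
proof -
  obtain U \<phi> \<phi>' r where U: "r > 0" "open U" "x \<in> U" "U \<subseteq> T"
    "homeomorphism U (ball 0 r) \<phi> \<phi>'" "\<phi> x = (0::complex)"
    "\<And>u. u \<in> U \<Longrightarrow> f u \<noteq> antipode (f x)"
    "\<And>u. u \<in> U \<Longrightarrow> chart (f x) (f u) = \<phi> u ^ mul x"
    using normal_form[OF assms] by metis
  let ?W = "unchart (f x) ` ball 0 (r ^ mul x)"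
  have "card {u\<in>U. f u = w} = mul x" if w: "w \<in> ?W" "w \<noteq> f x" for w
  proof -
    obtain c where c: "w = unchart (f x) c" "norm c < r ^ mul x" using w by auto
    have "c \<noteq> 0" using w c by auto
    have "bij_betw \<phi>' {z. z ^ mul x = c} {u\<in>U. f u = w}"
    proof (rule bij_betw_byWitness[where f' = \<phi>])
      have small: "z \<in> ball 0 r" if "z ^ mul x = c" for z
      proof -
        have "norm z ^ mul x < r ^ mul x" using that c(2) by (simp flip: norm_power)
        thus ?thesis using U(1) by (simp add: power_less_imp_less_base)
      qed
      show "\<forall>z\<in>{z. z ^ mul x = c}. \<phi> (\<phi>' z) = z" using small U(5) by (simp add: homeomorphism_def)
      show "\<forall>u\<in>{u \<in> U. f u = w}. \<phi>' (\<phi> u) = u" using U(5) by (simp add: homeomorphism_def)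
      show "\<phi>' ` {z. z ^ mul x = c} \<subseteq> {u \<in> U. f u = w}"
      proof
        fix u assume "u \<in> \<phi>' ` {z. z ^ mul x = c}"
        then obtain z where z: "z ^ mul x = c" "u = \<phi>' z" by auto
        hence u: "u \<in> U" "\<phi> u = z" using small U(5) by (auto simp: homeomorphism_def)
        hence "chart (f x) (f u) = c" using U(8) z by simp
        hence "f u = w" using c unchart_chart[OF U(7)[OF u(1)]] by simp
        thus "u \<in> {u \<in> U. f u = w}" using u by simp
      qed
      show "\<phi> ` {u \<in> U. f u = w} \<subseteq> {z. z ^ mul x = c}" using U(8) c(1) by force
    qed
    hence "card {z. z ^ mul x = c} = card {u\<in>U. f u = w}" by (rule bij_betw_same_card)
    thus ?thesis using card_nth_roots[OF \<open>c \<noteq> 0\<close>, of "mul x"] mul_pos[of x] by simp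
  qed
  moreover have "\<forall>\<^sub>F w in at (f x). w \<in> ?W \<and> w \<noteq> f x"
  proof -
    have "f x \<in> ?W" using U(1) by (intro image_eqI[of _ _ 0]) auto
    thus ?thesis unfolding eventually_at_topological using open_image_unchart[OF open_ball] by blast
  qed
  ultimately have "\<forall>\<^sub>F w in at (f x). card {u\<in>U. f u = w} = mul x" by (auto elim: eventually_mono)
  thus ?thesis using that U by blast
qed

lemma locally_injective:
  assumes "mul x = 1" "open T" "x \<in> T"
  obtains U where "open U" "x \<in> U" "U \<subseteq> T" "inj_on f U"
proof -
  obtain U \<phi> \<phi>' r where U: "r > 0" "open U" "x \<in> U" "U \<subseteq> T"
    "homeomorphism U (ball 0 r) \<phi> \<phi>'" "\<phi> x = (0::complex)"
    "\<And>u. u \<in> U \<Longrightarrow> f u \<noteq> antipode (f x)"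
    "\<And>u. u \<in> U \<Longrightarrow> chart (f x) (f u) = \<phi> u ^ mul x"
    using normal_form[OF assms(2,3)] by metis
  have "inj_on f U"
  proof (rule inj_onI)
    fix u v assume "u \<in> U" "v \<in> U" "f u = f v"
    hence "\<phi> u = \<phi> v" using U(8) assms(1) by (metis power_one_right)
    thus "u = v" using U(5) \<open>u \<in> U\<close> \<open>v \<in> U\<close> unfolding homeomorphism_def by metis
  qed
  thus ?thesis using that U by blast
qed

end

section \<open>Lifting through a rational function\<close>

lemma open_Collect_neq_on:
  fixes f g :: "'a::topological_space \<Rightarrow> 'b::t2_space"
  assumes "open U" "continuous_on U f" "continuous_on U g"
  shows "open {z\<in>U. f z \<noteq> g z}"
proof (subst open_subopen, intro ballI)
  fix z assume z: "z \<in> {z\<in>U. f z \<noteq> g z}"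
  then obtain A B where AB: "open A" "open B" "f z \<in> A" "g z \<in> B" "A \<inter> B = {}"
    using hausdorff by (metis (mono_tags, lifting) mem_Collect_eq)
  have "open (U \<inter> f -` A)" "open (U \<inter> g -` B)"
    using continuous_open_preimage assms AB by blast+
  hence "open ((U \<inter> f -` A) \<inter> (U \<inter> g -` B))" by (rule open_Int)
  moreover have "(U \<inter> f -` A) \<inter> (U \<inter> g -` B) \<subseteq> {z\<in>U. f z \<noteq> g z}" using AB by auto
  moreover have "z \<in> (U \<inter> f -` A) \<inter> (U \<inter> g -` B)" using z AB by auto
  ultimately show "\<exists>T. open T \<and> z \<in> T \<and> T \<subseteq> {z \<in> U. f z \<noteq> g z}" by blast
qed

lemma open_minus_finite_nonempty:
  fixes U :: "complex set"
  assumes "open U" "U \<noteq> {}" "finite Z"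
  shows "\<exists>z. z \<in> U \<and> z \<notin> Z"
proof (rule ccontr)
  assume "\<not> ?thesis"
  hence "finite U" using assms(3) by (meson finite_subset subsetI)
  thus False using assms(1,2) finite_imp_not_open by blast
qed

locale rat_lifting = F: ratfun p q + G: ratfun P Q for p q P Q :: "complex poly"
begin

abbreviation "f \<equiv> F.f"
abbreviation "g \<equiv> G.f"

text \<open>Lifts are taken over subsets of the plane and need only be continuous. Off \<open>Z\<close> the function \<open>f\<close> is
  locally injective at all points over \<open>g (Some z)\<close>; a lift is determined by its value at any point
  off \<open>Z\<close>, but not by its value at a point of \<open>Z\<close>.\<close>

definition lift_on :: "complex set \<Rightarrow> (complex \<Rightarrow> sphere) \<Rightarrow> bool" where
  "lift_on U \<psi> \<longleftrightarrow> continuous_on U \<psi> \<and> (\<forall>z\<in>U. f (\<psi> z) = g (Some z))"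

definition Z :: "complex set" where
  "Z = {z. \<exists>y. f y = g (Some z) \<and> F.mul y \<noteq> 1}"

definition compat :: "complex \<Rightarrow> bool" where
  "compat z \<longleftrightarrow> (\<forall>y. f y = g (Some z) \<longrightarrow> F.mul y dvd G.mul (Some z))"

lemma finite_Z: "finite Z"
proof -
  have "Z \<subseteq> Some -` (\<Union>y\<in>{y. F.mul y \<noteq> 1}. {x. g x = f y})"
  proof
    fix z assume "z \<in> Z"
    then obtain y where "f y = g (Some z)" "F.mul y \<noteq> 1" by (auto simp: Z_def)
    thus "z \<in> Some -` (\<Union>y\<in>{y. F.mul y \<noteq> 1}. {x. g x = f y})" by (intro vimageI2 UN_I[of y]) auto
  qed
  moreover have "finite (\<Union>y\<in>{y. F.mul y \<noteq> 1}. {x. g x = f y})"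
    using F.finite_ramified G.finite_fibre by blast
  ultimately show ?thesis by (meson finite_subset finite_vimageI inj_Some)
qed

lemma lift_subset: "lift_on U \<psi> \<Longrightarrow> V \<subseteq> U \<Longrightarrow> lift_on V \<psi>"
  unfolding lift_on_def using continuous_on_subset by blast

text \<open>A connected open set stays connected without the finite set \<open>Z\<close>, and off \<open>Z\<close> two lifts agree on an
  open and closed set. The points of \<open>Z\<close> follow by continuity.\<close>

lemma lift_unique:
  assumes U: "open U" "connected U" and s: "lift_on U \<psi>" "lift_on U \<psi>'"
    and z0: "z0 \<in> U" "z0 \<notin> Z" "\<psi> z0 = \<psi>' z0" and z: "z \<in> U"
  shows "\<psi> z = \<psi>' z"
proof -
  let ?N = "{z\<in>U. \<psi> z \<noteq> \<psi>' z}" and ?E = "{z\<in>U - Z. \<psi> z = \<psi>' z}"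
  have cont: "continuous_on U \<psi>" "continuous_on U \<psi>'" using s by (auto simp: lift_on_def)
  have opN: "open ?N" by (rule open_Collect_neq_on[OF U(1) cont])
  have opE: "open ?E"
  proof (subst open_subopen, intro ballI)
    fix z assume z: "z \<in> ?E"
    have "f (\<psi> z) = g (Some z)" using s z by (auto simp: lift_on_def)
    hence m1: "F.mul (\<psi> z) = 1" using z by (auto simp: Z_def)
    obtain W where W: "open W" "\<psi> z \<in> W" "inj_on f W"
      by (rule F.locally_injective[OF m1 open_UNIV UNIV_I])
    have "open ((U \<inter> \<psi> -` W) \<inter> (U \<inter> \<psi>' -` W) - Z)"
      using W(1) U(1) cont finite_Z by (intro open_Diff open_Int continuous_open_preimage finite_imp_closed)
    moreover have "z \<in> (U \<inter> \<psi> -` W) \<inter> (U \<inter> \<psi>' -` W) - Z" using z W by auto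
    moreover have "(U \<inter> \<psi> -` W) \<inter> (U \<inter> \<psi>' -` W) - Z \<subseteq> ?E"
    proof
      fix w assume w: "w \<in> (U \<inter> \<psi> -` W) \<inter> (U \<inter> \<psi>' -` W) - Z"
      hence "f (\<psi> w) = f (\<psi>' w)" using s by (auto simp: lift_on_def)
      thus "w \<in> ?E" using w inj_onD[OF W(3)] by auto
    qed
    ultimately show "\<exists>T. open T \<and> z \<in> T \<and> T \<subseteq> ?E" by blast
  qed
  have "connected (U - Z)" using U finite_Z by (intro connected_open_delete_finite) auto
  moreover have "?E \<inter> ?N \<inter> (U - Z) = {}" "U - Z \<subseteq> ?E \<union> ?N" by auto
  ultimately have "?E \<inter> (U - Z) = {} \<or> ?N \<inter> (U - Z) = {}"
    using connectedD[OF _ opE opN] by blast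
  moreover have "z0 \<in> ?E" using z0 by simp
  ultimately have "?N \<subseteq> Z" by blast
  hence "finite ?N" using finite_Z finite_subset by blast
  hence "?N = {}" using opN finite_imp_not_open by blast
  thus ?thesis using z by blast
qed

lemma lift_glue:
  assumes "\<And>i. i \<in> I \<Longrightarrow> open (U i)" "\<And>i. i \<in> I \<Longrightarrow> lift_on (U i) (\<psi> i)"
    and agree: "\<And>i j z. i \<in> I \<Longrightarrow> j \<in> I \<Longrightarrow> z \<in> U i \<Longrightarrow> z \<in> U j \<Longrightarrow> \<psi> i z = \<psi> j z"
  obtains \<Psi> where "lift_on (\<Union>i\<in>I. U i) \<Psi>" "\<And>i z. i \<in> I \<Longrightarrow> z \<in> U i \<Longrightarrow> \<Psi> z = \<psi> i z"
proof -
  define \<Psi> where "\<Psi> z = \<psi> (SOME i. i \<in> I \<and> z \<in> U i) z" for z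
  have eq: "\<Psi> z = \<psi> i z" if "i \<in> I" "z \<in> U i" for i z
  proof -
    have "(SOME i. i \<in> I \<and> z \<in> U i) \<in> I \<and> z \<in> U (SOME i. i \<in> I \<and> z \<in> U i)"
      by (rule someI[of _ i]) (use that in auto)
    thus ?thesis unfolding \<Psi>_def using agree that by blast
  qed
  have "continuous_on (\<Union>i\<in>I. U i) \<Psi>"
  proof (rule continuous_on_open_UN)
    fix i assume "i \<in> I"
    thus "continuous_on (U i) \<Psi>" using assms(2)[of i] eq[of i] unfolding lift_on_def
      by (metis (mono_tags, lifting) continuous_on_cong)
  qed (use assms in auto)
  hence "lift_on (\<Union>i\<in>I. U i) \<Psi>" using assms(2) eq by (auto simp: lift_on_def)
  thus ?thesis using that eq by blast
qed

text \<open>Near \<open>z0\<close> the function \<open>g\<close> is \<open>\<phi>^n\<close>, and near each point \<open>y\<close> over \<open>g (Some z0)\<close> the function \<open>f\<close> is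
  \<open>X^m\<close> with \<open>m\<close> dividing \<open>n\<close>. The local lifts are the solutions \<open>X = \<zeta> * \<phi>^(n div m)\<close> with
  \<open>\<zeta>^m = 1\<close>, and \<open>\<zeta>\<close> and \<open>y\<close> can be chosen so that a given value is attained.\<close>

lemma local_lifts:
  assumes "compat z0"
  obtains e where "e > 0" 
    "\<And>z1 u1. z1 \<in> ball z0 e \<Longrightarrow> f u1 = g (Some z1) \<Longrightarrow> \<exists>\<psi>. lift_on (ball z0 e) \<psi> \<and> \<psi> z1 = u1"
proof -
  define c where "c = g (Some z0)"
  define n where "n = G.mul (Some z0)"
  have n: "n > 0" unfolding n_def by (rule G.mul_pos)
  obtain U \<phi> \<phi>' r where U: "r > 0" "open U" "Some z0 \<in> U" 
    "homeomorphism U (ball 0 r) \<phi> \<phi>'" "\<phi> (Some z0) = (0::complex)"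
    "\<And>u. u \<in> U \<Longrightarrow> g u \<noteq> antipode c" "\<And>u. u \<in> U \<Longrightarrow> chart c (g u) = \<phi> u ^ n"
    using G.normal_form[of UNIV "Some z0"] unfolding c_def n_def by (metis UNIV_I open_UNIV)
  have "\<exists>W X X' s. s > 0 \<and> open W \<and> y \<in> W \<and> homeomorphism W (ball 0 s) X X' \<and> X y = (0::complex) \<and>
     (\<forall>u\<in>W. f u \<noteq> antipode (f y)) \<and> (\<forall>u\<in>W. chart (f y) (f u) = X u ^ F.mul y)" for y
    using F.normal_form[of UNIV y] by (metis UNIV_I open_UNIV)
  then obtain W X X' s where W: "\<And>y. s y > 0" "\<And>y. open (W y)" "\<And>y. y \<in> W y"
    "\<And>y. homeomorphism (W y) (ball 0 (s y)) (X y) (X' y)" "\<And>y. X y y = (0::complex)"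
    "\<And>y u. u \<in> W y \<Longrightarrow> f u \<noteq> antipode (f y)" "\<And>y u. u \<in> W y \<Longrightarrow> chart (f y) (f u) = X y u ^ F.mul y"
    by metis
  define m where "m = F.mul"
  define k where "k y = n div m y" for y
  have nk: "n = m y * k y" if "f y = c" for y
    using assms that by (simp add: compat_def c_def n_def m_def k_def)
  have kpos: "k y > 0" if "f y = c" for y using nk[OF that] n by (cases "k y") auto
  have tS: "((\<lambda>z. Some z) \<longlongrightarrow> Some z0) (nhds z0)" by (simp add: tendsto_Some filterlim_ident)
  have evU: "\<forall>\<^sub>F z in nhds z0. Some z \<in> U" using topological_tendstoD[OF tS U(2,3)] .
  have gcont: "((\<lambda>z. g (Some z)) \<longlongrightarrow> c) (nhds z0)"
    using continuous_on_tendsto_compose[OF G.continuous_f tS] by (simp add: c_def)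
  have ev1: "\<forall>\<^sub>F z in nhds z0. \<forall>u. f u = g (Some z) \<longrightarrow> (\<exists>y. f y = c \<and> u \<in> W y)"
    by (rule eventually_compose_filterlim[OF F.near_fibre gcont]) (use W(2,3) in auto)
  have \<phi>lim: "((\<lambda>z. \<phi> (Some z)) \<longlongrightarrow> 0) (nhds z0)"
  proof -
    have "continuous_on U \<phi>" using U(4) by (simp add: homeomorphism_def)
    from continuous_on_tendsto_compose[OF this tS U(3) evU] show ?thesis using U(5) by simp
  qed
  have ev2: "\<forall>\<^sub>F z in nhds z0. \<forall>y\<in>{y. f y = c}. norm (\<phi> (Some z) ^ k y) < s y"
  proof (subst eventually_ball_finite_distrib[OF F.finite_fibre], intro ballI)
    fix y assume y: "y \<in> {y. f y = c}"
    have "((\<lambda>z. norm (\<phi> (Some z) ^ k y)) \<longlongrightarrow> norm ((0::complex) ^ k y)) (nhds z0)"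
      by (intro tendsto_intros \<phi>lim)
    hence "((\<lambda>z. norm (\<phi> (Some z) ^ k y)) \<longlongrightarrow> 0) (nhds z0)" using kpos y by (simp add: zero_power)
    thus "\<forall>\<^sub>F z in nhds z0. norm (\<phi> (Some z) ^ k y) < s y" using W(1) order_tendstoD(2) by blast
  qed
  from eventually_conj[OF evU eventually_conj[OF ev1 ev2]] obtain e where e: "e > 0"
    "\<And>z. z \<in> ball z0 e \<Longrightarrow> Some z \<in> U \<and> (\<forall>u. f u = g (Some z) \<longrightarrow> (\<exists>y. f y = c \<and> u \<in> W y)) \<and>
        (\<forall>y\<in>{y. f y = c}. norm (\<phi> (Some z) ^ k y) < s y)"
    unfolding eventually_nhds_metric by (auto simp: dist_commute)
  show ?thesis
  proof (rule that[OF e(1)])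
    fix z1 u1 assume z1: "z1 \<in> ball z0 e" and u1: "f u1 = g (Some z1)"
    obtain y where y: "f y = c" "u1 \<in> W y" using e(2)[OF z1] u1 by blast
    \<comment> \<open>both sides are the value of \<open>g\<close> at \<open>z1\<close>, so the two bases differ by a root of unity\<close>
    have eq: "X y u1 ^ m y = (\<phi> (Some z1) ^ k y) ^ m y"
      using W(7)[OF y(2)] U(7)[of "Some z1"] e(2)[OF z1] u1 y(1) nk[OF y(1)] 
      by (simp add: m_def mult.commute flip: power_mult)
    have mpos: "m y > 0" unfolding m_def by (rule F.mul_pos)
    obtain \<zeta> where \<zeta>: "\<zeta> ^ m y = 1" "X y u1 = \<zeta> * \<phi> (Some z1) ^ k y"
    proof (cases "\<phi> (Some z1) ^ k y = 0")
      case True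
      hence "X y u1 = 0" using eq mpos by (simp add: zero_power)
      thus ?thesis using that[of 1] True by simp
    next
      case False
      thus ?thesis using that[of "X y u1 / \<phi> (Some z1) ^ k y"] eq by (simp add: power_divide)
    qed
    have "norm \<zeta> ^ m y = 1" using \<zeta>(1) by (metis norm_one norm_power)
    hence n\<zeta>: "norm \<zeta> = 1" using mpos using power_eq_imp_eq_base[of "norm \<zeta>" "m y" 1] by simp
    have inb: "\<zeta> * \<phi> (Some z) ^ k y \<in> ball 0 (s y)" if "z \<in> ball z0 e" for z
      using e(2)[OF that] y(1) n\<zeta> by (simp add: norm_mult)
    define \<psi> where "\<psi> z = X' y (\<zeta> * \<phi> (Some z) ^ k y)" for z
    have "lift_on (ball z0 e) \<psi>"
      unfolding lift_on_def
    proof (intro conjI ballI)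
      have "continuous_on (ball z0 e) (\<lambda>z. \<phi> (Some z))"
        by (rule continuous_on_compose2[of U \<phi>]) 
           (use U(4) e(2) in \<open>auto simp: homeomorphism_def intro!: continuous_intros\<close>)
      hence "continuous_on (ball z0 e) (\<lambda>z. \<zeta> * \<phi> (Some z) ^ k y)" by (intro continuous_intros)
      moreover have "continuous_on (ball 0 (s y)) (X' y)" using W(4) by (simp add: homeomorphism_def)
      ultimately show "continuous_on (ball z0 e) \<psi>" unfolding \<psi>_def
        using continuous_on_compose2[of "ball 0 (s y)" "X' y" "ball z0 e"] inb by blast
    next
      fix z assume z: "z \<in> ball z0 e"
      have in1: "\<psi> z \<in> W y" "X y (\<psi> z) = \<zeta> * \<phi> (Some z) ^ k y" 
        using inb[OF z] W(4)[of y] by (auto simp: \<psi>_def homeomorphism_def)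
      have "chart c (f (\<psi> z)) = (\<zeta> * \<phi> (Some z) ^ k y) ^ m y" 
        using W(7)[OF in1(1)] in1(2) y(1) by (simp add: m_def)
      also have "\<dots> = \<phi> (Some z) ^ n"
        using \<zeta>(1) nk[OF y(1)] by (simp add: power_mult_distrib mult.commute flip: power_mult)
      also have "\<dots> = chart c (g (Some z))" using U(7) e(2)[OF z] by simp
      finally have "unchart c (chart c (f (\<psi> z))) = unchart c (chart c (g (Some z)))" by simp
      thus "f (\<psi> z) = g (Some z)" 
        using W(6)[OF in1(1)] y(1) U(6)[of "Some z"] e(2)[OF z] by (simp add: unchart_chart)
    qed
    moreover have "\<psi> z1 = u1" using \<zeta>(2) y(2) W(4)[of y] by (auto simp: \<psi>_def homeomorphism_def)
    ultimately show "\<exists>\<psi>. lift_on (ball z0 e) \<psi> \<and> \<psi> z1 = u1" by blast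
  qed
qed

lemma local_extension:
  assumes "compat z0"
  obtains e where "e > 0" 
    "\<And>V \<psi>. open V \<Longrightarrow> connected V \<Longrightarrow> V \<noteq> {} \<Longrightarrow> V \<subseteq> ball z0 e \<Longrightarrow> lift_on V \<psi> \<Longrightarrow>
        \<exists>\<psi>'. lift_on (ball z0 e) \<psi>' \<and> (\<forall>z\<in>V. \<psi>' z = \<psi> z)"
proof -
  obtain e where e: "e > 0" 
    "\<And>z1 u1. z1 \<in> ball z0 e \<Longrightarrow> f u1 = g (Some z1) \<Longrightarrow> \<exists>\<psi>. lift_on (ball z0 e) \<psi> \<and> \<psi> z1 = u1"
    using local_lifts[OF assms] by metis
  show ?thesis
  proof (rule that[OF e(1)])
    fix V \<psi> assume V: "open V" "connected V" "V \<noteq> {}" "V \<subseteq> ball z0 e" and s: "lift_on V \<psi>"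
    obtain z1 where z1: "z1 \<in> V" "z1 \<notin> Z" using open_minus_finite_nonempty[OF V(1,3) finite_Z] by blast
    have "f (\<psi> z1) = g (Some z1)" using s z1 by (simp add: lift_on_def)
    then obtain \<psi>' where \<psi>': "lift_on (ball z0 e) \<psi>'" "\<psi>' z1 = \<psi> z1" using e(2) z1 V by blast
    have "\<psi>' z = \<psi> z" if "z \<in> V" for z
      by (rule lift_unique[OF V(1,2) lift_subset[OF \<psi>'(1) V(4)] s z1 \<psi>'(2) that])
    thus "\<exists>\<psi>'. lift_on (ball z0 e) \<psi>' \<and> (\<forall>z\<in>V. \<psi>' z = \<psi> z)" using \<psi>' by blast
  qed
qed

text \<open>The lift extends to a ball around each point of the closure of \<open>K\<close>. On balls of half the radius the
  extensions agree: if two of them meet, one of the two centres lies in the other full ball, so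
  the two full balls have common points in \<open>K\<close>, where both extensions equal \<open>\<psi>\<close>.\<close>

lemma extend_to_neighbourhood:
  assumes K: "open K" "convex K" "K \<noteq> {}" and s: "lift_on K \<psi>" and c: "\<And>x. x \<in> closure K \<Longrightarrow> compat x"
  obtains T \<psi>' where "open T" "closure K \<subseteq> T" "lift_on T \<psi>'" "\<And>z. z \<in> K \<Longrightarrow> \<psi>' z = \<psi> z"
proof -
  have "\<exists>e \<psi>'. e > 0 \<and> lift_on (ball x e) \<psi>' \<and> (\<forall>z\<in>ball x e \<inter> K. \<psi>' z = \<psi> z)" if x: "x \<in> closure K" for x
  proof -
    obtain e where e: "e > 0" 
      "\<And>V \<psi>. open V \<Longrightarrow> connected V \<Longrightarrow> V \<noteq> {} \<Longrightarrow> V \<subseteq> ball x e \<Longrightarrow> lift_on V \<psi> \<Longrightarrow>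
          \<exists>\<psi>'. lift_on (ball x e) \<psi>' \<and> (\<forall>z\<in>V. \<psi>' z = \<psi> z)"
      using local_extension[OF c[OF x]] by metis
    have "ball x e \<inter> K \<noteq> {}" 
    proof -
      obtain y where "y \<in> K" "dist y x < e" using x e(1) unfolding closure_approachable by blast
      thus ?thesis by (auto simp: dist_commute)
    qed
    hence "\<exists>\<psi>'. lift_on (ball x e) \<psi>' \<and> (\<forall>z\<in>ball x e \<inter> K. \<psi>' z = \<psi> z)"
      using e(2)[of "ball x e \<inter> K" \<psi>] K s by (simp add: open_Int convex_Int convex_connected lift_subset)
    thus ?thesis using e(1) by blast
  qed
  then obtain e \<psi>' where e: "\<And>x. x \<in> closure K \<Longrightarrow> e x > 0"
    "\<And>x. x \<in> closure K \<Longrightarrow> lift_on (ball x (e x)) (\<psi>' x)"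
    "\<And>x z. x \<in> closure K \<Longrightarrow> z \<in> ball x (e x) \<Longrightarrow> z \<in> K \<Longrightarrow> \<psi>' x z = \<psi> z" by (metis IntI)
  have agree1: "\<psi>' x z = \<psi>' y z" 
    if xy: "x \<in> closure K" "y \<in> closure K" and z: "z \<in> ball x (e x / 2)" "z \<in> ball y (e y / 2)" and le: "e y \<le> e x" for x y z
  proof -
    have "dist x y \<le> dist x z + dist y z" by (metis dist_triangle dist_commute)
    hence y: "y \<in> ball x (e x)" using z le by simp
    let ?V = "ball x (e x) \<inter> ball y (e y)"
    have "open (?V)" by auto
    moreover have "y \<in> ?V" using y e(1) xy by simp
    ultimately have "?V \<inter> K \<noteq> {}" using xy(2) by (metis Int_commute closure_iff_nhds_not_empty subset_refl)
    then obtain z2 where z2: "z2 \<in> ?V" "z2 \<in> K" "z2 \<notin> Z"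
      using open_minus_finite_nonempty[of "?V \<inter> K" Z] K(1) finite_Z by auto
    show ?thesis
    proof (rule lift_unique[of ?V _ _ z2])
      show "connected ?V" by (intro convex_connected convex_Int convex_ball)
      show "lift_on ?V (\<psi>' x)" "lift_on ?V (\<psi>' y)" using e(2) xy lift_subset by blast+
      show "\<psi>' x z2 = \<psi>' y z2" using e(3) xy z2 by simp
      show "z \<in> ?V" using z e(1)[OF xy(1)] e(1)[OF xy(2)] by simp
    qed (use z2 in auto)
  qed
  obtain \<Psi> where \<Psi>: "lift_on (\<Union>x\<in>closure K. ball x (e x / 2)) \<Psi>"
     "\<And>x z. x \<in> closure K \<Longrightarrow> z \<in> ball x (e x / 2) \<Longrightarrow> \<Psi> z = \<psi>' x z"
  proof (rule lift_glue[of "closure K" "\<lambda>x. ball x (e x / 2)" \<psi>'])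
    fix x assume "x \<in> closure K"
    thus "lift_on (ball x (e x / 2)) (\<psi>' x)" using e(1)[of x] by (intro lift_subset[OF e(2)] subset_ball) auto
  next
    fix x y z assume "x \<in> closure K" "y \<in> closure K" "z \<in> ball x (e x / 2)" "z \<in> ball y (e y / 2)"
    thus "\<psi>' x z = \<psi>' y z" using agree1 by (metis linear)
  qed (use that in auto)
  show ?thesis
  proof (rule that[OF _ _ \<Psi>(1)])
    show "closure K \<subseteq> (\<Union>x\<in>closure K. ball x (e x / 2))" using e(1) by force
    fix z assume z: "z \<in> K"
    hence "z \<in> closure K" using closure_subset by blast
    thus "\<Psi> z = \<psi> z" using \<Psi>(2)[of z z] e(1)[of z] e(3)[of z z] z by simp
  qed auto
qed

text \<open>Shrink \<open>D\<close> towards \<open>z1\<close> by a factor \<open>r\<close>. The set of factors for which the lift exists is nonempty, its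
  supremum belongs to it by gluing, and by \<open>extend_to_neighbourhood\<close> the supremum cannot be less
  than \<open>1\<close>.\<close>

lemma lift_bounded_convex:
  assumes D: "open D" "convex D" "bounded D" and c: "\<And>x. x \<in> D \<Longrightarrow> compat x"
    and z1: "z1 \<in> D" "z1 \<notin> Z" "f y1 = g (Some z1)"
  obtains \<psi> where "lift_on D \<psi>" "\<psi> z1 = y1"
proof -
  \<comment> \<open>for \<open>r > 0\<close> the image of \<open>D\<close> under the homothety with centre \<open>z1\<close> and factor \<open>r\<close>\<close>
  define K where "K r = (\<lambda>z. z1 + (1/r) *\<^sub>R (z - z1)) -` D" for r :: real
  obtain M where M: "M > 0" "\<And>z. z \<in> D \<Longrightarrow> norm (z - z1) < M"
  proof -
    obtain M where "M > 0" "D \<subseteq> ball z1 M" using D(3) bounded_subset_ballD by blast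
    thus ?thesis using that[of M] by (auto simp: dist_norm norm_minus_commute subset_iff)
  qed
  have opK: "open (K r)" for r unfolding K_def by (intro open_vimage D continuous_intros)
  have z1K: "z1 \<in> K r" for r using z1 by (simp add: K_def)
  have mono: "K r \<subseteq> K s" if "0 < r" "r \<le> s" for r s
  proof
    fix z assume z: "z \<in> K r"
    have "z1 + (1/s) *\<^sub>R (z - z1) = (1 - r/s) *\<^sub>R z1 + (r/s) *\<^sub>R (z1 + (1/r) *\<^sub>R (z - z1))"
      using that by (simp add: scaleR_diff_left scaleR_add_right)
    also have "\<dots> \<in> D" using z z1 that by (intro convexD[OF D(2)]) (auto simp: K_def)
    finally show "z \<in> K s" by (simp add: K_def)
  qed
  have K1: "K 1 = D" by (simp add: K_def)
  have cvK: "convex (K r)" for r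
  proof -
    have "K r = (\<lambda>z. (1/r) *\<^sub>R z) -` ((+) (-(z1 - (1/r) *\<^sub>R z1)) ` D)"
    proof (rule set_eqI)
      fix z
      have "z \<in> K r \<longleftrightarrow> (1/r) *\<^sub>R z + (z1 - (1/r) *\<^sub>R z1) \<in> D" by (simp add: K_def algebra_simps)
      also have "\<dots> \<longleftrightarrow> (1/r) *\<^sub>R z \<in> (+) (-(z1 - (1/r) *\<^sub>R z1)) ` D"
      proof
        assume "(1/r) *\<^sub>R z + (z1 - (1/r) *\<^sub>R z1) \<in> D"
        thus "(1/r) *\<^sub>R z \<in> (+) (-(z1 - (1/r) *\<^sub>R z1)) ` D" by (rule rev_image_eqI) simp
      qed (auto simp: algebra_simps)
      finally show "z \<in> K r \<longleftrightarrow> z \<in> (\<lambda>z. (1/r) *\<^sub>R z) -` ((+) (-(z1 - (1/r) *\<^sub>R z1)) ` D)" by simp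
    qed
    moreover have "linear (\<lambda>z::complex. (1/r) *\<^sub>R z)" by (rule linear_scaleR)
    ultimately show ?thesis using convex_linear_vimage[OF _ convex_translation[OF D(2)]] by metis
  qed
  have clK: "closure (K r) \<subseteq> D" if r: "0 < r" "r < 1" for r
  proof
    fix z assume z: "z \<in> closure (K r)"
    let ?h = "\<lambda>z. z1 + (1/r) *\<^sub>R (z - z1)"
    have "?h z \<in> closure D"
    proof -
      have "?h ` closure (K r) \<subseteq> closure D"
      proof (rule image_closure_subset)
        show "?h ` K r \<subseteq> closure D" using closure_subset by (auto simp: K_def)
      qed (auto intro!: continuous_intros)
      thus ?thesis using z by blast
    qed
    hence "?h z - (1 - r) *\<^sub>R (?h z - z1) \<in> interior D"
      using D z1 r by (intro mem_interior_closure_convex_shrink) (auto simp: interior_open)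
    also have "?h z - (1 - r) *\<^sub>R (?h z - z1) = z1 + (1/r - (1 - r) * (1/r)) *\<^sub>R (z - z1)"
      by (simp add: scaleR_diff_left)
    also have "1/r - (1 - r) * (1/r) = 1" using r by (simp add: field_simps)
    also have "z1 + 1 *\<^sub>R (z - z1) = z" by simp
    finally show "z \<in> D" using interior_subset by blast
  qed
  define S where "S = {r. 0 < r \<and> r \<le> 1 \<and> (\<exists>\<psi>. lift_on (K r) \<psi> \<and> \<psi> z1 = y1)}"
  have "\<exists>r. r \<in> S"
  proof -
    obtain e \<psi> where e: "e > 0" "lift_on (ball z1 e) \<psi>" "\<psi> z1 = y1"
      using local_lifts[OF c[OF z1(1)]] z1(3) by (metis centre_in_ball)
    define r where "r = min 1 (e / M)"
    have r: "r > 0" "r \<le> 1" "r * M \<le> e" using e(1) M(1) by (auto simp: r_def field_simps min_def)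
    have "K r \<subseteq> ball z1 e"
    proof
      fix z assume "z \<in> K r"
      hence "norm ((1/r) *\<^sub>R (z - z1)) < M" using M(2)[of "z1 + (1/r) *\<^sub>R (z - z1)"] by (simp add: K_def)
      hence "(1/r) * norm (z - z1) < M" using r(1) unfolding norm_scaleR by simp
      hence "norm (z - z1) < r * M" using r(1) by (simp add: field_simps)
      thus "z \<in> ball z1 e" using r(3) by (simp add: dist_norm norm_minus_commute)
    qed
    hence "lift_on (K r) \<psi>" using e(2) lift_subset by blast
    thus ?thesis using e r by (auto simp: S_def)
  qed
  then obtain r0 where r0: "r0 \<in> S" by blast
  have bdd: "bdd_above S" by (rule bdd_aboveI[of _ 1]) (simp add: S_def)
  define R where "R = Sup S"
  have R: "0 < R" "R \<le> 1" "\<And>r. r \<in> S \<Longrightarrow> r \<le> R"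
  proof -
    show up: "r \<le> R" if "r \<in> S" for r unfolding R_def using bdd that cSup_upper by blast
    show "0 < R" using up[OF r0] r0 by (simp add: S_def)
    show "R \<le> 1" unfolding R_def using r0 by (intro cSup_least) (auto simp: S_def)
  qed
  have "\<forall>r\<in>S. \<exists>\<psi>. lift_on (K r) \<psi> \<and> \<psi> z1 = y1" by (auto simp: S_def)
  from bchoice[OF this] obtain \<psi>s where \<psi>s: "\<And>r. r \<in> S \<Longrightarrow> lift_on (K r) (\<psi>s r) \<and> \<psi>s r z1 = y1" by blast
  have agree: "\<psi>s r z = \<psi>s s z" if "r \<in> S" "s \<in> S" "r \<le> s" "z \<in> K r" for r s z
  proof (rule lift_unique[of "K r" _ _ z1])
    have "K r \<subseteq> K s" using mono that by (simp add: S_def)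
    thus "lift_on (K r) (\<psi>s s)" using \<psi>s that lift_subset by blast
  qed (use that \<psi>s opK convex_connected[OF cvK] z1K z1 in auto)
  obtain \<Psi> where \<Psi>: "lift_on (\<Union>r\<in>S. K r) \<Psi>" "\<And>r z. r \<in> S \<Longrightarrow> z \<in> K r \<Longrightarrow> \<Psi> z = \<psi>s r z"
  proof (rule lift_glue[of S K \<psi>s])
    fix r s z assume "r \<in> S" "s \<in> S" "z \<in> K r" "z \<in> K s"
    thus "\<psi>s r z = \<psi>s s z" using agree by (metis linear)
  qed (use opK \<psi>s that in auto)
  have "K R \<subseteq> (\<Union>r\<in>S. K r)"
  proof
    fix z assume z: "z \<in> K R"
    have "((\<lambda>r. z1 + (1/r) *\<^sub>R (z - z1)) \<longlongrightarrow> z1 + (1/R) *\<^sub>R (z - z1)) (at_left R)"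
      using R(1) by (intro tendsto_intros) auto
    hence "\<forall>\<^sub>F r in at_left R. z1 + (1/r) *\<^sub>R (z - z1) \<in> D"
      using D(1) z topological_tendstoD by (fastforce simp: K_def)
    moreover have "\<forall>\<^sub>F r in at_left R. 0 < r \<and> r < R" using R(1) eventually_at_left_field by fastforce
    ultimately have "\<forall>\<^sub>F r in at_left R. z1 + (1/r) *\<^sub>R (z - z1) \<in> D \<and> (0 < r \<and> r < R)" by (rule eventually_conj)
    then obtain r where r: "z \<in> K r" "0 < r" "r < R"
      using eventually_happens[of _ "at_left R"] by (auto simp: K_def)
    then obtain s where s: "s \<in> S" "r < s" using less_cSup_iff[of S r] bdd r0 unfolding R_def by blast
    thus "z \<in> (\<Union>r\<in>S. K r)" using r mono[of r s] by auto
  qed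
  hence solR: "lift_on (K R) \<Psi>" using \<Psi>(1) lift_subset by blast
  have \<Psi>1: "\<Psi> z1 = y1" using \<Psi>(2)[OF r0 z1K] \<psi>s[OF r0] by simp
  have "R = 1"
  proof (rule ccontr)
    assume "R \<noteq> 1"
    hence R1: "R < 1" using R by simp
    obtain T \<psi>' where T: "open T" "closure (K R) \<subseteq> T" "lift_on T \<psi>'" "\<And>z. z \<in> K R \<Longrightarrow> \<psi>' z = \<Psi> z"
      using extend_to_neighbourhood[OF opK cvK _ solR] z1K clK[OF R(1) R1] c by (metis empty_iff subset_iff)
    have "compact (closure (K R))" using clK[OF R(1) R1] D(3) bounded_subset by (auto simp: compact_eq_bounded_closed)
    then obtain \<epsilon> where \<epsilon>: "\<epsilon> > 0" "(\<Union>x\<in>closure (K R). ball x \<epsilon>) \<subseteq> T"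
      using compact_subset_open_imp_ball_epsilon_subset T(1,2) by metis
    \<comment> \<open>points of \<open>K s\<close> are within \<open>(s - R) * M / s\<close> of points of \<open>K R\<close>\<close>
    obtain s where s: "R < s" "s \<le> 1" "(s - R) * M \<le> \<epsilon> * R"
    proof (rule that[of "min 1 (R + \<epsilon> * R / M)"])
      show "R < min 1 (R + \<epsilon> * R / M)" using R R1 M \<epsilon> by simp
      have "min 1 (R + \<epsilon> * R / M) - R \<le> \<epsilon> * R / M" by simp
      thus "(min 1 (R + \<epsilon> * R / M) - R) * M \<le> \<epsilon> * R" using M(1) by (simp add: pos_le_divide_eq)
    qed auto
    have "K s \<subseteq> T"
    proof
      fix z assume z: "z \<in> K s"
      let ?z = "z1 + (R/s) *\<^sub>R (z - z1)"
      have "?z \<in> K R" using z R s by (simp add: K_def)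
      hence cl: "?z \<in> closure (K R)" using closure_subset by blast
      have "z \<in> D" using z mono[of s 1] s R K1 by auto
      have "?z - z = (R/s - 1) *\<^sub>R (z - z1)" by (simp add: algebra_simps)
      hence "dist ?z z = \<bar>R/s - 1\<bar> * norm (z - z1)" by (simp add: dist_norm)
      also have "\<bar>R/s - 1\<bar> = (s - R) / s" using s R by (simp add: field_simps)
      also have "(s - R) / s * norm (z - z1) < (s - R) / s * M" 
        using M(2)[OF \<open>z \<in> D\<close>] s R by (intro mult_strict_left_mono) auto
      also have "\<dots> \<le> \<epsilon> * R / s" using s R by (simp add: divide_right_mono)
      also have "\<dots> \<le> \<epsilon>" using s R \<epsilon> by (simp add: field_simps)
      finally have "z \<in> ball ?z \<epsilon>" by simp
      thus "z \<in> T" using \<epsilon>(2) cl by blast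
    qed
    hence "lift_on (K s) \<psi>'" using T(3) lift_subset by blast
    moreover have "\<psi>' z1 = y1" using T(4)[OF z1K] \<Psi>1 by simp
    ultimately have "s \<in> S" using s R by (auto simp: S_def)
    thus False using R(3) s by fastforce
  qed
  thus ?thesis using that[of \<Psi>] solR \<Psi>1 K1 by simp
qed

text \<open>An unbounded domain is exhausted by its intersections with balls.\<close>

theorem lift_convex:
  assumes D: "open D" "convex D" and c: "\<And>x. x \<in> D \<Longrightarrow> compat x"
    and z1: "z1 \<in> D" "z1 \<notin> Z" "f y1 = g (Some z1)"
  obtains \<psi> where "lift_on D \<psi>" "\<psi> z1 = y1"
proof -
  define E where "E n = D \<inter> ball z1 (real n + 1)" for n
  have E: "open (E n)" "convex (E n)" "z1 \<in> E n" for n using D z1 by (auto simp: E_def convex_Int)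
  have "\<exists>\<psi>. lift_on (E n) \<psi> \<and> \<psi> z1 = y1" for n
    by (rule lift_bounded_convex[OF E(1,2) _ _ E(3) z1(2,3)]) (use c in \<open>auto simp: E_def\<close>)
  then obtain \<psi> where \<psi>: "\<And>n. lift_on (E n) (\<psi> n)" "\<And>n. \<psi> n z1 = y1" by metis
  have mono: "E m \<subseteq> E n" if "m \<le> n" for m n using that by (auto simp: E_def)
  have agree: "\<psi> m z = \<psi> n z" if "m \<le> n" "z \<in> E m" for m n z
    by (rule lift_unique[OF E(1) convex_connected[OF E(2)] \<psi>(1) lift_subset[OF \<psi>(1) mono[OF that(1)]] E(3) z1(2)])
       (use that \<psi> in auto)
  obtain \<Psi> where \<Psi>: "lift_on (\<Union>n\<in>UNIV. E n) \<Psi>" "\<And>n z. n \<in> UNIV \<Longrightarrow> z \<in> E n \<Longrightarrow> \<Psi> z = \<psi> n z"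
  proof (rule lift_glue[of UNIV E \<psi>])
    fix m n z assume "z \<in> E m" "z \<in> E n"
    thus "\<psi> m z = \<psi> n z" using agree by (metis linear)
  qed (use E \<psi> that in auto)
  have "(\<Union>n\<in>UNIV. E n) = D"
  proof
    show "D \<subseteq> (\<Union>n\<in>UNIV. E n)"
    proof
      fix z assume "z \<in> D"
      moreover obtain n where "dist z1 z < real n" using reals_Archimedean2 by blast
      ultimately have "z \<in> E n" by (simp add: E_def)
      thus "z \<in> (\<Union>n\<in>UNIV. E n)" by blast
    qed
  qed (auto simp: E_def)
  thus ?thesis using that[of \<Psi>] \<Psi>(1) \<Psi>(2)[of 0 z1] E(3) \<psi>(2) by simp
qed

theorem lift_sphere:
  assumes c: "\<And>x. compat x"
  obtains \<Psi> where "continuous_on UNIV \<Psi>" "\<And>x. f (\<Psi> x) = g x"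
proof -
  obtain z1 where z1: "z1 \<notin> Z" using open_minus_finite_nonempty[OF open_UNIV _ finite_Z] by blast
  obtain y1 where "f y1 = g (Some z1)" using F.surj_f by blast
  then obtain \<psi> where \<psi>: "lift_on UNIV \<psi>" using lift_convex[of UNIV z1 y1] c z1 by auto
  have tS: "(Some \<longlongrightarrow> (None::sphere)) at_infinity"
    using tendsto_Some_None[of "\<lambda>z::complex. z" at_infinity] by (simp add: filterlim_ident)
  have lim: "((\<lambda>z. f (\<psi> z)) \<longlongrightarrow> g None) at_infinity"
  proof -
    have "((\<lambda>z. g (Some z)) \<longlongrightarrow> g None) at_infinity"
      using continuous_on_tendsto_compose[OF G.continuous_f tS] by simp
    thus ?thesis using \<psi> by (simp add: lift_on_def)
  qed
  obtain x where x: "f x = g None" "(\<psi> \<longlongrightarrow> x) at_infinity"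
  proof (rule F.lift_limit[OF _ lim, where S = UNIV])
    fix P :: "complex \<Rightarrow> bool" assume "eventually P at_infinity"
    then obtain b where b: "\<And>z. norm z \<ge> b \<Longrightarrow> P z" by (auto simp: eventually_at_infinity)
    have "connected (- cball (0::complex) b)"
      by (rule connected_complement_bounded_convex) auto
    moreover have "\<forall>\<^sub>F z in at_infinity. z \<in> - cball (0::complex) b"
      unfolding eventually_at_infinity by (intro exI[of _ "b + 1"]) auto
    ultimately show "\<exists>C. connected C \<and> (\<forall>\<^sub>F z in at_infinity. z \<in> C) \<and> (\<forall>z\<in>C. P z)"
      using b by (intro exI[of _ "- cball 0 b"]) auto
  qed (use \<psi> in \<open>auto simp: lift_on_def trivial_limit_at_infinity\<close>)
  define \<Psi> where "\<Psi> u = (case u of None \<Rightarrow> x | Some z \<Rightarrow> \<psi> z)" for u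
  have "continuous_on UNIV \<Psi>"
    unfolding continuous_on_open_vimage[OF open_UNIV]
  proof (intro allI impI)
    fix U :: "sphere set" assume U: "open U"
    have eq: "Some -` (\<Psi> -` U \<inter> UNIV) = \<psi> -` U" by (auto simp: \<Psi>_def)
    have "continuous_on UNIV \<psi>" using \<psi> by (simp add: lift_on_def)
    hence "open (\<psi> -` U)" using U open_vimage by blast
    moreover have "bounded (- (\<psi> -` U))" if "x \<in> U"
    proof -
      from topological_tendstoD[OF x(2) U that] obtain b where "\<And>z. norm z \<ge> b \<Longrightarrow> \<psi> z \<in> U"
        by (auto simp: eventually_at_infinity)
      hence "- (\<psi> -` U) \<subseteq> ball 0 b" by force
      thus ?thesis using bounded_subset bounded_ball by blast
    qed
    ultimately show "open (\<Psi> -` U \<inter> UNIV)" unfolding open_option_iff eq by (simp add: \<Psi>_def)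
  qed
  moreover have "f (\<Psi> u) = g u" for u using x \<psi> by (cases u) (auto simp: \<Psi>_def lift_on_def)
  ultimately show ?thesis using that by blast
qed

end

section \<open>Continuous lifts are rational\<close>

lemma finite_open_sphere_empty:
  fixes U :: "sphere set"
  assumes "open U" "finite U"
  shows "U = {}"
proof -
  have op: "open (Some -` U)" and bd: "None \<in> U \<Longrightarrow> bounded (- (Some -` U))" using assms(1) by (auto simp: open_option_iff)
  have "finite (Some -` U)" using assms(2) by (simp add: finite_vimageI)
  hence e: "Some -` U = {}" using op finite_imp_not_open by blast
  have "None \<notin> U"
  proof
    assume "None \<in> U"
    hence "bounded (UNIV :: complex set)" using bd e by simp
    thus False using not_bounded_UNIV by blast
  qed
  moreover have "Some z \<notin> U" for z using e by blast
  ultimately show ?thesis by (metis all_not_in_conv not_Some_eq)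
qed

lemma continuous_rat_map:
  assumes "coprime p q" "q \<noteq> 0"
  shows "continuous_on UNIV (rat_map p q)"
proof (cases "max (degree p) (degree q) > 0")
  case True
  then interpret ratfun p q using assms by unfold_locales auto
  show ?thesis by (rule continuous_f)
next
  case False
  hence "degree p = 0" "degree q = 0" by auto
  then obtain a b where ab: "p = [:a:]" "q = [:b:]" by (metis degree_eq_zeroE)
  hence "rat_map p q = (\<lambda>x. Some (a / b))" using assms(2) by (auto simp: rat_map_def fun_eq_iff split: option.splits)
  thus ?thesis by simp
qed

text \<open>Among all representations of the fraction, one whose denominator has least degree is reduced.\<close>

lemma quotient_reduced:
  fixes P Q :: "complex poly"
  assumes "Q \<noteq> 0"
  obtains p q where "q \<noteq> 0" "coprime p q" "P * q = p * Q"
proof -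
  let ?S = "\<lambda>q. q \<noteq> 0 \<and> (\<exists>p. P * q = p * Q)"
  have "\<exists>q. ?S q \<and> (\<forall>q'. ?S q' \<longrightarrow> degree q \<le> degree q')"
    by (rule ex_has_least_nat[of ?S Q]) (use assms in auto)
  then obtain q p where q: "q \<noteq> 0" "P * q = p * Q" and min: "\<And>q'. ?S q' \<Longrightarrow> degree q \<le> degree q'" by blast
  have "coprime p q"
  proof (rule coprimeI)
    fix r assume "r dvd p" "r dvd q"
    then obtain p' q' where pq: "p = r * p'" "q = r * q'" by (auto elim!: dvdE)
    have nz: "r \<noteq> 0" "q' \<noteq> 0" using q(1) pq by auto
    have "r * (P * q') = r * (p' * Q)" using q(2) pq by (simp add: algebra_simps)
    hence "P * q' = p' * Q" using nz by simp
    hence "degree q \<le> degree q'" using min nz by blast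
    hence "degree r = 0" using pq(2) nz by (simp add: degree_mult_eq)
    thus "is_unit r" using nz(1) by (simp add: is_unit_iff_degree)
  qed
  thus ?thesis using that q by blast
qed

text \<open>The function has poles but no essential singularities, since it is continuous as a map to the sphere.
  Multiplied by a suitable polynomial it becomes entire, and as its behaviour at infinity is again
  controlled by continuity, this entire function is a polynomial.\<close>

lemma rational_functionI:
  fixes \<psi> :: "sphere \<Rightarrow> sphere"
  assumes cont: "continuous_on UNIV \<psi>" and fin: "finite Z"
    and nN: "\<And>z. z \<notin> Z \<Longrightarrow> \<psi> (Some z) \<noteq> None"
    and hol: "(\<lambda>z. the (\<psi> (Some z))) holomorphic_on - Z"
  shows "rational_function \<psi>"
proof -
  define u where "u = (\<lambda>z. the (\<psi> (Some z)))"
  define P where "P = {z. \<psi> (Some z) = None}"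
  have finP: "finite P" using nN fin by (metis (mono_tags, lifting) P_def finite_subset mem_Collect_eq subsetI)
  have limS: "((\<lambda>z. \<psi> (Some z)) \<longlongrightarrow> \<psi> (Some a)) (at a)" for a
    using continuous_on_tendsto_compose[OF cont, of Some "Some a" "at a"] by (simp add: tendsto_Some)
  have eq: "\<psi> (Some z) = Some (u z)" if "z \<notin> P" for z using that by (auto simp: u_def P_def)
  have evP: "\<forall>\<^sub>F z in at a. z \<notin> P" for a
  proof -
    have "open (- (P - {a}))" using finP by (intro open_Compl finite_imp_closed) simp
    thus ?thesis unfolding eventually_at_topological by (intro exI[of _ "- (P - {a})"]) auto
  qed
  have lim: "(u \<longlongrightarrow> u a) (at a)" if "a \<notin> P" for a
  proof -
    have "((\<lambda>z. \<psi> (Some z)) \<longlongrightarrow> Some (u a)) (at a)"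
      by (subst eq[OF that, symmetric]) (rule limS)
    hence "((\<lambda>z. the (\<psi> (Some z))) \<longlongrightarrow> u a) (at a)" by (rule tendsto_the(1))
    thus ?thesis by (subst u_def)
  qed
  have holu: "u holomorphic_on - P"
  proof (rule no_isolated_singularity)
    show "continuous_on (- P) u" using lim by (auto simp: continuous_on_def intro: tendsto_within_subset)
    show "u holomorphic_on - P - Z" using hol unfolding u_def by (rule holomorphic_on_subset) auto
    show "open (- P)" using finP by (simp add: finite_imp_closed open_Compl)
  qed (rule fin)
  have poleu: "filterlim u at_infinity (at a)" if "a \<in> P" for a
  proof -
    have "((\<lambda>z. \<psi> (Some z)) \<longlongrightarrow> None) (at a)" using limS[of a] that by (simp add: P_def)
    moreover have "\<forall>\<^sub>F z in at a. \<psi> (Some z) = Some (u z)" using evP by (rule eventually_mono) (rule eq)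
    ultimately have "((\<lambda>z. Some (u z)) \<longlongrightarrow> None) (at a)" by (rule Lim_transform_eventually)
    thus ?thesis by (simp add: tendsto_Some_None)
  qed
  have "\<exists>n l. ((\<lambda>z. (z - a) ^ n * u z) \<longlongrightarrow> l) (at a)" if a: "a \<in> P" for a
  proof -
    define n where "n = nat (- zorder u a)"
    define h where "h = zor_poly u a"
    have op: "open (- (P - {a}))" using finP by (intro open_Compl finite_imp_closed) simp
    have "u holomorphic_on - (P - {a}) - {a}" using holu by (rule holomorphic_on_subset) auto
    moreover have "is_pole u a" using poleu[OF a] by (simp add: is_pole_def)
    ultimately obtain r where r: "r > 0" "h holomorphic_on cball a r"
       "\<forall>w\<in>cball a r - {a}. u w = h w / (w - a) ^ n \<and> h w \<noteq> 0"
      using zorder_exist_pole[of u "- (P - {a})" a] op unfolding n_def h_def by auto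
    have "isCont h a" using r(1,2) by (metis centre_in_ball continuous_on_interior holomorphic_on_imp_continuous_on interior_cball)
    hence "(h \<longlongrightarrow> h a) (at a)" by (simp add: isCont_def)
    moreover have "\<forall>\<^sub>F w in at a. h w = (w - a) ^ n * u w"
      unfolding eventually_at using r(1,3) by (intro exI[of _ r]) (auto simp: dist_commute)
    ultimately have "((\<lambda>z. (z - a) ^ n * u z) \<longlongrightarrow> h a) (at a)" by (rule Lim_transform_eventually)
    thus ?thesis by blast
  qed
  hence "\<forall>a\<in>P. \<exists>n l. ((\<lambda>z. (z - a) ^ n * u z) \<longlongrightarrow> l) (at a)" by blast
  then obtain n l where nl: "\<And>a. a \<in> P \<Longrightarrow> ((\<lambda>z. (z - a) ^ n a * u z) \<longlongrightarrow> l a) (at a)" by metis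
  define Q where "Q = (\<Prod>a\<in>P. [:- a, 1:] ^ n a)"
  have Qnz: "Q \<noteq> 0" using finP by (simp add: Q_def)
  have pQ: "poly Q z = (\<Prod>a\<in>P. (z - a) ^ n a)" for z by (simp add: Q_def poly_prod)
  have limQ: "((\<lambda>z. poly Q z * u z) \<longlongrightarrow> (\<Prod>b\<in>P-{a}. (a - b) ^ n b) * l a) (at a)" if a: "a \<in> P" for a
  proof -
    have e: "poly Q z * u z = (\<Prod>b\<in>P-{a}. (z - b) ^ n b) * ((z - a) ^ n a * u z)" for z
      unfolding pQ using prod.remove[OF finP a, of "\<lambda>a. (z - a) ^ n a"] by simp
    show ?thesis unfolding e by (intro tendsto_intros nl[OF a])
  qed
  define v where "v z = (if z \<in> P then (\<Prod>b\<in>P-{z}. (z - b) ^ n b) * l z else poly Q z * u z)" for z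
  have vlim: "(v \<longlongrightarrow> v a) (at a)" for a
  proof -
    have "\<forall>\<^sub>F z in at a. poly Q z * u z = v z" using evP by (rule eventually_mono) (simp add: v_def)
    moreover have "((\<lambda>z. poly Q z * u z) \<longlongrightarrow> v a) (at a)"
    proof (cases "a \<in> P")
      case True thus ?thesis using limQ by (simp add: v_def)
    next
      case False thus ?thesis using lim[OF False] by (auto simp: v_def intro!: tendsto_intros)
    qed
    ultimately show ?thesis by (rule Lim_transform_eventually[rotated])
  qed
  have holv: "v holomorphic_on UNIV"
  proof (rule no_isolated_singularity)
    show "continuous_on UNIV v" using vlim by (auto simp: continuous_on_def)
    have "(\<lambda>z. poly Q z * u z) holomorphic_on UNIV - P" using holu by (auto intro!: holomorphic_intros simp: Compl_eq_Diff_UNIV)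
    thus "v holomorphic_on UNIV - P" by (rule holomorphic_transform) (simp add: v_def)
  qed (use finP in auto)
  have evinfP: "\<forall>\<^sub>F z in at_infinity. z \<notin> P \<and> norm (poly Q z) \<ge> 1"
  proof -
    obtain B where B: "\<And>a. a \<in> P \<Longrightarrow> norm a < B" using finite_imp_bounded[OF finP] 
      by (metis bounded_pos_less)
    have "z \<notin> P \<and> norm (poly Q z) \<ge> 1" if z: "norm z \<ge> B + 1" for z
    proof
      show "z \<notin> P" using B z by force
      have "norm (z - a) \<ge> 1" if "a \<in> P" for a using B[OF that] z norm_triangle_ineq2[of z a] by linarith
      hence "1 \<le> (\<Prod>a\<in>P. norm (z - a) ^ n a)" by (intro prod_ge_1 one_le_power) auto
      thus "norm (poly Q z) \<ge> 1" by (simp add: pQ norm_power flip: prod_norm)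
    qed
    thus ?thesis unfolding eventually_at_infinity by blast
  qed
  have tNone: "((\<lambda>z. \<psi> (Some z)) \<longlongrightarrow> \<psi> None) at_infinity"
  proof -
    have "(Some \<longlongrightarrow> (None::sphere)) at_infinity"
      using tendsto_Some_None[of "\<lambda>z::complex. z" at_infinity] by (simp add: filterlim_ident)
    thus ?thesis using continuous_on_tendsto_compose[OF cont] by simp
  qed
  \<comment> \<open>adding the identity turns a finite value at infinity into a pole there\<close>
  obtain \<delta> :: complex where \<delta>: "filterlim (\<lambda>z. u z + \<delta> * z) at_infinity at_infinity"
  proof (cases "\<psi> None")
    case None
    have "\<forall>\<^sub>F z in at_infinity. \<psi> (Some z) = Some (u z)" using evinfP by (rule eventually_mono) (use eq in auto)
    moreover have "((\<lambda>z. \<psi> (Some z)) \<longlongrightarrow> None) at_infinity" using tNone None by simp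
    ultimately have "((\<lambda>z. Some (u z)) \<longlongrightarrow> None) at_infinity" by (rule Lim_transform_eventually[rotated])
    thus ?thesis using that[of 0] by (simp add: tendsto_Some_None)
  next
    case (Some c)
    have "((\<lambda>z. the (\<psi> (Some z))) \<longlongrightarrow> c) at_infinity" by (rule tendsto_the(1)) (use tNone Some in simp)
    hence "(u \<longlongrightarrow> c) at_infinity" by (subst u_def)
    hence "filterlim (\<lambda>z. u z + z) at_infinity at_infinity"
      by (rule tendsto_add_filterlim_at_infinity) (rule filterlim_ident)
    thus ?thesis using that[of 1] by simp
  qed
  define v' where "v' z = v z + \<delta> * z * poly Q z" for z
  have "v' holomorphic_on UNIV" unfolding v'_def using holv by (auto intro!: holomorphic_intros)
  moreover have "((inverse \<circ> v') \<longlongrightarrow> 0) at_infinity"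
  proof -
    have "filterlim (\<lambda>z. norm (u z + \<delta> * z)) at_top at_infinity"
      using \<delta> by (simp add: filterlim_at_infinity_conv_norm_at_top)
    moreover have "\<forall>\<^sub>F z in at_infinity. norm (u z + \<delta> * z) \<le> norm (v' z)" using evinfP
    proof eventually_elim
      case (elim z)
      hence "v' z = poly Q z * (u z + \<delta> * z)" by (simp add: v'_def v_def algebra_simps)
      thus ?case using elim mult_right_mono[of 1 "norm (poly Q z)" "norm (u z + \<delta> * z)"] by (simp add: norm_mult)
    qed
    ultimately have "filterlim (\<lambda>z. norm (v' z)) at_top at_infinity" by (rule filterlim_at_top_mono)
    hence "filterlim v' at_infinity at_infinity" by (simp add: filterlim_at_infinity_conv_norm_at_top)
    thus ?thesis unfolding o_def by (rule filterlim_compose[OF tendsto_inverse_0])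
  qed
  ultimately obtain a N where aN: "\<And>z. v' z = (\<Sum>i\<le>N. a i * z ^ i)" by (rule pole_at_infinity) blast
  define R where "R = (\<Sum>i\<le>N. monom (a i) i) - smult \<delta> ([:0, 1:] * Q)"
  have R: "poly R z = v z" for z
  proof -
    have "poly (\<Sum>i\<le>N. monom (a i) i) z = v' z" by (simp add: aN poly_sum poly_monom)
    thus ?thesis by (simp add: R_def v'_def)
  qed
  obtain p q where pq: "q \<noteq> 0" "coprime p q" "R * q = p * Q" using quotient_reduced[OF Qnz] .
  have agree: "\<psi> (Some z) = rat_map p q (Some z)" if "z \<notin> P" "poly Q z \<noteq> 0" "poly q z \<noteq> 0" for z
  proof -
    have "poly R z * poly q z = poly p z * poly Q z" using pq(3) by (metis poly_mult)
    moreover have "poly R z = poly Q z * u z" using R that(1) by (simp add: v_def)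
    ultimately have "u z = poly p z / poly q z" using that by (simp add: field_simps)
    thus ?thesis using eq[OF that(1)] that by (simp add: rat_map_def)
  qed
  let ?D = "{x\<in>UNIV. \<psi> x \<noteq> rat_map p q x}"
  have "open ?D" by (rule open_Collect_neq_on[OF open_UNIV cont continuous_rat_map[OF pq(2,1)]])
  moreover have "?D \<subseteq> insert None (Some ` (P \<union> {z. poly Q z = 0} \<union> {z. poly q z = 0}))"
  proof
    fix x assume "x \<in> ?D"
    thus "x \<in> insert None (Some ` (P \<union> {z. poly Q z = 0} \<union> {z. poly q z = 0}))"
      using agree by (cases x) auto
  qed
  hence "finite ?D" using finP poly_roots_finite[OF Qnz] poly_roots_finite[OF pq(1)] by (meson finite_Un finite_imageI finite_insert finite_subset)
  ultimately have "?D = {}" by (rule finite_open_sphere_empty)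
  hence "\<psi> = rat_map p q" by (simp add: fun_eq_iff)
  thus ?thesis using pq unfolding rational_function_def by blast
qed

text \<open>Off a finite set the lift is, locally, a holomorphic inverse of \<open>f\<close> composed with \<open>g\<close>.\<close>

theorem (in rat_lifting) factorization:
  assumes c: "\<And>x. compat x"
  obtains \<psi> where "rational_function \<psi>" "g = f \<circ> \<psi>"
proof -
  obtain \<Psi> where \<Psi>: "continuous_on UNIV \<Psi>" "\<And>x. f (\<Psi> x) = g x" using lift_sphere[OF c] by metis
  define Z0 where "Z0 = Z \<union> {z. \<Psi> (Some z) = None} \<union> {z. g (Some z) = None}"
  have "finite {z. \<Psi> (Some z) = None}"
  proof -
    have "{z. \<Psi> (Some z) = None} \<subseteq> Some -` {x. g x = f None}" using \<Psi>(2) by (auto, metis)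
    thus ?thesis using G.finite_fibre by (meson finite_subset finite_vimageI inj_Some)
  qed
  moreover have "finite {z. g (Some z) = None}"
  proof -
    have e: "{z. g (Some z) = None} = Some -` {x. g x = None}" by auto
    show ?thesis unfolding e by (intro finite_vimageI G.finite_fibre) simp
  qed
  ultimately have finZ0: "finite Z0" using finite_Z by (simp add: Z0_def)
  define u where "u = (\<lambda>z. the (\<Psi> (Some z)))"
  have opZ0: "open (- Z0)" using finZ0 by (simp add: finite_imp_closed open_Compl)
  have "u field_differentiable at z" if z: "z \<notin> Z0" for z
  proof -
    have y: "\<Psi> (Some z) = Some (u z)" using z by (auto simp: Z0_def u_def)
    have "f (\<Psi> (Some z)) = g (Some z)" by (rule \<Psi>(2))
    hence m1: "F.mul (\<Psi> (Some z)) = 1" using z by (auto simp: Z0_def Z_def)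
    obtain U where U: "open U" "\<Psi> (Some z) \<in> U" "inj_on f U"
      by (rule F.locally_injective[OF m1 open_UNIV UNIV_I])
    define W where "W = Some -` U \<inter> {w. poly q w \<noteq> 0}"
    have W: "open W" unfolding W_def using U(1) 
      by (intro open_Int open_Collect_neq continuous_intros) (auto simp: open_option_iff)
    define Fq where "Fq = (\<lambda>w. poly p w / poly q w)"
    have fFq: "f (Some w) = Some (Fq w)" if "w \<in> W" for w using that by (simp add: W_def rat_map_def Fq_def)
    have holF: "Fq holomorphic_on W" unfolding Fq_def by (auto simp: W_def intro!: holomorphic_intros)
    have injF: "inj_on Fq W"
    proof (rule inj_onI)
      fix a b assume ab: "a \<in> W" "b \<in> W" "Fq a = Fq b"
      hence "f (Some a) = f (Some b)" using fFq by simp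
      moreover have "Some a \<in> U" "Some b \<in> U" using ab by (auto simp: W_def)
      ultimately have "Some a = Some b" by (rule inj_onD[OF U(3)])
      thus "a = b" by simp
    qed
    obtain J where J: "J holomorphic_on Fq ` W" "\<And>w. w \<in> W \<Longrightarrow> J (Fq w) = w"
      by (rule holomorphic_has_inverse[OF holF W injF]) blast
    have uW: "u z \<in> W"
    proof -
      have "poly q (u z) \<noteq> 0" using \<Psi>(2)[of "Some z"] y z by (auto simp: Z0_def rat_map_def split: if_splits)
      thus ?thesis using U(2) y by (simp add: W_def)
    qed
    have contu: "((\<lambda>z. \<Psi> (Some z)) \<longlongrightarrow> \<Psi> (Some z)) (nhds z)"
      using continuous_on_tendsto_compose[OF \<Psi>(1), of Some "Some z" "nhds z"] by (simp add: tendsto_Some filterlim_ident)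
    have "((\<lambda>z. the (\<Psi> (Some z))) \<longlongrightarrow> u z) (nhds z)" by (rule tendsto_the(1)) (use contu y in simp)
    hence "(u \<longlongrightarrow> u z) (nhds z)" by (subst u_def)
    hence "\<forall>\<^sub>F z' in nhds z. u z' \<in> W" using W uW by (rule topological_tendstoD)
    moreover have "\<forall>\<^sub>F z' in nhds z. z' \<in> - Z0" using opZ0 z eventually_nhds by blast
    ultimately have "\<forall>\<^sub>F z' in nhds z. u z' \<in> W \<and> z' \<in> - Z0" by (rule eventually_conj)
    then obtain e where e: "e > 0" "\<And>z'. z' \<in> ball z e \<Longrightarrow> u z' \<in> W \<and> z' \<notin> Z0"
      unfolding eventually_nhds_metric by (auto simp: dist_commute)
    define Gq where "Gq = (\<lambda>w. poly P w / poly Q w)"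
    have gz: "poly Q z' \<noteq> 0 \<and> Fq (u z') = Gq z'" if "z' \<in> ball z e" for z'
    proof -
      have "\<Psi> (Some z') = Some (u z')" using e(2)[OF that] by (auto simp: Z0_def u_def)
      hence "g (Some z') = Some (Fq (u z'))" using \<Psi>(2)[of "Some z'"] fFq e(2)[OF that] by simp
      thus ?thesis by (auto simp: rat_map_def Gq_def split: if_splits)
    qed
    have "(J \<circ> Gq) holomorphic_on ball z e"
    proof (rule holomorphic_on_compose)
      show "Gq holomorphic_on ball z e" unfolding Gq_def using gz by (auto intro!: holomorphic_intros)
      have "Gq ` ball z e \<subseteq> Fq ` W" using gz e(2) by (metis image_subsetI imageI)
      thus "J holomorphic_on Gq ` ball z e" using J(1) holomorphic_on_subset by blast
    qed
    hence "u holomorphic_on ball z e"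
    proof (rule holomorphic_transform)
      fix z' assume "z' \<in> ball z e"
      thus "(J \<circ> Gq) z' = u z'" using gz e(2) J(2) by (metis comp_apply)
    qed
    thus ?thesis using e(1) by (meson centre_in_ball holomorphic_on_imp_differentiable_at open_ball)
  qed
  hence "u holomorphic_on - Z0" by (auto simp: holomorphic_on_def field_differentiable_at_within)
  hence "rational_function \<Psi>"
    by (intro rational_functionI[OF \<Psi>(1) finZ0]) (auto simp: u_def Z0_def)
  thus ?thesis using that[of \<Psi>] \<Psi>(2) by (simp add: fun_eq_iff)
qed

section \<open>Sections of a clean Belyi function\<close>

lemma components_CP1: "connected_components_of (subtopology CP1 A) = components A"
proof -
  have "connected_component_of (subtopology euclidean A) x y \<longleftrightarrow> connected_component A x y" for x y :: sphere
    unfolding connected_component_of_def connected_component_def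
    by (auto simp: connectedin_subtopology)
  hence "connected_component_of (subtopology euclidean A) = connected_component A" by (intro ext)
  thus ?thesis
    unfolding CP1_eq_euclidean connected_components_of_def components_def by simp
qed

text \<open>Each of the finitely many sets is relatively closed in the union, so each is relatively open.\<close>

lemma components_eqI:
  fixes E :: "'a::topological_space set set"
  assumes fin: "finite E" and ne: "{} \<notin> E" and con: "\<And>e. e \<in> E \<Longrightarrow> connected e"
    and disj: "\<And>e e'. e \<in> E \<Longrightarrow> e' \<in> E \<Longrightarrow> e \<noteq> e' \<Longrightarrow> closure e \<inter> e' = {}"
  shows "components (\<Union>E) = E"
proof -
  have comp: "e \<in> components (\<Union>E)" if e: "e \<in> E" for e
  proof (rule in_components_maximal[THEN iffD2], intro conjI allI impI)
    show "e \<noteq> {}" "e \<subseteq> \<Union>E" "connected e" using e ne con by auto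
  next
    fix d assume d: "d \<noteq> {} \<and> e \<subseteq> d \<and> d \<subseteq> \<Union>E \<and> connected d"
    let ?B = "\<Union>e'\<in>E - {e}. closure e'"
    have "closed (closure e)" "closed ?B" using fin by (auto intro!: closed_UN)
    moreover have "d \<subseteq> closure e \<union> ?B"
    proof
      fix x assume "x \<in> d"
      then obtain e' where "e' \<in> E" "x \<in> e'" using d by blast
      thus "x \<in> closure e \<union> ?B" using closure_subset[of e'] by (cases "e' = e") auto
    qed
    moreover have "closure e \<inter> ?B \<inter> d = {}"
    proof (rule ccontr)
      assume "closure e \<inter> ?B \<inter> d \<noteq> {}"
      then obtain x e' where x: "x \<in> closure e" "e' \<in> E" "e' \<noteq> e" "x \<in> closure e'" "x \<in> d" by auto
      then obtain e'' where e'': "e'' \<in> E" "x \<in> e''" using d by blast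
      show False using disj[OF e e''(1)] disj[OF x(2) e''(1)] x e''(2) by blast
    qed
    ultimately have "closure e \<inter> d = {} \<or> ?B \<inter> d = {}" using connected_closedD[of d "closure e" ?B] d by blast
    moreover have "closure e \<inter> d \<noteq> {}" using d closure_subset[of e] \<open>e \<in> E\<close> ne by (metis Int_absorb1 bot.extremum_uniqueI inf.absorb_iff2 inf_mono order_refl)
    ultimately have B: "?B \<inter> d = {}" by blast
    have "d \<subseteq> e"
    proof
      fix x assume "x \<in> d"
      then obtain e' where "e' \<in> E" "x \<in> e'" using d by blast
      thus "x \<in> e" using B \<open>x \<in> d\<close> closure_subset[of e'] by (cases "e' = e") auto
    qed
    thus "d = e" using d by blast
  qed
  show ?thesis
  proof
    show "E \<subseteq> components (\<Union>E)" using comp by blast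
    show "components (\<Union>E) \<subseteq> E"
    proof
      fix c assume c: "c \<in> components (\<Union>E)"
      then obtain x where x: "x \<in> c" "x \<in> \<Union>E" 
        using in_components_nonempty in_components_subset by (metis all_not_in_conv subsetD)
      then obtain e where e: "e \<in> E" "x \<in> e" by blast
      hence "c = e" using components_nonoverlap[OF c comp[OF e(1)]] x(1) by blast
      thus "c \<in> E" using e by simp
    qed
  qed
qed

text \<open>Sections of \<open>f\<close> are lifts of the identity, the rational function \<open>[:0, 1:] / 1\<close>, through \<open>f\<close>.\<close>

locale clean_ratfun = ratfun +
  assumes ramified: "\<And>x. mul x \<noteq> 1 \<Longrightarrow> f x \<in> {Some 0, Some 1, None}"
    and over_1: "\<And>x. f x = Some 1 \<Longrightarrow> mul x = 2"
begin

sublocale id: ratfun "[:0, 1:]" 1 by unfold_locales auto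
sublocale sec: rat_lifting p q "[:0, 1:]" 1 by unfold_locales

lemma id_map [simp]: "rat_map [:0, 1:] 1 (Some z) = Some z" by (simp add: rat_map_def)

definition section_on :: "complex set \<Rightarrow> (complex \<Rightarrow> sphere) \<Rightarrow> bool" where
  "section_on \<Omega> s \<longleftrightarrow> continuous_on \<Omega> s \<and> (\<forall>w\<in>\<Omega>. f (s w) = Some w)"

lemma section_on_lift: "section_on \<Omega> s \<longleftrightarrow> sec.lift_on \<Omega> s"
  by (simp add: section_on_def sec.lift_on_def)

lemma not_in_Z: "z \<notin> {0, 1} \<Longrightarrow> z \<notin> sec.Z" 
  using ramified by (fastforce simp: sec.Z_def)

lemma compat: "z \<notin> {0, 1} \<Longrightarrow> sec.compat z"
  unfolding sec.compat_def
proof (intro allI impI)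
  fix y assume "z \<notin> {0, 1}" "f y = rat_map [:0, 1:] 1 (Some z)"
  hence "mul y = 1" using ramified[of y] by auto
  thus "mul y dvd id.mul (Some z)" by simp
qed

lemma mul_eq_1: "f z = Some a \<Longrightarrow> a \<notin> {0, 1} \<Longrightarrow> mul z = 1"
  using ramified[of z] by auto

lemma section_exists:
  assumes "open \<Omega>" "convex \<Omega>" "\<Omega> \<inter> {0, 1} = {}" "a \<in> \<Omega>" "f z = Some a"
  obtains s where "section_on \<Omega> s" "s a = z"
proof -
  have "\<And>x. x \<in> \<Omega> \<Longrightarrow> sec.compat x" using compat assms by blast
  moreover have "a \<notin> sec.Z" using not_in_Z assms by blast
  ultimately obtain \<psi> where "sec.lift_on \<Omega> \<psi>" "\<psi> a = z"
    using sec.lift_convex[OF assms(1,2) _ assms(4), of z] assms(5) by auto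
  thus ?thesis using that by (simp add: section_on_lift)
qed

lemma section_unique:
  assumes "open \<Omega>" "connected \<Omega>" "section_on \<Omega> s" "section_on \<Omega> s'" "\<Omega> \<inter> {0, 1} = {}" 
    "a \<in> \<Omega>" "s a = s' a" "w \<in> \<Omega>"
  shows "s w = s' w"
proof (rule sec.lift_unique[OF assms(1,2)])
  show "a \<notin> sec.Z" using not_in_Z assms by blast
qed (use assms in \<open>auto simp: section_on_lift\<close>)

lemma section_subset: "section_on \<Omega> s \<Longrightarrow> \<Omega>' \<subseteq> \<Omega> \<Longrightarrow> section_on \<Omega>' s"
  unfolding section_on_def using continuous_on_subset by blast

text \<open>A section is locally an inverse of \<open>f\<close>, restricted to an open set where \<open>f\<close> is injective.\<close>

lemma open_section_image:
  assumes "open \<Omega>" "section_on \<Omega> s" "\<Omega> \<inter> {0, 1} = {}"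
  shows "open (s ` \<Omega>)"
proof (subst open_subopen, intro ballI)
  fix z assume "z \<in> s ` \<Omega>"
  then obtain a where a: "a \<in> \<Omega>" "z = s a" by blast
  have "f z = Some a" using assms(2) a by (simp add: section_on_def)
  hence m1: "mul z = 1" using mul_eq_1 a assms(3) by blast
  obtain U where U: "open U" "z \<in> U" "inj_on f U"
    by (rule locally_injective[OF m1 open_UNIV UNIV_I])
  have opA: "open (\<Omega> \<inter> s -` U)" using assms(1,2) U(1) continuous_open_preimage by (metis section_on_def)
  let ?T = "U \<inter> f -` (Some ` (\<Omega> \<inter> s -` U))"
  have "open ?T" by (intro open_Int U(1) open_vimage continuous_f) (simp add: open_image_Some opA)
  moreover have "z \<in> ?T" using U(2) a \<open>f z = Some a\<close> by auto
  moreover have "?T \<subseteq> s ` \<Omega>"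
  proof
    fix u assume u: "u \<in> ?T"
    then obtain w where w: "f u = Some w" "w \<in> \<Omega>" "s w \<in> U" by auto
    have "f (s w) = f u" using w assms(2) by (simp add: section_on_def)
    hence "s w = u" using inj_onD[OF U(3)] u w(3) by blast
    thus "u \<in> s ` \<Omega>" using w(2) by blast
  qed
  ultimately show "\<exists>T. open T \<and> z \<in> T \<and> T \<subseteq> s ` \<Omega>" by blast
qed

text \<open>The filter \<open>F\<close> describes a way to approach \<open>y\<close> inside \<open>\<Omega>\<close>. It has a basis of connected sets, as
  needed for the convergence of sections.\<close>

definition approach :: "complex filter \<Rightarrow> complex set \<Rightarrow> sphere \<Rightarrow> bool" where
  "approach F \<Omega> y \<longleftrightarrow> F \<noteq> bot \<and> (\<forall>\<^sub>F w in F. w \<in> \<Omega>) \<and> (Some \<longlongrightarrow> y) F \<and> y \<notin> Some ` \<Omega> \<and>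
     (\<forall>P. eventually P F \<longrightarrow> (\<exists>C. connected C \<and> (\<forall>\<^sub>F w in F. w \<in> C) \<and> (\<forall>w\<in>C. P w)))"

lemma section_limit:
  assumes "approach F \<Omega> y" "section_on \<Omega> s"
  shows "f (Lim F s) = y" "(s \<longlongrightarrow> Lim F s) F"
proof -
  have A: "F \<noteq> bot" "\<forall>\<^sub>F w in F. w \<in> \<Omega>" "(Some \<longlongrightarrow> y) F" 
     "\<And>P. eventually P F \<Longrightarrow> \<exists>C. connected C \<and> (\<forall>\<^sub>F w in F. w \<in> C) \<and> (\<forall>w\<in>C. P w)"
    using assms(1) unfolding approach_def by blast+
  have "\<forall>\<^sub>F w in F. Some w = f (s w)" 
    using A(2) by (rule eventually_mono) (use assms(2) in \<open>simp add: section_on_def\<close>)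
  hence lim: "((\<lambda>w. f (s w)) \<longlongrightarrow> y) F" using A(3) by (rule Lim_transform_eventually[rotated])
  obtain x where x: "f x = y" "(s \<longlongrightarrow> x) F"
  proof (rule lift_limit[OF A(1) lim A(4) _ A(2)])
    show "continuous_on \<Omega> s" using assms(2) by (simp add: section_on_def)
  qed
  thus "f (Lim F s) = y" "(s \<longlongrightarrow> Lim F s) F" using tendsto_Lim[OF _ x(2)] A(1) by auto
qed

text \<open>The section over \<open>\<Omega>\<close> that maps the base point \<open>a\<close> to \<open>z\<close>; it is unique on \<open>\<Omega>\<close> when \<open>\<Omega>\<close> is convex and open and
  avoids \<open>0\<close> and \<open>1\<close>.\<close>

definition through :: "complex set \<Rightarrow> complex \<Rightarrow> sphere \<Rightarrow> complex \<Rightarrow> sphere" where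
  "through \<Omega> a z = (SOME s. section_on \<Omega> s \<and> s a = z)"

lemma through:
  assumes "open \<Omega>" "convex \<Omega>" "\<Omega> \<inter> {0, 1} = {}" "a \<in> \<Omega>" "f z = Some a"
  shows "section_on \<Omega> (through \<Omega> a z)" "through \<Omega> a z a = z"
proof -
  have "\<exists>s. section_on \<Omega> s \<and> s a = z" using section_exists[OF assms] by metis
  from someI_ex[OF this] show "section_on \<Omega> (through \<Omega> a z)" "through \<Omega> a z a = z"
    unfolding through_def by auto
qed

text \<open>The values of all sections at one point \<open>w\<close> of \<open>\<Omega>\<close> are exactly the points over \<open>w\<close>. If \<open>w\<close> is close
  to \<open>y\<close>, then \<open>mul x\<close> of these lie in a small neighbourhood of \<open>x\<close>, and a section has its value there
  if and only if it tends to \<open>x\<close>.\<close>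

lemma card_limit_fibre:
  assumes \<Omega>: "open \<Omega>" "convex \<Omega>" "\<Omega> \<inter> {0, 1} = {}" "a \<in> \<Omega>" 
    and A: "approach F \<Omega> y" and x: "f x = y"
  shows "card {z. f z = Some a \<and> Lim F (through \<Omega> a z) = x} = mul x"
proof -
  let ?X = "{z. f z = Some a}"
  let ?\<sigma> = "through \<Omega> a" and ?L = "\<lambda>z. Lim F (through \<Omega> a z)"
  have sec: "section_on \<Omega> (?\<sigma> z)" "?\<sigma> z a = z" if "z \<in> ?X" for z
    using through[OF \<Omega>] that by auto
  have L: "f (?L z) = y" "(?\<sigma> z \<longlongrightarrow> ?L z) F" if "z \<in> ?X" for z
    using section_limit[OF A sec(1)[OF that]] by auto
  obtain T where T: "\<And>x. x \<in> {x. f x = y} \<Longrightarrow> open (T x) \<and> x \<in> T x" 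
    "\<And>x x'. x \<in> {x. f x = y} \<Longrightarrow> x' \<in> {x. f x = y} \<Longrightarrow> x \<noteq> x' \<Longrightarrow> T x \<inter> T x' = {}"
    using separate_finite_t2[OF finite_fibre[of y]] by metis
  have "\<forall>x\<in>{x. f x = y}. \<exists>U. open U \<and> x \<in> U \<and> U \<subseteq> T x \<and> (\<forall>\<^sub>F w in at (f x). card {u\<in>U. f u = w} = mul x)"
  proof
    fix x assume x: "x \<in> {x. f x = y}"
    have Tx: "open (T x)" "x \<in> T x" using T(1)[OF x] by auto
    obtain V where "open V" "x \<in> V" "V \<subseteq> T x" "\<forall>\<^sub>F w in at (f x). card {u\<in>V. f u = w} = mul x"
      by (rule eventually_card_fibre[OF Tx])
    thus "\<exists>U. open U \<and> x \<in> U \<and> U \<subseteq> T x \<and> (\<forall>\<^sub>F w in at (f x). card {u\<in>U. f u = w} = mul x)" by blast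
  qed
  from bchoice[OF this] obtain U where
    "\<forall>x\<in>{x. f x = y}. open (U x) \<and> x \<in> U x \<and> U x \<subseteq> T x \<and> (\<forall>\<^sub>F w in at (f x). card {u\<in>U x. f u = w} = mul x)" ..
  note U = bspec[OF this]
  have A': "F \<noteq> bot" "\<forall>\<^sub>F w in F. w \<in> \<Omega>" "(Some \<longlongrightarrow> y) F" "y \<notin> Some ` \<Omega>"
    using A unfolding approach_def by blast+
  have atF: "filterlim Some (at y) F"
    unfolding filterlim_at using A'(2,3) by (auto elim!: eventually_mono simp: A'(4)) (use A'(4) in blast)
  have ev1: "\<forall>\<^sub>F w in F. card {u\<in>U x. f u = Some w} = mul x"
    by (rule eventually_compose_filterlim[OF _ atF]) (use U[of x] x in simp)
  have ev2: "\<forall>\<^sub>F w in F. \<forall>z\<in>?X. ?\<sigma> z w \<in> U (?L z)"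
  proof (subst eventually_ball_finite_distrib[OF finite_fibre], intro ballI)
    fix z assume z: "z \<in> ?X"
    show "\<forall>\<^sub>F w in F. ?\<sigma> z w \<in> U (?L z)"
      by (rule topological_tendstoD[OF L(2)[OF z]]) (use U[of "?L z"] L(1)[OF z] in auto)
  qed
  obtain w where w: "card {u\<in>U x. f u = Some w} = mul x" "\<And>z. z \<in> ?X \<Longrightarrow> ?\<sigma> z w \<in> U (?L z)" "w \<in> \<Omega>"
    using eventually_happens[OF eventually_conj[OF ev1 eventually_conj[OF ev2 A'(2)]]] A'(1) by blast
  have "bij_betw (\<lambda>z. ?\<sigma> z w) {z. f z = Some a \<and> ?L z = x} {u\<in>U x. f u = Some w}"
  proof (rule bij_betwI')
    fix z z' assume z: "z \<in> {z. f z = Some a \<and> ?L z = x}" "z' \<in> {z. f z = Some a \<and> ?L z = x}"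
    show "(?\<sigma> z w = ?\<sigma> z' w) = (z = z')"
    proof
      assume "?\<sigma> z w = ?\<sigma> z' w"
      hence "?\<sigma> z a = ?\<sigma> z' a"
        using section_unique[OF \<Omega>(1) convex_connected[OF \<Omega>(2)] sec(1) sec(1) \<Omega>(3) w(3) _ \<Omega>(4)] z by blast
      thus "z = z'" using sec(2) z by simp
    qed simp
  next
    fix z assume z: "z \<in> {z. f z = Some a \<and> ?L z = x}"
    thus "?\<sigma> z w \<in> {u\<in>U x. f u = Some w}" using w(2)[of z] sec(1)[of z] w(3) by (auto simp: section_on_def)
  next
    fix u assume u: "u \<in> {u\<in>U x. f u = Some w}"
    obtain s where s: "section_on \<Omega> s" "s w = u" 
      using section_exists[OF \<Omega>(1-3) w(3), of u] u by auto
    define z where "z = s a"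
    have z: "z \<in> ?X" using s \<Omega>(4) by (simp add: z_def section_on_def)
    have eq: "?\<sigma> z w = u"
      using section_unique[OF \<Omega>(1) convex_connected[OF \<Omega>(2)] sec(1)[OF z] s(1) \<Omega>(3,4) _ w(3)] sec(2)[OF z] s(2) by (simp add: z_def)
    have "u \<in> U (?L z)" using w(2)[OF z] eq by simp
    hence "?L z = x" using T(2)[of "?L z" x] U[of "?L z"] U[of x] L(1)[OF z] x u by blast
    thus "\<exists>z\<in>{z. f z = Some a \<and> ?L z = x}. u = ?\<sigma> z w" using z eq by blast
  qed
  thus ?thesis using w(1) by (simp add: bij_betw_same_card)
qed

section \<open>Half-edges and vertex degrees\<close>

text \<open>A convex neighbourhood of the open segment \<open>]0,1[\<close> that avoids the critical values \<open>0\<close> and \<open>1\<close>.\<close>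

definition diam_disc :: "complex set" where "diam_disc = ball (1/2) (1/2)"

lemma diam_disc: "open diam_disc" "convex diam_disc" "diam_disc \<inter> {0, 1} = {}" "1/2 \<in> diam_disc"
  by (auto simp: diam_disc_def dist_norm)

lemma of_real_diam_disc: "complex_of_real t \<in> diam_disc \<longleftrightarrow> 0 < t \<and> t < 1"
proof -
  have "dist (1/2) (complex_of_real t) = \<bar>1/2 - t\<bar>"
  proof -
    have "1/2 - complex_of_real t = complex_of_real (1/2 - t)" by simp
    thus ?thesis unfolding dist_norm by (simp only: norm_of_real)
  qed
  thus ?thesis by (auto simp: diam_disc_def abs_if field_simps)
qed

lemma approach_diam_disc:
  assumes "b \<in> {0, 1}"
  shows "approach (at b within diam_disc) diam_disc (Some b)"
  unfolding approach_def
proof (intro conjI allI impI)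
  have "b \<in> closure diam_disc" using assms by (auto simp: diam_disc_def dist_norm)
  moreover have "b \<notin> diam_disc" using assms diam_disc by auto
  ultimately have "b islimpt diam_disc" by (simp add: closure_def)
  thus "at b within diam_disc \<noteq> bot" by (simp add: trivial_limit_within)
  show "\<forall>\<^sub>F w in at b within diam_disc. w \<in> diam_disc" by (simp add: eventually_at_filter)
  show "(Some \<longlongrightarrow> Some b) (at b within diam_disc)" by (simp add: tendsto_Some)
  show "Some b \<notin> Some ` diam_disc" using \<open>b \<notin> diam_disc\<close> by auto
  fix P assume "eventually P (at b within diam_disc)"
  then obtain d where d: "d > 0" "\<And>w. w \<in> diam_disc \<Longrightarrow> w \<noteq> b \<Longrightarrow> dist w b < d \<Longrightarrow> P w"
    unfolding eventually_at by blast
  have "connected (diam_disc \<inter> ball b d)" using diam_disc(2) by (intro convex_connected convex_Int convex_ball)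
  moreover have "\<forall>\<^sub>F w in at b within diam_disc. w \<in> diam_disc \<inter> ball b d"
    unfolding eventually_at using d(1) by (intro exI[of _ d]) (auto simp: dist_commute)
  moreover have "\<forall>w\<in>diam_disc \<inter> ball b d. P w"
  proof
    fix w assume "w \<in> diam_disc \<inter> ball b d"
    thus "P w" using \<open>b \<notin> diam_disc\<close> by (intro d(2)) (auto simp: dist_commute)
  qed
  ultimately show "\<exists>C. connected C \<and> (\<forall>\<^sub>F w in at b within diam_disc. w \<in> C) \<and> (\<forall>w\<in>C. P w)" by blast
qed

text \<open>A half-edge is a component of the part of the graph over \<open>]0,1[\<close>. It is identified with its point
  over \<open>1/2\<close>; it runs from the vertex \<open>src z\<close> to the point \<open>tgt z\<close> over \<open>1\<close>, which is the middle of the edge.\<close>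

definition X where "X = {z. f z = Some (1/2)}"
definition \<sigma> where "\<sigma> z = through diam_disc (1/2) z"
definition src where "src z = Lim (at 0 within diam_disc) (\<sigma> z)"
definition tgt where "tgt z = Lim (at 1 within diam_disc) (\<sigma> z)"
definition half_edge where "half_edge z = (\<lambda>t. \<sigma> z (complex_of_real t)) ` {0<..<1}"
definition edge where "edge w = insert w (\<Union>z\<in>{z\<in>X. tgt z = w}. half_edge z)"

lemma finite_X: "finite X" unfolding X_def by (rule finite_fibre)

lemma \<sigma>: "z \<in> X \<Longrightarrow> section_on diam_disc (\<sigma> z)" "z \<in> X \<Longrightarrow> \<sigma> z (1/2) = z"
  using through[OF diam_disc] by (auto simp: \<sigma>_def X_def)

lemma src: assumes "z \<in> X" shows "f (src z) = Some 0" "(\<sigma> z \<longlongrightarrow> src z) (at 0 within diam_disc)"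
  using section_limit[OF approach_diam_disc \<sigma>(1)[OF assms], of 0] by (auto simp: src_def)

lemma tgt: assumes "z \<in> X" shows "f (tgt z) = Some 1" "(\<sigma> z \<longlongrightarrow> tgt z) (at 1 within diam_disc)"
  using section_limit[OF approach_diam_disc \<sigma>(1)[OF assms], of 1] by (auto simp: tgt_def)

lemma card_src: "f v = Some 0 \<Longrightarrow> card {z\<in>X. src z = v} = mul v"
  using card_limit_fibre[OF diam_disc approach_diam_disc, of 0 v] by (simp add: X_def src_def \<sigma>_def)

lemma card_tgt: "f w = Some 1 \<Longrightarrow> card {z\<in>X. tgt z = w} = 2"
  using card_limit_fibre[OF diam_disc approach_diam_disc, of 1 w] over_1 by (simp add: X_def tgt_def \<sigma>_def)

lemma f_\<sigma>: "z \<in> X \<Longrightarrow> 0 < t \<Longrightarrow> t < 1 \<Longrightarrow> f (\<sigma> z (complex_of_real t)) = Some (complex_of_real t)"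
  using \<sigma>(1) of_real_diam_disc by (auto simp: section_on_def)

lemma section_diam_disc_eq:
  assumes "z \<in> X" "z' \<in> X" "w \<in> diam_disc" "\<sigma> z w = \<sigma> z' w"
  shows "z = z'"
  using section_unique[OF diam_disc(1) convex_connected[OF diam_disc(2)] \<sigma>(1) \<sigma>(1) diam_disc(3) assms(3,4) diam_disc(4)] \<sigma>(2) assms by metis

lemma \<sigma>_surj:
  assumes "f u = Some w" "w \<in> diam_disc"
  obtains z where "z \<in> X" "\<sigma> z w = u"
proof -
  obtain s where s: "section_on diam_disc s" "s w = u" using section_exists[OF diam_disc(1-3) assms(2,1)] by metis
  have z: "s (1/2) \<in> X" using s(1) diam_disc(4) by (simp add: section_on_def X_def)
  have "\<sigma> (s (1/2)) w = s w"
    using section_unique[OF diam_disc(1) convex_connected[OF diam_disc(2)] \<sigma>(1)[OF z] s(1) diam_disc(3) diam_disc(4) _ assms(2)] \<sigma>(2)[OF z] by simp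
  thus ?thesis using that z s by simp
qed

lemma half_edge_path:
  assumes z: "z \<in> X"
  defines "\<gamma> \<equiv> \<lambda>t::real. if t = 0 then src z else if t = 1 then tgt z else \<sigma> z (complex_of_real t)"
  shows "continuous_on {0..1} \<gamma>"
proof (rule continuous_on_IccI)
  have lim0: "filterlim complex_of_real (at 0 within diam_disc) (at_right 0)"
    unfolding filterlim_at
  proof
    have "\<forall>\<^sub>F t in at_right 0. 0 < t \<and> t < (1::real)" by (simp add: eventually_at_right_field) (use zero_less_one in blast)
    thus "\<forall>\<^sub>F t in at_right 0. complex_of_real t \<in> diam_disc \<and> complex_of_real t \<noteq> 0"
      by (rule eventually_mono) (auto simp: of_real_diam_disc)
    show "(complex_of_real \<longlongrightarrow> 0) (at_right 0)" using tendsto_of_real[OF tendsto_ident_at[of "0::real"]] by simp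
  qed
  have ev0: "\<forall>\<^sub>F t in at_right 0. 0 < t \<and> t < (1::real)" by (simp add: eventually_at_right_field) (use zero_less_one in blast)
  have "((\<lambda>t. \<sigma> z (complex_of_real t)) \<longlongrightarrow> \<gamma> 0) (at_right 0)"
    unfolding \<gamma>_def by simp (rule filterlim_compose[OF src(2)[OF z] lim0])
  moreover have "\<forall>\<^sub>F t in at_right 0. \<sigma> z (complex_of_real t) = \<gamma> t"
    using ev0 by (rule eventually_mono) (auto simp: \<gamma>_def)
  ultimately show "(\<gamma> \<longlongrightarrow> \<gamma> 0) (at_right 0)" by (rule Lim_transform_eventually)
  have ev1: "\<forall>\<^sub>F t in at_left 1. 0 < t \<and> t < (1::real)" by (simp add: eventually_at_left_field) (use zero_less_one in blast)
  have lim1: "filterlim complex_of_real (at 1 within diam_disc) (at_left 1)"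
    unfolding filterlim_at
  proof
    show "\<forall>\<^sub>F t in at_left 1. complex_of_real t \<in> diam_disc \<and> complex_of_real t \<noteq> 1"
      using ev1 by (rule eventually_mono) (auto simp: of_real_diam_disc)
    show "(complex_of_real \<longlongrightarrow> 1) (at_left 1)" using tendsto_of_real[OF tendsto_ident_at[of "1::real"]] by simp
  qed
  have "((\<lambda>t. \<sigma> z (complex_of_real t)) \<longlongrightarrow> \<gamma> 1) (at_left 1)"
    unfolding \<gamma>_def by simp (rule filterlim_compose[OF tgt(2)[OF z] lim1])
  moreover have "\<forall>\<^sub>F t in at_left 1. \<sigma> z (complex_of_real t) = \<gamma> t"
    using ev1 by (rule eventually_mono) (auto simp: \<gamma>_def)
  ultimately show "(\<gamma> \<longlongrightarrow> \<gamma> 1) (at_left 1)" by (rule Lim_transform_eventually)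
  fix t :: real assume t: "0 < t" "t < 1"
  have "continuous_on {0<..<1} (\<lambda>t. \<sigma> z (complex_of_real t))"
  proof (rule continuous_on_compose2[of diam_disc "\<sigma> z"])
    show "continuous_on diam_disc (\<sigma> z)" using \<sigma>(1)[OF z] by (simp add: section_on_def)
    show "continuous_on {0<..<1} complex_of_real" by (intro continuous_on_of_real continuous_on_id)
    show "complex_of_real ` {0<..<1} \<subseteq> diam_disc" by (auto simp: of_real_diam_disc)
  qed
  hence "continuous_on {0<..<1} \<gamma>" by (rule continuous_on_eq) (auto simp: \<gamma>_def)
  hence "isCont \<gamma> t" using t by (simp add: continuous_on_eq_continuous_at)
  thus "\<gamma> \<midarrow>t\<rightarrow> \<gamma> t" by (simp add: isCont_def)
qed simp

lemma closure_half_edge: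
  assumes z: "z \<in> X"
  shows "closure (half_edge z) = half_edge z \<union> {src z, tgt z}" "connected (half_edge z)"
proof -
  define \<gamma> where "\<gamma> = (\<lambda>t::real. if t = 0 then src z else if t = 1 then tgt z else \<sigma> z (complex_of_real t))"
  have cont: "continuous_on {0..1} \<gamma>" using half_edge_path[OF z] by (simp add: \<gamma>_def)
  have he: "half_edge z = \<gamma> ` {0<..<1}" unfolding half_edge_def by (intro image_cong) (auto simp: \<gamma>_def)
  have all: "\<gamma> ` {0..1} = half_edge z \<union> {src z, tgt z}"
  proof -
    have "{0..1::real} = {0<..<1} \<union> {0, 1}" by auto
    thus ?thesis by (simp add: he image_Un) (auto simp: \<gamma>_def)
  qed
  have "closed (\<gamma> ` {0..1})" using compact_continuous_image[OF cont] by (intro compact_imp_closed) auto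
  hence "closure (half_edge z) \<subseteq> \<gamma> ` {0..1}" unfolding he by (intro closure_minimal) auto
  moreover have "\<gamma> ` closure {0<..<1} \<subseteq> closure (half_edge z)"
    unfolding he
  proof (rule image_closure_subset)
    show "continuous_on (closure {0<..<1}) \<gamma>" using cont by simp
  qed (auto simp: closure_subset)
  hence "\<gamma> ` {0..1} \<subseteq> closure (half_edge z)" by simp
  ultimately show "closure (half_edge z) = half_edge z \<union> {src z, tgt z}" using all by blast
  show "connected (half_edge z)" unfolding he
    by (intro connected_continuous_image continuous_on_subset[OF cont]) auto
qed

lemma finite_X': "finite {z\<in>X. tgt z = w}" using finite_X by simp

lemma closure_edge: "closure (edge w) = edge w \<union> src ` {z\<in>X. tgt z = w}"
proof -
  have "closure (edge w) = closure {w} \<union> closure (\<Union>z\<in>{z\<in>X. tgt z = w}. half_edge z)"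
    unfolding edge_def by (subst insert_is_Un) (rule closure_Un)
  also have "closure (\<Union>z\<in>{z\<in>X. tgt z = w}. half_edge z) = (\<Union>z\<in>{z\<in>X. tgt z = w}. closure (half_edge z))"
    using finite_X' by (induction rule: finite_induct) auto
  also have "\<dots> = (\<Union>z\<in>{z\<in>X. tgt z = w}. half_edge z \<union> {src z, tgt z})"
    using closure_half_edge(1) by auto
  finally show ?thesis by (auto simp: edge_def)
qed

lemma f_half_edge: "u \<in> half_edge z \<Longrightarrow> z \<in> X \<Longrightarrow> \<exists>t. 0 < t \<and> t < 1 \<and> f u = Some (complex_of_real t)"
  using f_\<sigma> by (auto simp: half_edge_def)

lemma connected_edge: "connected (edge w)" if "f w = Some 1"
proof -
  have eq: "edge w = \<Union>(insert {w} ((\<lambda>z. insert w (half_edge z)) ` {z\<in>X. tgt z = w}))"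
    unfolding edge_def by blast
  have con: "connected (insert w (half_edge z))" if "z \<in> X" "tgt z = w" for z
    by (rule connected_intermediate_closure[OF closure_half_edge(2)[OF that(1)]])
       (use closure_half_edge(1)[OF that(1)] that(2) in auto)
  show ?thesis unfolding eq
  proof (rule connected_Union)
    fix S assume "S \<in> insert {w} ((\<lambda>z. insert w (half_edge z)) ` {z\<in>X. tgt z = w})"
    thus "connected S" using con by auto
  qed auto
qed

lemma half_edge_disjoint:
  assumes "z \<in> X" "z' \<in> X" "half_edge z \<inter> half_edge z' \<noteq> {}"
  shows "z = z'"
proof -
  obtain t t' where t: "0 < t" "t < 1" "0 < t'" "t' < 1" "\<sigma> z (complex_of_real t) = \<sigma> z' (complex_of_real t')"
    using assms(3) by (auto simp: half_edge_def)
  hence "t = t'" using f_\<sigma>[OF assms(1) t(1,2)] f_\<sigma>[OF assms(2) t(3,4)] by simp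
  thus ?thesis using section_diam_disc_eq[OF assms(1,2), of "complex_of_real t"] t of_real_diam_disc by simp
qed

lemma edge_disjoint:
  assumes w: "f w = Some 1" "f w' = Some 1" "w \<noteq> w'"
  shows "closure (edge w) \<inter> edge w' = {}"
proof (rule ccontr)
  assume "closure (edge w) \<inter> edge w' \<noteq> {}"
  then obtain u where u: "u \<in> edge w \<or> u \<in> src ` {z\<in>X. tgt z = w}" "u \<in> edge w'" 
    using closure_edge by blast
  have pos: "\<exists>t. 0 < t \<and> t \<le> 1 \<and> f u = Some (complex_of_real t)"
    using u(2) f_half_edge[of u] w(2) unfolding edge_def by (fastforce intro: exI[of _ 1])
  have "u \<notin> src ` {z\<in>X. tgt z = w}" using pos src(1) by auto
  hence u1: "u \<in> edge w" using u by blast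
  consider "u = w" "u = w'" | z where "z \<in> X" "u \<in> half_edge z" "u = w'" | z where "z \<in> X" "u \<in> half_edge z" "u = w"
    | z z' where "z \<in> X" "z' \<in> X" "tgt z = w" "tgt z' = w'" "u \<in> half_edge z" "u \<in> half_edge z'"
    using u1 u(2) unfolding edge_def by blast
  thus False
  proof cases
    case 2 thus ?thesis using f_half_edge[of u] w by fastforce
  next
    case 3 thus ?thesis using f_half_edge[of u] w by fastforce
  next
    case 4
    hence "z = z'" using half_edge_disjoint by blast
    thus ?thesis using 4 w by simp
  qed (use w in simp)
qed

lemma Union_edges: "(\<Union>w\<in>{w. f w = Some 1}. edge w) = {x. \<exists>t::real. 0 < t \<and> t \<le> 1 \<and> f x = Some (of_real t)}"
proof (intro equalityI subsetI)
  fix u assume "u \<in> (\<Union>w\<in>{w. f w = Some 1}. edge w)"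
  then obtain w where w: "f w = Some 1" "u \<in> edge w" by blast
  show "u \<in> {x. \<exists>t::real. 0 < t \<and> t \<le> 1 \<and> f x = Some (of_real t)}"
    using w f_half_edge[of u] unfolding edge_def by (fastforce intro: exI[of _ 1])
next
  fix u assume "u \<in> {x. \<exists>t::real. 0 < t \<and> t \<le> 1 \<and> f x = Some (of_real t)}"
  then obtain t :: real where t: "0 < t" "t \<le> 1" "f u = Some (of_real t)" by blast
  show "u \<in> (\<Union>w\<in>{w. f w = Some 1}. edge w)"
  proof (cases "t = 1")
    case True
    thus ?thesis using t(3) by (auto simp: edge_def)
  next
    case False
    hence B: "complex_of_real t \<in> diam_disc" using t by (simp add: of_real_diam_disc)
    obtain z where z: "z \<in> X" "\<sigma> z (of_real t) = u" by (rule \<sigma>_surj[OF t(3) B])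
    have "u \<in> edge (tgt z)" using z t False by (auto simp: edge_def half_edge_def)
    thus ?thesis using tgt(1)[OF z(1)] by blast
  qed
qed

lemma edges_belyi_graph: "edges (belyi_graph f) = edge ` {w. f w = Some 1}"
proof -
  have "components (\<Union>(edge ` {w. f w = Some 1})) = edge ` {w. f w = Some 1}"
  proof (rule components_eqI)
    show "finite (edge ` {w. f w = Some 1})" using finite_fibre by blast
    show "{} \<notin> edge ` {w. f w = Some 1}" by (auto simp: edge_def)
  qed (use connected_edge edge_disjoint in blast)+
  thus ?thesis unfolding belyi_graph_def components_CP1 by (simp add: Union_edges)
qed

lemma verts_belyi_graph: "verts (belyi_graph f) = {x. f x = Some 0}"
  by (simp add: belyi_graph_def)

lemma inj_edge: "inj_on edge {w. f w = Some 1}"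
proof (rule inj_onI)
  fix w w' assume w: "w \<in> {w. f w = Some 1}" "w' \<in> {w. f w = Some 1}" "edge w = edge w'"
  show "w = w'"
  proof (rule ccontr)
    assume "w \<noteq> w'"
    hence "closure (edge w) \<inter> edge w' = {}" using edge_disjoint w by blast
    moreover have "w' \<in> edge w'" by (simp add: edge_def)
    ultimately show False using w(3) closure_subset by blast
  qed
qed

lemma card_edges: "2 * card (edges (belyi_graph f)) = N"
proof -
  have "N = (\<Sum>x | f x = Some 1. mul x)" by (simp add: sum_mul_fibre)
  also have "\<dots> = (\<Sum>x | f x = Some 1. 2)" by (intro sum.cong) (auto simp: over_1)
  also have "\<dots> = 2 * card {x. f x = Some 1}" by simp
  finally show ?thesis by (simp add: edges_belyi_graph card_image[OF inj_edge])
qed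

lemma edge_ends_edge: 
  assumes "f w = Some 1" shows "edge_ends (edge w) = src ` {z\<in>X. tgt z = w}"
proof -
  have "src z \<notin> edge w" if "z \<in> X" for z
  proof
    assume "src z \<in> edge w"
    hence "src z \<in> (\<Union>w\<in>{w. f w = Some 1}. edge w)" using assms by blast
    thus False using src(1)[OF that] unfolding Union_edges by auto
  qed
  thus ?thesis unfolding edge_ends_def CP1_eq_euclidean using closure_edge by auto
qed

lemma two_half_edges:
  assumes "f w = Some 1"
  obtains z1 z2 where "z1 \<noteq> z2" "{z\<in>X. tgt z = w} = {z1, z2}"
  using card_tgt[OF assms] that by (auto simp: card_2_iff)

text \<open>Both degrees in question are sums over edges whose terms are at most \<open>2\<close>; in terms of the two
  half-edges of each edge they become cardinalities.\<close>

lemma sum_over_edges: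
  fixes t :: "sphere set \<Rightarrow> nat"
  assumes "\<And>w. f w = Some 1 \<Longrightarrow> (if R (edge w) then t (edge w) else 0) = card {z\<in>X. tgt z = w \<and> S z}"
  shows "(\<Sum>e | e \<in> edges (belyi_graph f) \<and> R e. t e) = card {z\<in>X. S z}"
proof -
  let ?W = "{w. f w = Some 1}"
  have finW: "finite ?W" by (rule finite_fibre)
  have "(\<Sum>e | e \<in> edges (belyi_graph f) \<and> R e. t e) = (\<Sum>e\<in>edge ` ?W. if R e then t e else 0)"
    unfolding edges_belyi_graph using finW by (simp add: sum.If_cases Int_def)
  also have "\<dots> = (\<Sum>w\<in>?W. if R (edge w) then t (edge w) else 0)"
    by (subst sum.reindex[OF inj_edge]) (simp add: o_def)
  also have "\<dots> = (\<Sum>w\<in>?W. card {z\<in>X. tgt z = w \<and> S z})" by (rule sum.cong[OF refl]) (use assms in simp)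
  also have "\<dots> = (\<Sum>w\<in>?W. \<Sum>z\<in>{z\<in>{z\<in>X. S z}. tgt z = w}. 1)"
    by (intro sum.cong refl) (auto intro!: arg_cong[of _ _ card])
  also have "\<dots> = (\<Sum>z\<in>{z\<in>X. S z}. 1)"
    by (rule sum.group) (use finite_X finW tgt(1) in auto)
  finally show ?thesis by simp
qed

text \<open>An edge with both ends at \<open>v\<close> counts twice in the degree, and both of its half-edges start at \<open>v\<close>.\<close>

theorem vertex_degree_eq_mul:
  assumes v: "f v = Some 0"
  shows "vertex_degree (belyi_graph f) v = mul v"
proof -
  let ?t = "\<lambda>e. if edge_ends e = {v} then 2 else 1 :: nat"
  have summand: "(if v \<in> edge_ends (edge w) then ?t (edge w) else 0) = card {z\<in>X. tgt z = w \<and> src z = v}"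
    if w: "f w = Some 1" for w
  proof -
    obtain z1 z2 where z: "z1 \<noteq> z2" "{z\<in>X. tgt z = w} = {z1, z2}" by (rule two_half_edges[OF w])
    have e: "edge_ends (edge w) = {src z1, src z2}" using edge_ends_edge[OF w] z(2) by auto
    have c: "{z\<in>X. tgt z = w \<and> src z = v} = {z\<in>{z1, z2}. src z = v}" using z(2) by blast
    have c': "{z\<in>{z1, z2}. src z = v} = (if src z1 = v then {z1} else {}) \<union> (if src z2 = v then {z2} else {})" by auto
    show ?thesis unfolding e c c' using z(1) by auto
  qed
  show ?thesis
    using sum_over_edges[where R = "\<lambda>e. v \<in> edge_ends e" and t = ?t and S = "\<lambda>z. src z = v", OF summand] card_src[OF v]
    by (simp add: vertex_degree_def)
qed

end

section \<open>Every face contains exactly one pole\<close>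

definition half_plane :: "complex \<Rightarrow> real \<Rightarrow> complex set" where
  "half_plane d k = {w. inner d w > k}"

lemma half_plane: "open (half_plane d k)" "convex (half_plane d k)"
  unfolding half_plane_def by (rule open_halfspace_gt, rule convex_halfspace_gt)

text \<open>From every point the ray in direction \<open>d\<close> stays in the set, because along it both the norm and the
  inner product with \<open>d\<close> do not decrease, and it reaches a convex half-plane contained in the set.\<close>

lemma connected_half_plane_outside:
  assumes d: "norm d = 1" and "k \<ge> 0"
  shows "connected (half_plane d k \<inter> - cball 0 R)"
proof -
  define M where "M = max R k"
  let ?C = "half_plane d M"
  define ray where "ray a = {a + of_real t * d |t. t \<ge> 0}" for a
  have dd: "inner d d = 1" using d by (simp add: dot_square_norm)
  have inn: "inner d (a + of_real t * d) = inner d a + t" for a t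
    by (simp add: inner_add_right dd flip: scaleR_conv_of_real)
  have C: "?C \<subseteq> half_plane d k \<inter> - cball 0 R"
  proof
    fix w assume "w \<in> ?C"
    hence "inner d w > R" "inner d w > k" by (auto simp: half_plane_def M_def)
    moreover have "inner d w \<le> norm w" using norm_cauchy_schwarz[of d w] d by simp
    ultimately show "w \<in> half_plane d k \<inter> - cball 0 R" by (simp add: half_plane_def)
  qed
  have ray: "ray a \<subseteq> half_plane d k \<inter> - cball 0 R" "a \<in> ray a" "ray a \<inter> ?C \<noteq> {}" "connected (ray a)"
    if a: "a \<in> half_plane d k \<inter> - cball 0 R" for a
  proof -
    show "ray a \<subseteq> half_plane d k \<inter> - cball 0 R"
    proof
      fix w assume "w \<in> ray a"
      then obtain t where t: "w = a + of_real t * d" "t \<ge> 0" by (auto simp: ray_def)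
      have "inner d w > k" using a t inn by (simp add: half_plane_def)
      moreover have "norm w > R"
      proof -
        have "(norm w)\<^sup>2 = (norm a)\<^sup>2 + 2 * t * inner d a + t\<^sup>2"
        proof -
          have w: "w = a + t *\<^sub>R d" by (simp add: t(1) scaleR_conv_of_real)
          show ?thesis unfolding power2_norm_eq_inner w
            by (simp add: inner_add_left inner_add_right dd inner_commute[of a d] power2_eq_square algebra_simps)
        qed
        moreover have "inner d a \<ge> 0" using a \<open>k \<ge> 0\<close> by (simp add: half_plane_def)
        ultimately have "(norm w)\<^sup>2 \<ge> (norm a)\<^sup>2" using t(2) by simp
        hence "norm w \<ge> norm a" by (rule power2_le_imp_le) simp
        thus ?thesis using a by simp
      qed
      ultimately show "w \<in> half_plane d k \<inter> - cball 0 R" by (simp add: half_plane_def)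
    qed
    show "a \<in> ray a" unfolding ray_def by (auto intro!: exI[of _ 0])
    define s where "s = \<bar>M\<bar> + \<bar>inner d a\<bar> + 1"
    have "s \<ge> 0" "inner d a + s > M" by (auto simp: s_def)
    hence "a + of_real s * d \<in> ray a \<inter> ?C"
      unfolding ray_def half_plane_def Int_iff mem_Collect_eq inn by blast
    thus "ray a \<inter> ?C \<noteq> {}" by blast
    have "ray a = (\<lambda>t. a + of_real t * d) ` {0..}" by (auto simp: ray_def)
    moreover have "connected ((\<lambda>t. a + complex_of_real t * d) ` {0..})"
      by (intro connected_continuous_image continuous_intros) auto
    ultimately show "connected (ray a)" by simp
  qed
  let ?S = "half_plane d k \<inter> - cball 0 R"
  have C0: "?C \<noteq> {}"
  proof -
    have "0 + of_real (\<bar>M\<bar> + 1) * d \<in> ?C" unfolding half_plane_def using inn[of 0 "\<bar>M\<bar> + 1"] by auto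
    thus ?thesis by blast
  qed
  have "?S = (\<Union>a\<in>?S. ray a \<union> ?C) \<union> ?C" using ray C by blast
  also have "\<dots> = \<Union>(insert ?C ((\<lambda>a. ray a \<union> ?C) ` ?S))" by blast
  finally have eq: "?S = \<Union>(insert ?C ((\<lambda>a. ray a \<union> ?C) ` ?S))" .
  have "connected (\<Union>(insert ?C ((\<lambda>a. ray a \<union> ?C) ` ?S)))"
  proof (rule connected_Union)
    fix s assume s: "s \<in> insert ?C ((\<lambda>a. ray a \<union> ?C) ` ?S)"
    have cC: "connected ?C" using half_plane(2) by (rule convex_connected)
    show "connected s"
    proof (cases "s = ?C")
      case False
      then obtain a where a: "a \<in> ?S" "s = ray a \<union> ?C" using s by blast
      show ?thesis unfolding a(2) by (rule connected_Un) (use ray[OF a(1)] cC in auto)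
    qed (use cC in simp)
  next
    show "\<Inter>(insert ?C ((\<lambda>a. ray a \<union> ?C) ` ?S)) \<noteq> {}" using C0 by blast
  qed
  thus ?thesis using eq by simp
qed

context clean_ratfun begin

definition seg :: "sphere set" where "seg = (\<lambda>t. Some (complex_of_real t)) ` {0..1}"
definition off_graph :: "sphere set" where "off_graph = {x. f x \<notin> seg}"
definition face_at :: "sphere \<Rightarrow> sphere set" where "face_at x = connected_component_set off_graph x"

lemma faces_belyi_graph: "faces (belyi_graph f) = components off_graph"
proof -
  have "support (belyi_graph f) = {x. f x \<in> seg}"
  proof -
    have "support (belyi_graph f) = {x. f x = Some 0} \<union> {x. \<exists>t::real. 0 < t \<and> t \<le> 1 \<and> f x = Some (of_real t)}"
      unfolding support_def edges_belyi_graph verts_belyi_graph Union_edges ..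
    also have "\<dots> = {x. f x \<in> seg}"
    proof (intro equalityI subsetI)
      fix x assume "x \<in> {x. f x \<in> seg}"
      then obtain t :: real where "0 \<le> t" "t \<le> 1" "f x = Some (of_real t)" by (auto simp: seg_def)
      thus "x \<in> {x. f x = Some 0} \<union> {x. \<exists>t::real. 0 < t \<and> t \<le> 1 \<and> f x = Some (of_real t)}"
        by (cases "t = 0") auto
    next
      fix x assume "x \<in> {x. f x = Some 0} \<union> {x. \<exists>t::real. 0 < t \<and> t \<le> 1 \<and> f x = Some (of_real t)}"
      then consider "f x = Some 0" | t :: real where "0 < t" "t \<le> 1" "f x = Some (of_real t)" by auto
      thus "x \<in> {x. f x \<in> seg}"
      proof cases
        case 1 thus ?thesis unfolding seg_def by (auto intro!: image_eqI[of _ _ "0::real"])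
      qed (auto simp: seg_def)
    qed
    finally show ?thesis .
  qed
  hence "topspace CP1 - support (belyi_graph f) = off_graph" by (auto simp: CP1_eq_euclidean off_graph_def)
  thus ?thesis unfolding faces_def components_CP1 by simp
qed

lemma face_at_eq:
  assumes "connected S" "S \<subseteq> off_graph" "x \<in> S" "y \<in> S"
  shows "face_at x = face_at y"
  unfolding face_at_def
  using assms by (metis connected_component_eq connected_component_def mem_Collect_eq)

lemma face_at_in_faces: "x \<in> off_graph \<Longrightarrow> face_at x \<in> faces (belyi_graph f)"
  unfolding faces_belyi_graph components_def face_at_def by blast

lemma self_in_face_at: "x \<in> off_graph \<Longrightarrow> x \<in> face_at x"
  by (simp add: face_at_def connected_component_refl)

lemma face_at_subset: "face_at x \<subseteq> off_graph"
  by (simp add: face_at_def connected_component_subset)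

lemma face_eq_face_at: "F \<in> faces (belyi_graph f) \<Longrightarrow> x \<in> F \<Longrightarrow> F = face_at x"
  unfolding faces_belyi_graph face_at_def
  by (metis components_iff connected_component_eq mem_Collect_eq)

lemma not_seg: "Im w \<noteq> 0 \<or> Re w < 0 \<or> Re w > 1 \<Longrightarrow> Some w \<notin> seg"
  by (auto simp: seg_def)

lemma section_image_off_graph:
  assumes "section_on \<Omega> s" "\<And>w. w \<in> \<Omega> \<Longrightarrow> Some w \<notin> seg"
  shows "s ` \<Omega> \<subseteq> off_graph"
  using assms by (auto simp: section_on_def off_graph_def)

lemma connected_section_image:
  "section_on \<Omega> s \<Longrightarrow> connected \<Omega> \<Longrightarrow> connected (s ` \<Omega>)"
  by (simp add: section_on_def connected_continuous_image)

text \<open>Four convex half-planes that cover the complement of \<open>[0,1]\<close>. When two of them meet, the intersection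
  is unbounded, so that it reaches infinity.\<close>

definition outer_half_planes :: "(complex \<times> real) set" where
  "outer_half_planes = {(\<i>, 0), (-\<i>, 0), (-1, 0), (1, 1)}"

lemma outer_norm: "(d, k) \<in> outer_half_planes \<Longrightarrow> norm d = 1 \<and> k \<ge> 0"
  by (auto simp: outer_half_planes_def)

lemma outer_not_seg: "(d, k) \<in> outer_half_planes \<Longrightarrow> w \<in> half_plane d k \<Longrightarrow> Some w \<notin> seg"
  by (rule not_seg) (auto simp: outer_half_planes_def half_plane_def inner_complex_def)

lemma outer_01: "(d, k) \<in> outer_half_planes \<Longrightarrow> half_plane d k \<inter> {0, 1} = {}"
  by (auto simp: outer_half_planes_def half_plane_def inner_complex_def)

lemma outer_cover: "Some w \<notin> seg \<Longrightarrow> \<exists>d k. (d, k) \<in> outer_half_planes \<and> w \<in> half_plane d k"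
proof -
  assume w: "Some w \<notin> seg"
  have "Im w \<noteq> 0 \<or> Re w < 0 \<or> Re w > 1"
  proof (rule ccontr)
    assume "\<not> ?thesis"
    hence "w = complex_of_real (Re w)" "0 \<le> Re w" "Re w \<le> 1" by (auto simp: complex_eq_iff)
    thus False using w unfolding seg_def by (metis atLeastAtMost_iff imageI)
  qed
  then consider "Im w > 0" | "Im w < 0" | "Re w < 0" | "Re w > 1" by linarith
  thus ?thesis
    by cases (force simp: outer_half_planes_def half_plane_def inner_complex_def)+
qed

definition far :: "complex set \<Rightarrow> complex filter" where
  "far \<Omega> = inf at_infinity (principal \<Omega>)"

lemma eventually_far: "eventually P (far \<Omega>) \<longleftrightarrow> (\<exists>R. \<forall>w\<in>\<Omega>. norm w > R \<longrightarrow> P w)"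
  unfolding far_def eventually_inf_principal eventually_at_infinity
  by (metis dual_order.strict_trans1 gt_ex less_imp_le)

lemma far_neq_bot:
  assumes a: "a \<in> \<Omega>" "e \<noteq> 0" "\<And>t. t > 0 \<Longrightarrow> a + of_real t * e \<in> \<Omega>"
  shows "far \<Omega> \<noteq> bot"
proof
  assume "far \<Omega> = bot"
  hence "eventually (\<lambda>_. False) (far \<Omega>)" by simp
  then obtain R where R: "\<And>w. w \<in> \<Omega> \<Longrightarrow> \<not> norm w > R" unfolding eventually_far by blast
  define t where "t = (\<bar>R\<bar> + norm a + 1) / norm e"
  have "\<bar>R\<bar> + norm a + 1 > 0" by (smt (verit) norm_ge_zero)
  hence t: "t > 0" using a(2) unfolding t_def by (intro divide_pos_pos) auto
  have "norm (of_real t * e) = t * norm e" using t by (simp add: norm_mult)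
  also have "\<dots> = \<bar>R\<bar> + norm a + 1" using a(2) by (simp add: t_def)
  finally have "norm (of_real t * e) = \<bar>R\<bar> + norm a + 1" .
  hence "norm (a + of_real t * e) > R" using norm_triangle_ineq2[of "of_real t * e" "- a"] by (simp add: add.commute)
  thus False using R a(3)[OF t] by blast
qed

lemma approach_far:
  assumes q: "(d, k) \<in> outer_half_planes"
  shows "approach (far (half_plane d k)) (half_plane d k) None"
  unfolding approach_def
proof (intro conjI allI impI)
  have d: "norm d = 1" using outer_norm[OF q] by simp
  hence dd: "inner d d = 1" by (simp add: dot_square_norm)
  have inn: "inner d (a + of_real t * d) = inner d a + t" for a t
    by (simp add: inner_add_right dd flip: scaleR_conv_of_real)
  show "far (half_plane d k) \<noteq> bot"
  proof (rule far_neq_bot)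
    show "0 + of_real (\<bar>k\<bar> + 1) * d \<in> half_plane d k" unfolding half_plane_def using inn[of 0 "\<bar>k\<bar> + 1"] by auto
    show "d \<noteq> 0" using d by auto
    fix t :: real assume "t > 0"
    thus "0 + of_real (\<bar>k\<bar> + 1) * d + of_real t * d \<in> half_plane d k"
      unfolding half_plane_def mem_Collect_eq inn using inn[of 0] by simp
  qed
  show "\<forall>\<^sub>F w in far (half_plane d k). w \<in> half_plane d k" unfolding eventually_far by blast
  have "filterlim (\<lambda>z. z) at_infinity (far (half_plane d k))"
    unfolding far_def by (metis filterlim_ident filterlim_mono inf.cobounded1 order_refl)
  thus "(Some \<longlongrightarrow> None) (far (half_plane d k))" using tendsto_Some_None[of "\<lambda>z::complex. z"] by simp
  show "None \<notin> Some ` half_plane d k" by auto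
  fix P assume "eventually P (far (half_plane d k))"
  then obtain R where R: "\<And>w. w \<in> half_plane d k \<Longrightarrow> norm w > R \<Longrightarrow> P w" unfolding eventually_far by blast
  have "connected (half_plane d k \<inter> - cball 0 R)"
    using connected_half_plane_outside outer_norm[OF q] by blast
  moreover have "\<forall>\<^sub>F w in far (half_plane d k). w \<in> half_plane d k \<inter> - cball 0 R"
    unfolding eventually_far by (intro exI[of _ R]) auto
  moreover have "\<forall>w\<in>half_plane d k \<inter> - cball 0 R. P w" using R by auto
  ultimately show "\<exists>C. connected C \<and> (\<forall>\<^sub>F w in far (half_plane d k). w \<in> C) \<and> (\<forall>w\<in>C. P w)" by blast
qed

text \<open>Moving the value of \<open>f\<close> to infinity inside one of the half-planes moves \<open>z\<close> to a pole.\<close>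

definition leads_to :: "sphere \<Rightarrow> sphere \<Rightarrow> bool" where
  "leads_to z pole \<longleftrightarrow> (\<exists>d k s a. (d, k) \<in> outer_half_planes \<and> section_on (half_plane d k) s \<and> a \<in> half_plane d k \<and> s a = z \<and>
     (s \<longlongrightarrow> pole) (far (half_plane d k)))"

text \<open>Two sections through \<open>z\<close> agree on the intersection of their half-planes, which is a convex set
  reaching infinity.\<close>

lemma leads_to_unique:
  assumes "leads_to z pole" "leads_to z pole'"
  shows "pole = pole'"
proof -
  obtain d k s a where 1: "(d, k) \<in> outer_half_planes" "section_on (half_plane d k) s" "a \<in> half_plane d k" "s a = z"
     "(s \<longlongrightarrow> pole) (far (half_plane d k))" using assms(1) unfolding leads_to_def by blast
  obtain d' k' s' a' where 2: "(d', k') \<in> outer_half_planes" "section_on (half_plane d' k') s'" "a' \<in> half_plane d' k'" "s' a' = z"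
     "(s' \<longlongrightarrow> pole') (far (half_plane d' k'))" using assms(2) unfolding leads_to_def by blast
  have aa: "a' = a"
  proof -
    have "Some a = Some a'" using 1 2 unfolding section_on_def by metis
    thus ?thesis by simp
  qed
  let ?H = "half_plane d k \<inter> half_plane d' k'"
  have aH: "a \<in> ?H" using 1 2 aa by simp
  have opH: "open ?H" "connected ?H"
    using half_plane by (auto intro!: convex_connected convex_Int)
  have eq: "s w = s' w" if "w \<in> ?H" for w
  proof (rule section_unique[OF opH])
    show "section_on ?H s" "section_on ?H s'" using 1(2) 2(2) section_subset by blast+
    show "?H \<inter> {0, 1} = {}" using outer_01[OF 1(1)] by blast
  qed (use aH that 1(4) 2(4) aa in auto)
  \<comment> \<open>the direction \<open>d + d'\<close> leads to infinity inside both half-planes\<close>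
  have nb: "far ?H \<noteq> bot"
  proof (rule far_neq_bot[OF aH, of "d + d'"])
    have dd: "inner d d = 1" "inner d' d' = 1" 
      using outer_norm[OF 1(1)] outer_norm[OF 2(1)] by (auto simp: dot_square_norm)
    have ge: "inner d d' \<ge> -1" "inner d' d \<ge> -1" 
      using 1(1) 2(1) by (auto simp: outer_half_planes_def inner_complex_def)
    show "d + d' \<noteq> 0"
    proof
      assume "d + d' = 0"
      hence "d' = - d" by (simp add: eq_neg_iff_add_eq_0 add.commute)
      thus False using 1(1) 2(1) aH by (auto simp: outer_half_planes_def half_plane_def inner_complex_def)
    qed
    fix t :: real assume t: "t > 0"
    have "inner d (of_real t * (d + d')) = t * (1 + inner d d')" "inner d' (of_real t * (d + d')) = t * (1 + inner d' d)"
      unfolding scaleR_conv_of_real[symmetric] using dd by (simp_all add: inner_add_right algebra_simps)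
    moreover have "t * (1 + inner d d') \<ge> 0" "t * (1 + inner d' d) \<ge> 0" using t ge by auto
    ultimately have "inner d (of_real t * (d + d')) \<ge> 0" "inner d' (of_real t * (d + d')) \<ge> 0" by auto
    thus "a + of_real t * (d + d') \<in> ?H" using aH 
      unfolding half_plane_def by (auto simp: inner_add_right)
  qed
  have le: "far ?H \<le> far (half_plane d k)" "far ?H \<le> far (half_plane d' k')"
    unfolding far_def by (intro inf_mono order_refl; simp)+
  have "(s \<longlongrightarrow> pole) (far ?H)" using 1(5) le(1) tendsto_mono by blast
  moreover have "\<forall>\<^sub>F w in far ?H. s w = s' w" unfolding eventually_far using eq by blast
  ultimately have "(s' \<longlongrightarrow> pole) (far ?H)" by (rule Lim_transform_eventually)
  moreover have "(s' \<longlongrightarrow> pole') (far ?H)" using 2(5) le(2) tendsto_mono by blast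
  ultimately show ?thesis using tendsto_unique nb by blast
qed

lemma leads_to_exists:
  assumes "f z = Some a" "(d, k) \<in> outer_half_planes" "a \<in> half_plane d k"
  obtains s pole where "section_on (half_plane d k) s" "s a = z" "(s \<longlongrightarrow> pole) (far (half_plane d k))" 
    "f pole = None" "leads_to z pole"
proof -
  obtain s where s: "section_on (half_plane d k) s" "s a = z"
    by (rule section_exists[OF half_plane outer_01[OF assms(2)] assms(3,1)])
  note lim = section_limit[OF approach_far[OF assms(2)] s(1)]
  show ?thesis
  proof (rule that[OF s lim(2,1)])
    show "leads_to z (Lim (far (half_plane d k)) s)" unfolding leads_to_def using s assms lim(2) by blast
  qed
qed

definition basin :: "sphere \<Rightarrow> sphere set" where
  "basin pole = insert pole {z. leads_to z pole}"

lemma pole_in_off_graph: "f pole = None \<Longrightarrow> pole \<in> off_graph"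
  by (auto simp: off_graph_def seg_def)

lemma off_graph_cover: "off_graph \<subseteq> (\<Union>pole\<in>{pole. f pole = None}. basin pole)"
proof
  fix z assume z: "z \<in> off_graph"
  show "z \<in> (\<Union>pole\<in>{pole. f pole = None}. basin pole)"
  proof (cases "f z")
    case None thus ?thesis by (auto simp: basin_def)
  next
    case (Some a)
    hence "Some a \<notin> seg" using z by (simp add: off_graph_def)
    then obtain d k where dk: "(d, k) \<in> outer_half_planes" "a \<in> half_plane d k" using outer_cover by blast
    obtain s pole where "section_on (half_plane d k) s" "s a = z" "(s \<longlongrightarrow> pole) (far (half_plane d k))" 
       "f pole = None" "leads_to z pole" by (rule leads_to_exists[OF Some dk])
    thus ?thesis by (auto simp: basin_def)
  qed
qed

lemma leads_to_finite: "leads_to z pole \<Longrightarrow> f z \<noteq> None"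
  by (auto simp: leads_to_def section_on_def)

lemma basin_disjoint:
  assumes "f pole = None" "f pole' = None" "pole \<noteq> pole'"
  shows "basin pole \<inter> basin pole' = {}"
  unfolding basin_def using assms leads_to_finite leads_to_unique by blast

text \<open>At a finite point the image of a section is a neighbourhood. Near the pole: if \<open>R\<close> is large, then the
  points with \<open>|f| > R\<close> lie in disjoint neighbourhoods of the poles, and a section over the connected
  part of a half-plane outside the disc of radius \<open>R\<close> remains in the neighbourhood where it starts.\<close>

lemma open_basin:
  assumes pole: "f pole = None"
  shows "open (basin pole)"
proof (subst open_subopen, intro ballI)
  fix z assume z: "z \<in> basin pole"
  show "\<exists>T. open T \<and> z \<in> T \<and> T \<subseteq> basin pole"
  proof (cases "z = pole")
    case False
    hence "leads_to z pole" using z by (simp add: basin_def)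
    then obtain d k s a where 1: "(d, k) \<in> outer_half_planes" "section_on (half_plane d k) s" "a \<in> half_plane d k" "s a = z"
      "(s \<longlongrightarrow> pole) (far (half_plane d k))" unfolding leads_to_def by blast
    have "open (s ` half_plane d k)" by (rule open_section_image[OF half_plane(1) 1(2) outer_01[OF 1(1)]])
    moreover have "s ` half_plane d k \<subseteq> basin pole" using 1 by (auto simp: basin_def leads_to_def)
    ultimately show ?thesis using 1(3,4) by blast
  next
    case True
    obtain T where T: "\<And>x. x \<in> {x. f x = None} \<Longrightarrow> open (T x) \<and> x \<in> T x" 
      "\<And>x x'. x \<in> {x. f x = None} \<Longrightarrow> x' \<in> {x. f x = None} \<Longrightarrow> x \<noteq> x' \<Longrightarrow> T x \<inter> T x' = {}"
      using separate_finite_t2[OF finite_fibre[of None]] by metis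
    have ev: "\<forall>\<^sub>F w in nhds None. \<forall>u. f u = w \<longrightarrow> (\<exists>x. f x = None \<and> u \<in> T x)"
      using near_fibre[of None T] T(1) by blast
    have "\<exists>R\<ge>1. \<forall>w. norm w > R \<longrightarrow> (\<forall>u. f u = Some w \<longrightarrow> (\<exists>x. f x = None \<and> u \<in> T x))"
    proof -
      have "(Some \<longlongrightarrow> (None::sphere)) at_infinity"
        using tendsto_Some_None[of "\<lambda>z::complex. z" at_infinity] by (simp add: filterlim_ident)
      from eventually_compose_filterlim[OF ev this] obtain b where
        "\<And>w. norm w \<ge> b \<Longrightarrow> \<forall>u. f u = Some w \<longrightarrow> (\<exists>x. f x = None \<and> u \<in> T x)"
        unfolding eventually_at_infinity by blast
      hence "\<forall>u. f u = Some w \<longrightarrow> (\<exists>x. f x = None \<and> u \<in> T x)" if "norm w > max 1 b" for w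
        using that by (meson less_imp_le max_less_iff_conj)
      thus ?thesis by (intro exI[of _ "max 1 b"] conjI) simp_all
    qed
    then obtain R where R: "R \<ge> 1" "\<And>w u. norm w > R \<Longrightarrow> f u = Some w \<Longrightarrow> \<exists>x. f x = None \<and> u \<in> T x" by blast
    let ?O = "insert None (Some ` (- cball (0::complex) R))"
    have "Some -` ?O = - cball (0::complex) R" by auto
    hence opO: "open ?O" by (simp add: open_option_iff open_Compl)
    let ?T = "T pole \<inter> f -` ?O"
    have "open ?T" using T(1)[of pole] pole by (intro open_Int open_vimage continuous_f opO) auto
    moreover have "pole \<in> ?T" using T(1)[of pole] pole by auto
    moreover have "?T \<subseteq> basin pole"
    proof
      fix u assume u: "u \<in> ?T"
      show "u \<in> basin pole"
      proof (cases "f u")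
        case None
        hence "u = pole" using T(1)[of u] T(2)[of u pole] pole u by blast
        thus ?thesis by (simp add: basin_def)
      next
        case (Some a)
        hence a: "norm a > R" using u by auto
        have "Some a \<notin> seg"
        proof
          assume "Some a \<in> seg"
          hence "norm a \<le> 1" by (auto simp: seg_def)
          thus False using a R(1) by simp
        qed
        then obtain d k where dk: "(d, k) \<in> outer_half_planes" "a \<in> half_plane d k" using outer_cover by blast
        obtain s pole' where s: "section_on (half_plane d k) s" "s a = u" "(s \<longlongrightarrow> pole') (far (half_plane d k))" 
          "f pole' = None" "leads_to u pole'" by (rule leads_to_exists[OF Some dk])
        let ?H = "half_plane d k \<inter> - cball 0 R"
        have "connected (s ` ?H)"
          using connected_half_plane_outside outer_norm[OF dk(1)] section_subset[OF s(1), of ?H]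
          by (intro connected_section_image) auto
        moreover have "s ` ?H \<subseteq> (\<Union>x\<in>{x. f x = None}. T x)"
        proof
          fix v assume "v \<in> s ` ?H"
          then obtain w where w: "w \<in> ?H" "v = s w" by blast
          have "f v = Some w" using w s(1) by (simp add: section_on_def)
          thus "v \<in> (\<Union>x\<in>{x. f x = None}. T x)" using R(2)[of w v] w(1) by auto
        qed
        moreover have "s ` ?H \<inter> T pole \<noteq> {}"
        proof -
          have "a \<in> ?H" using dk(2) a by simp
          hence "u \<in> s ` ?H" using s(2) by blast
          thus ?thesis using u by blast
        qed
        ultimately have sub: "s ` ?H \<subseteq> T pole"
          using connected_subset_disjoint_opens[where C = "s ` ?H" and X = "{x. f x = None}" and T = T and x = pole] T pole by simp
        have "\<forall>\<^sub>F w in far (half_plane d k). s w \<in> T pole"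
          unfolding eventually_far using sub by (intro exI[of _ R]) auto
        moreover have "\<forall>\<^sub>F w in far (half_plane d k). s w \<in> T pole'"
          by (rule topological_tendstoD[OF s(3)]) (use T(1)[of pole'] s(4) in auto)
        ultimately have "\<forall>\<^sub>F w in far (half_plane d k). s w \<in> T pole \<and> s w \<in> T pole'" by (rule eventually_conj)
        moreover have "far (half_plane d k) \<noteq> bot" using approach_far[OF dk(1)] by (simp add: approach_def)
        ultimately have "\<exists>w. s w \<in> T pole \<and> s w \<in> T pole'" using eventually_happens by blast
        hence "pole' = pole" using T(2)[of pole pole'] s(4) pole by blast
        thus ?thesis using s(5) by (simp add: basin_def)
      qed
    qed
    ultimately show ?thesis using True by blast
  qed
qed

text \<open>The basins are open and disjoint and cover the complement of the graph, so a connected subset lies in one of them.\<close>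

lemma pole_unique_in_face:
  assumes "f pole = None" "f pole' = None" "face_at pole = face_at pole'"
  shows "pole = pole'"
proof -
  have "face_at pole \<subseteq> basin pole"
  proof (rule connected_subset_disjoint_opens[where X = "{pole. f pole = None}" and T = basin])
    show "connected (face_at pole)" by (simp add: face_at_def connected_connected_component)
    show "face_at pole \<subseteq> (\<Union>x\<in>{pole. f pole = None}. basin x)" using off_graph_cover face_at_subset by blast
    show "face_at pole \<inter> basin pole \<noteq> {}" using self_in_face_at[OF pole_in_off_graph[OF assms(1)]] by (auto simp: basin_def)
  qed (use open_basin basin_disjoint assms in auto)
  moreover have "pole' \<in> face_at pole" using self_in_face_at[OF pole_in_off_graph[OF assms(2)]] assms(3) by simp
  ultimately have "pole' \<in> basin pole" by blast
  thus ?thesis using leads_to_finite[of pole' pole] assms(2) by (auto simp: basin_def)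
qed

section \<open>Sides of edges and face degrees\<close>

text \<open>The two half-discs of \<open>diam_disc\<close> are lifted to the two sides of a half-edge; \<open>upper_pt\<close> and its
  conjugate serve as base points for them.\<close>

definition upper_pt :: complex where "upper_pt = Complex (1/2) (1/4)"
definition up where "up z = face_at (\<sigma> z upper_pt)"
definition dn where "dn z = face_at (\<sigma> z (cnj upper_pt))"

lemma upper_pt_diam_disc: "upper_pt \<in> diam_disc" "cnj upper_pt \<in> diam_disc"
proof -
  have "1/2 - upper_pt = Complex 0 (-1/4)" "1/2 - cnj upper_pt = Complex 0 (1/4)" by (auto simp: upper_pt_def complex_eq_iff)
  thus "upper_pt \<in> diam_disc" "cnj upper_pt \<in> diam_disc" by (simp_all add: diam_disc_def dist_norm norm_complex_def)
qed

lemma half_disc: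
  assumes z: "z \<in> X"
  shows "b \<in> diam_disc \<Longrightarrow> Im b > 0 \<Longrightarrow> \<sigma> z b \<in> off_graph \<and> face_at (\<sigma> z b) = up z"
    and "b \<in> diam_disc \<Longrightarrow> Im b < 0 \<Longrightarrow> \<sigma> z b \<in> off_graph \<and> face_at (\<sigma> z b) = dn z"
proof -
  let ?U = "diam_disc \<inter> {w. Im w > 0}" and ?D = "diam_disc \<inter> {w. Im w < 0}"
  have cv: "connected ?U" "connected ?D"
    using diam_disc(2) by (auto intro!: convex_connected convex_Int convex_halfspace_Im_gt convex_halfspace_Im_lt)
  have U: "connected (\<sigma> z ` ?U)" "connected (\<sigma> z ` ?D)"
    using cv section_subset[OF \<sigma>(1)[OF z]] connected_section_image by blast+
  have F: "\<sigma> z ` ?U \<subseteq> off_graph" "\<sigma> z ` ?D \<subseteq> off_graph"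
    using section_image_off_graph[OF section_subset[OF \<sigma>(1)[OF z]]] not_seg by (metis (no_types, lifting) Int_iff inf_le1 less_irrefl mem_Collect_eq)+
  show "\<sigma> z b \<in> off_graph \<and> face_at (\<sigma> z b) = up z" if "b \<in> diam_disc" "Im b > 0"
    using face_at_eq[OF U(1) F(1), of "\<sigma> z b" "\<sigma> z upper_pt"] F(1) that upper_pt_diam_disc(1) by (auto simp: up_def upper_pt_def)
  show "\<sigma> z b \<in> off_graph \<and> face_at (\<sigma> z b) = dn z" if "b \<in> diam_disc" "Im b < 0"
    using face_at_eq[OF U(2) F(2), of "\<sigma> z b" "\<sigma> z (cnj upper_pt)"] F(2) that upper_pt_diam_disc(2) by (auto simp: dn_def upper_pt_def)
qed

text \<open>Continue the lift of the upper half-disc to a section over the upper half-plane. This tile lies in one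
  face, which contains the pole that the tile tends to.\<close>

lemma card_up:
  assumes pole: "f pole = None"
  shows "card {z\<in>X. up z = face_at pole} = mul pole"
proof -
  let ?H = "half_plane \<i> 0"
  have q: "(\<i>, 0) \<in> outer_half_planes" by (simp add: outer_half_planes_def)
  have ptH: "upper_pt \<in> ?H" by (simp add: half_plane_def upper_pt_def inner_complex_def)
  let ?L = "\<lambda>u. Lim (far ?H) (through ?H upper_pt u)"
  have key: "face_at u = face_at pole \<longleftrightarrow> ?L u = pole" if u: "f u = Some upper_pt" for u
  proof -
    note th = through[OF half_plane outer_01[OF q] ptH u]
    note lim = section_limit[OF approach_far[OF q] th(1)]
    have con: "connected (through ?H upper_pt u ` ?H)" 
      by (rule connected_section_image[OF th(1) convex_connected[OF half_plane(2)]])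
    have sub: "through ?H upper_pt u ` ?H \<subseteq> off_graph" by (rule section_image_off_graph[OF th(1) outer_not_seg[OF q]])
    have cl: "?L u \<in> closure (through ?H upper_pt u ` ?H)"
    proof (rule Lim_in_closed_set[OF closed_closure _ _ lim(2)])
      show "\<forall>\<^sub>F w in far ?H. through ?H upper_pt u w \<in> closure (through ?H upper_pt u ` ?H)"
        unfolding eventually_far using closure_subset by blast
      show "far ?H \<noteq> bot" using approach_far[OF q] by (simp add: approach_def)
    qed
    have "connected (insert (?L u) (through ?H upper_pt u ` ?H))"
      by (rule connected_intermediate_closure[OF con]) (use cl closure_subset[of "through ?H upper_pt u ` ?H"] in \<open>blast+\<close>)
    moreover have "insert (?L u) (through ?H upper_pt u ` ?H) \<subseteq> off_graph" using sub pole_in_off_graph[OF lim(1)] by blast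
    ultimately have "face_at u = face_at (?L u)"
      by (rule face_at_eq) (use th(2) ptH in \<open>auto intro!: image_eqI[of _ _ upper_pt]\<close>)
    thus ?thesis using pole_unique_in_face[OF lim(1) pole] by auto
  qed
  have "bij_betw (\<lambda>z. \<sigma> z upper_pt) {z\<in>X. up z = face_at pole} {u. f u = Some upper_pt \<and> ?L u = pole}"
  proof (rule bij_betwI')
    fix z z' assume "z \<in> {z\<in>X. up z = face_at pole}" "z' \<in> {z\<in>X. up z = face_at pole}"
    thus "(\<sigma> z upper_pt = \<sigma> z' upper_pt) = (z = z')" using section_diam_disc_eq[OF _ _ upper_pt_diam_disc(1)] by blast
  next
    fix z assume z: "z \<in> {z\<in>X. up z = face_at pole}"
    have "f (\<sigma> z upper_pt) = Some upper_pt" using \<sigma>(1)[of z] z upper_pt_diam_disc(1) by (simp add: section_on_def)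
    thus "\<sigma> z upper_pt \<in> {u. f u = Some upper_pt \<and> ?L u = pole}" using key z by (simp add: up_def)
  next
    fix u assume u: "u \<in> {u. f u = Some upper_pt \<and> ?L u = pole}"
    hence fu: "f u = Some upper_pt" by simp
    obtain z where z: "z \<in> X" "\<sigma> z upper_pt = u" by (rule \<sigma>_surj[OF fu upper_pt_diam_disc(1)])
    have "up z = face_at pole" using key u z by (simp add: up_def)
    thus "\<exists>z\<in>{z\<in>X. up z = face_at pole}. u = \<sigma> z upper_pt" using z by auto
  qed
  hence "card {z\<in>X. up z = face_at pole} = card {u. f u = Some upper_pt \<and> ?L u = pole}" by (rule bij_betw_same_card)
  also have "\<dots> = mul pole"
    by (rule card_limit_fibre[OF half_plane outer_01[OF q] ptH approach_far[OF q] pole])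
  finally show ?thesis .
qed

text \<open>Near \<open>w\<close> the function is \<open>1 + y^2\<close> in a local coordinate \<open>y\<close>. The two half-edges are the two halves of
  the imaginary axis, and the half-discs \<open>Re y > 0\<close> and \<open>Re y < 0\<close> lie off the graph. Since
  \<open>Im (y^2) = 2 * Re y * Im y\<close>, the upper side of the half-edge with \<open>Im y > 0\<close> is where \<open>Re y > 0\<close>, while for the
  other half-edge it is where \<open>Re y < 0\<close>.\<close>

lemma sides_swap:
  assumes w: "f w = Some 1"
  obtains z1 z2 where "z1 \<noteq> z2" "{z\<in>X. tgt z = w} = {z1, z2}" "up z1 = dn z2" "dn z1 = up z2"
proof -
  obtain U \<phi> \<phi>' r where U: "r > 0" "open U" "w \<in> U" and "U \<subseteq> UNIV" and U':
    "homeomorphism U (ball 0 r) \<phi> \<phi>'" "\<phi> w = (0::complex)"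
    "\<And>u. u \<in> U \<Longrightarrow> f u \<noteq> antipode (f w)" "\<And>u. u \<in> U \<Longrightarrow> chart (f w) (f u) = \<phi> u ^ mul w"
    using normal_form[OF open_UNIV UNIV_I, of w] by metis
  note U = U U'
  have fU: "f u = Some (1 + \<phi> u ^ 2)" if "u \<in> U" for u
  proof -
    have "f u \<noteq> None" using U(6)[OF that] w by (simp add: antipode_def)
    moreover have "the (f u) - 1 = \<phi> u ^ 2" using U(7)[OF that] w over_1[OF w] by (simp add: chart_def)
    ultimately show ?thesis by (cases "f u") (auto simp: algebra_simps)
  qed
  have hom: "continuous_on U \<phi>" "continuous_on (ball 0 r) \<phi>'" "\<And>u. u \<in> U \<Longrightarrow> \<phi> u \<in> ball 0 r"
     "\<And>u. u \<in> U \<Longrightarrow> \<phi>' (\<phi> u) = u" "\<And>y. y \<in> ball 0 r \<Longrightarrow> \<phi>' y \<in> U" "\<And>y. y \<in> ball 0 r \<Longrightarrow> \<phi> (\<phi>' y) = y"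
    using U(4) by (auto simp: homeomorphism_def)
  define HR where "HR = ball (0::complex) r \<inter> {y. Re y > 0}"
  define HL where "HL = ball (0::complex) r \<inter> {y. Re y < 0}"
  have conn: "connected (\<phi>' ` HR)" "connected (\<phi>' ` HL)"
    unfolding HR_def HL_def using hom(2)
    by (auto intro!: connected_continuous_image convex_connected convex_Int convex_halfspace_Re_gt convex_halfspace_Re_lt
        intro: continuous_on_subset)
  \<comment> \<open>\<open>1 + y^2\<close> lies in \<open>[0,1]\<close> only for imaginary \<open>y\<close>\<close>
  have sub: "\<phi>' y \<in> off_graph" if y: "y \<in> ball 0 r" "Re y \<noteq> 0" for y
  proof -
    have fy: "f (\<phi>' y) = Some (1 + y\<^sup>2)" using fU[OF hom(5)[OF y(1)]] hom(6)[OF y(1)] by simp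
    have "Some (1 + y\<^sup>2) \<notin> seg"
    proof
      assume "Some (1 + y\<^sup>2) \<in> seg"
      then obtain t :: real where t: "t \<le> 1" "1 + y\<^sup>2 = of_real t" by (auto simp: seg_def)
      have "Re (1 + y\<^sup>2) = t" "Im (1 + y\<^sup>2) = 0" using t(2) by auto
      hence "1 + (Re y)\<^sup>2 - (Im y)\<^sup>2 = t" "2 * Re y * Im y = 0" by (auto simp: power2_eq_square)
      hence "1 + (Re y)\<^sup>2 = t" using y(2) by auto
      moreover have "(Re y)\<^sup>2 > 0" using y(2) by simp
      ultimately show False using t(1) by linarith
    qed
    thus ?thesis by (simp add: off_graph_def fy)
  qed
  have subs: "\<phi>' ` HR \<subseteq> off_graph" "\<phi>' ` HL \<subseteq> off_graph" using sub by (auto simp: HR_def HL_def)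
  define cR where "cR = face_at (\<phi>' (of_real (r/2)))"
  define cL where "cL = face_at (\<phi>' (of_real (-r/2)))"
  have rin: "of_real (r/2) \<in> HR" "of_real (-r/2) \<in> HL" using U(1) by (auto simp: HR_def HL_def norm_divide)
  have cR: "face_at (\<phi>' y) = cR" if "y \<in> HR" for y
    unfolding cR_def by (rule face_at_eq[OF conn(1) subs(1)]) (use that rin in auto)
  have cL: "face_at (\<phi>' y) = cL" if "y \<in> HL" for y
    unfolding cL_def by (rule face_at_eq[OF conn(2) subs(2)]) (use that rin in auto)
  obtain z1 z2 where z: "z1 \<noteq> z2" "{z\<in>X. tgt z = w} = {z1, z2}" by (rule two_half_edges[OF w])
  have zX: "z \<in> X" "tgt z = w" if "z \<in> {z1, z2}" for z using z(2) that by blast+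
  have ev: "\<forall>\<^sub>F b in at 1 within diam_disc. \<sigma> z b \<in> U" if "z \<in> {z1, z2}" for z
    by (rule topological_tendstoD[OF tgt(2)[OF zX(1)[OF that]] U(2)]) (use zX(2)[OF that] U(3) in simp)
  have "\<forall>\<^sub>F b in at 1 within diam_disc. \<sigma> z1 b \<in> U \<and> \<sigma> z2 b \<in> U" using ev by (intro eventually_conj) auto
  then obtain \<delta> where \<delta>: "\<delta> > 0" "\<And>b. b \<in> diam_disc \<Longrightarrow> b \<noteq> 1 \<Longrightarrow> dist b 1 < \<delta> \<Longrightarrow> \<sigma> z1 b \<in> U \<and> \<sigma> z2 b \<in> U"
    unfolding eventually_at by blast
  define t where "t = max (1/2) (1 - \<delta>/2)"
  have t: "0 < t" "t < 1" "1 - t < \<delta>" using \<delta>(1) by (auto simp: t_def)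
  define V where "V = diam_disc \<inter> ball 1 \<delta>"
  have V: "open V" "of_real t \<in> V" "V \<subseteq> diam_disc"
  proof -
    have "dist 1 (complex_of_real t) = \<bar>1 - t\<bar>"
      unfolding dist_norm by (metis norm_of_real of_real_1 of_real_diff)
    thus "of_real t \<in> V" using t of_real_diam_disc by (simp add: V_def)
  qed (auto simp: V_def diam_disc)
  have inU: "\<sigma> z b \<in> U" if "b \<in> V" "z \<in> {z1, z2}" for z b
    using \<delta>(2)[of b] that diam_disc(3) by (auto simp: V_def dist_commute)
  define y where "y z b = \<phi> (\<sigma> z b)" for z b
  have y2: "y z b ^ 2 = b - 1" if "b \<in> V" "z \<in> {z1, z2}" for z b
  proof -
    have "f (\<sigma> z b) = Some b" using \<sigma>(1)[OF zX(1)[OF that(2)]] that(1) V(3) by (auto simp: section_on_def)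
    thus ?thesis using fU[OF inU[OF that]] by (simp add: y_def algebra_simps)
  qed
  have conty: "continuous_on V (y z)" if "z \<in> {z1, z2}" for z
    unfolding y_def
    using \<sigma>(1)[OF zX(1)[OF that]] V(3) inU that hom(1)
    by (intro continuous_on_compose2[of U \<phi> V "\<sigma> z"]) (auto simp: section_on_def intro: continuous_on_subset)
  have sides: "(Im (y z (of_real t)) > 0 \<longrightarrow> up z = cR \<and> dn z = cL) \<and> (Im (y z (of_real t)) < 0 \<longrightarrow> up z = cL \<and> dn z = cR)"
    if zz: "z \<in> {z1, z2}" for z
  proof -
    note X = zX(1)[OF zz]
    \<comment> \<open>near \<open>of_real t\<close> the coordinate stays in the same half of the plane, so the points slightly above and below the segment can be compared\<close>
    have near: "\<exists>\<eta>>0. \<forall>b. dist b (of_real t) < \<eta> \<longrightarrow> b \<in> V \<and> (Im (y z b) > 0 \<longleftrightarrow> Im (y z (of_real t)) > 0) \<and> (Im (y z b) < 0 \<longleftrightarrow> Im (y z (of_real t)) < 0)"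
      if nz: "Im (y z (of_real t)) \<noteq> 0"
    proof -
      have "isCont (y z) (of_real t)" using conty[OF zz] V(1,2) by (simp add: continuous_on_eq_continuous_at)
      hence lim: "((\<lambda>b. Im (y z b)) \<longlongrightarrow> Im (y z (of_real t))) (nhds (of_real t))"
        by (intro tendsto_Im) (simp add: isCont_def tendsto_at_iff_tendsto_nhds)
      have evV: "\<forall>\<^sub>F b in nhds (of_real t). b \<in> V" using V(1,2) eventually_nhds by blast
      consider "Im (y z (of_real t)) > 0" | "Im (y z (of_real t)) < 0" using nz by linarith
      hence "\<forall>\<^sub>F b in nhds (of_real t). b \<in> V \<and> (Im (y z b) > 0 \<longleftrightarrow> Im (y z (of_real t)) > 0) \<and> (Im (y z b) < 0 \<longleftrightarrow> Im (y z (of_real t)) < 0)"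
      proof cases
        case 1
        from eventually_conj[OF evV order_tendstoD(1)[OF lim 1]] show ?thesis
          by (rule eventually_mono) (use 1 in auto)
      next
        case 2
        from eventually_conj[OF evV order_tendstoD(2)[OF lim 2]] show ?thesis
          by (rule eventually_mono) (use 2 in auto)
      qed
      thus ?thesis unfolding eventually_nhds_metric .
    qed
    have im: "2 * Re (y z b) * Im (y z b) = Im b" if "b \<in> V" for b
    proof -
      have "Im (y z b ^ 2) = Im (b - 1)" using y2[OF that zz] by simp
      thus ?thesis by (simp add: power2_eq_square algebra_simps)
    qed
    have side: "face_at (\<sigma> z b) = (if Re (y z b) > 0 then cR else cL)" if "b \<in> V" "Re (y z b) \<noteq> 0" for b
    proof -
      have "y z b \<in> ball 0 r" "\<phi>' (y z b) = \<sigma> z b" using hom(3,4) inU[OF that(1) zz] by (auto simp: y_def)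
      thus ?thesis using cR[of "y z b"] cL[of "y z b"] that(2) by (auto simp: HR_def HL_def)
    qed
    show ?thesis
    proof (cases "Im (y z (of_real t)) = 0")
      case False
      from near[OF this] obtain \<eta> where \<eta>: "\<eta> > 0" "\<And>b. dist b (of_real t) < \<eta> \<Longrightarrow> b \<in> V \<and> (Im (y z b) > 0 \<longleftrightarrow> Im (y z (of_real t)) > 0) \<and> (Im (y z b) < 0 \<longleftrightarrow> Im (y z (of_real t)) < 0)"
        by blast
      define b1 where "b1 = complex_of_real t + of_real (\<eta>/2) * \<i>"
      define b2 where "b2 = complex_of_real t - of_real (\<eta>/2) * \<i>"
      have d: "dist b1 (of_real t) < \<eta>" "dist b2 (of_real t) < \<eta>" using \<eta>(1) by (auto simp: b1_def b2_def dist_norm norm_mult)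
      have b: "Im b1 > 0" "Im b2 < 0" using \<eta>(1) by (auto simp: b1_def b2_def)
      have u: "up z = face_at (\<sigma> z b1)" "dn z = face_at (\<sigma> z b2)"
        using half_disc[OF X] b \<eta>(2)[OF d(1)] \<eta>(2)[OF d(2)] V(3) by auto
      have i1: "2 * Re (y z b1) * Im (y z b1) > 0" "2 * Re (y z b2) * Im (y z b2) < 0"
        using im \<eta>(2)[OF d(1)] \<eta>(2)[OF d(2)] b by auto
      have "Re (y z b1) \<noteq> 0" "Re (y z b2) \<noteq> 0" using i1 by auto
      note s = side[OF conjunct1[OF \<eta>(2)[OF d(1)]] this(1)] side[OF conjunct1[OF \<eta>(2)[OF d(2)]] this(2)]
      show ?thesis
      proof (intro conjI impI)
        assume "Im (y z (of_real t)) > 0"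
        hence "Im (y z b1) > 0" "Im (y z b2) > 0" using \<eta>(2) d by blast+
        hence "Re (y z b1) > 0" "\<not> Re (y z b2) > 0" using i1 by (auto simp: zero_less_mult_iff mult_less_0_iff)
        thus "up z = cR" "dn z = cL" using u s by auto
      next
        assume "Im (y z (of_real t)) < 0"
        hence "Im (y z b1) < 0" "Im (y z b2) < 0" using \<eta>(2) d by blast+
        hence "\<not> Re (y z b1) > 0" "Re (y z b2) > 0" using i1 by (auto simp: zero_less_mult_iff mult_less_0_iff)
        thus "up z = cL" "dn z = cR" using u s by auto
      qed
    qed simp
  qed
  have nz: "y z1 (of_real t) \<noteq> y z2 (of_real t)"
  proof
    assume "y z1 (of_real t) = y z2 (of_real t)"
    hence "\<sigma> z1 (of_real t) = \<sigma> z2 (of_real t)" using hom(4) inU[OF V(2)] unfolding y_def by (metis insertCI)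
    hence "z1 = z2" using section_diam_disc_eq[of z1 z2 "of_real t"] zX(1) V by blast
    thus False using z(1) by simp
  qed
  have sq: "y z (of_real t) ^ 2 = of_real t - 1" if "z \<in> {z1, z2}" for z using y2[OF V(2) that] .
  have "y z2 (of_real t) = - y z1 (of_real t)"
    using nz sq[of z1] sq[of z2] power2_eq_iff[of "y z2 (of_real t)" "y z1 (of_real t)"] by auto
  moreover have "Im (y z1 (of_real t)) \<noteq> 0"
  proof
    assume i0: "Im (y z1 (of_real t)) = 0"
    have "Re (y z1 (of_real t) ^ 2) = t - 1" using sq[of z1] by simp
    hence "(Re (y z1 (of_real t)))\<^sup>2 = t - 1" using i0 by (simp add: power2_eq_square)
    thus False using t(2) zero_le_power2[of "Re (y z1 (of_real t))"] by linarith
  qed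
  ultimately have "up z1 = dn z2 \<and> dn z1 = up z2"
    using sides[of z1] sides[of z2] by (cases "Im (y z1 (of_real t)) > 0") auto
  thus ?thesis using that z by blast
qed

lemma half_edge_in_closure:
  assumes z: "z \<in> X"
  shows "half_edge z \<subseteq> closure (up z)" "half_edge z \<subseteq> closure (dn z)"
proof -
  have lim: "\<sigma> z (of_real t) \<in> closure S" if t: "0 < t" "t < 1" and s: "\<bar>s\<bar> = 1"
     and S: "\<And>\<epsilon>. \<epsilon> > 0 \<Longrightarrow> of_real t + of_real (s * \<epsilon>) * \<i> \<in> diam_disc \<Longrightarrow> \<sigma> z (of_real t + of_real (s * \<epsilon>) * \<i>) \<in> S" 
     for t s :: real and S
  proof -
    let ?b = "\<lambda>\<epsilon>. complex_of_real t + of_real (s * \<epsilon>) * \<i>"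
    have bt: "of_real t \<in> diam_disc" using t of_real_diam_disc by simp
    have "(?b \<longlongrightarrow> ?b 0) (at_right 0)" by (intro tendsto_intros)
    hence lb: "(?b \<longlongrightarrow> of_real t) (at_right 0)" by simp
    have cont: "continuous_on diam_disc (\<sigma> z)" using \<sigma>(1)[OF z] by (simp add: section_on_def)
    have evB: "\<forall>\<^sub>F \<epsilon> in at_right 0. ?b \<epsilon> \<in> diam_disc" by (rule topological_tendstoD[OF lb diam_disc(1) bt])
    have "((\<lambda>\<epsilon>. \<sigma> z (?b \<epsilon>)) \<longlongrightarrow> \<sigma> z (of_real t)) (at_right 0)"
      by (rule continuous_on_tendsto_compose[OF cont lb bt evB])
    moreover have "\<forall>\<^sub>F \<epsilon> in at_right 0. \<sigma> z (?b \<epsilon>) \<in> closure S"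
      using eventually_conj[OF evB eventually_at_right_less[of 0]]
      by (rule eventually_mono) (use S closure_subset in blast)
    ultimately show ?thesis by (intro Lim_in_closed_set[OF closed_closure, of _ _ "at_right 0"]) auto
  qed
  have all: "half_edge z \<subseteq> closure S" if s: "\<bar>s\<bar> = 1"
    and S: "\<And>b. b \<in> diam_disc \<Longrightarrow> s * Im b > 0 \<Longrightarrow> \<sigma> z b \<in> S" for s S
  proof
    fix u assume "u \<in> half_edge z"
    then obtain t where t: "0 < t" "t < 1" "u = \<sigma> z (of_real t)" by (auto simp: half_edge_def)
    have ss: "s * s = 1" using s by (metis abs_mult_self_eq mult_1)
    show "u \<in> closure S" unfolding t(3)
    proof (rule lim[OF t(1,2) s])
      fix \<epsilon> :: real assume "\<epsilon> > 0" "of_real t + of_real (s * \<epsilon>) * \<i> \<in> diam_disc"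
      thus "\<sigma> z (of_real t + of_real (s * \<epsilon>) * \<i>) \<in> S"
        using S[of "of_real t + of_real (s * \<epsilon>) * \<i>"] ss by (simp add: mult.assoc[symmetric])
    qed
  qed
  show "half_edge z \<subseteq> closure (up z)" by (rule all[of 1]) (use half_disc(1)[OF z] self_in_face_at in fastforce)+
  show "half_edge z \<subseteq> closure (dn z)" by (rule all[of "-1"]) (use half_disc(2)[OF z] self_in_face_at in fastforce)+
qed

lemma face_touching_edge:
  assumes z: "z \<in> X" and F: "F \<in> faces (belyi_graph f)" and sub: "half_edge z \<subseteq> closure F"
  shows "F = up z \<or> F = dn z"
proof -
  have "z \<in> half_edge z" using \<sigma>(2)[OF z] by (auto simp: half_edge_def intro!: image_eqI[of _ _ "1/2"])
  hence "z \<in> closure F" using sub by blast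
  moreover have "open (\<sigma> z ` diam_disc)" by (rule open_section_image[OF diam_disc(1) \<sigma>(1)[OF z] diam_disc(3)])
  moreover have "z \<in> \<sigma> z ` diam_disc" using \<sigma>(2)[OF z] diam_disc(4) by (metis imageI)
  ultimately have "\<sigma> z ` diam_disc \<inter> F \<noteq> {}" by (metis Int_commute closure_iff_nhds_not_empty order_refl)
  then obtain b where b: "b \<in> diam_disc" "\<sigma> z b \<in> F" by blast
  have FF: "F = face_at (\<sigma> z b)" by (rule face_eq_face_at[OF F b(2)])
  have "Im b \<noteq> 0"
  proof
    assume "Im b = 0"
    hence br: "b = of_real (Re b)" by (simp add: complex_eq_iff)
    hence "0 < Re b" "Re b < 1" using b(1) of_real_diam_disc by metis+
    moreover have "f (\<sigma> z b) = Some b" using \<sigma>(1)[OF z] b(1) by (simp add: section_on_def)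
    ultimately have "f (\<sigma> z b) \<in> seg" unfolding seg_def using br by (metis atLeastAtMost_iff imageI less_imp_le)
    moreover have "\<sigma> z b \<in> off_graph" using b(2) F unfolding faces_belyi_graph by (metis in_components_subset subsetD)
    ultimately show False by (simp add: off_graph_def)
  qed
  thus ?thesis using half_disc[OF z b(1)] FF by (cases "Im b > 0") auto
qed

text \<open>An edge lies in the closure of the faces at its two sides and of no other face. These are the faces on
  the upper sides of its two half-edges, so the term of the edge is the number of half-edges with the given
  face on the upper side.\<close>

theorem face_degree_eq_mul:
  assumes pole: "f pole = None"
  shows "face_at pole \<in> faces (belyi_graph f)" "face_degree (belyi_graph f) (face_at pole) = mul pole"
proof -
  let ?F = "face_at pole"
  show F: "?F \<in> faces (belyi_graph f)" by (rule face_at_in_faces[OF pole_in_off_graph[OF pole]])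
  let ?t = "\<lambda>e. if \<exists>F'\<in>faces (belyi_graph f). F' \<noteq> ?F \<and> e \<subseteq> CP1 closure_of F' then 1 else 2 :: nat"
  have summand: "(if edge w \<subseteq> CP1 closure_of ?F then ?t (edge w) else 0) = card {z\<in>X. tgt z = w \<and> up z = ?F}"
    if w: "f w = Some 1" for w
  proof -
    obtain z1 z2 where z: "z1 \<noteq> z2" "{z\<in>X. tgt z = w} = {z1, z2}" "up z1 = dn z2" "dn z1 = up z2"
      by (rule sides_swap[OF w])
    have zX: "z1 \<in> X" "tgt z1 = w" "z2 \<in> X" "tgt z2 = w" using z(2) by blast+
    have e: "edge w = insert w (half_edge z1 \<union> half_edge z2)" unfolding edge_def z(2) by auto
    have wcl: "w \<in> closure (half_edge z1)" using closure_half_edge(1)[OF zX(1)] zX(2) by blast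
    have iff: "edge w \<subseteq> closure F' \<longleftrightarrow> F' = up z1 \<or> F' = up z2" if F': "F' \<in> faces (belyi_graph f)" for F'
    proof
      assume "edge w \<subseteq> closure F'"
      hence "half_edge z1 \<subseteq> closure F'" using e by blast
      thus "F' = up z1 \<or> F' = up z2" using face_touching_edge[OF zX(1) F'] z(4) by simp
    next
      assume "F' = up z1 \<or> F' = up z2"
      hence h: "half_edge z1 \<subseteq> closure F'" "half_edge z2 \<subseteq> closure F'"
        using half_edge_in_closure[OF zX(1)] half_edge_in_closure[OF zX(3)] z(3,4) by auto
      have "closure (half_edge z1) \<subseteq> closure F'" using h(1) by (simp add: closure_minimal)
      thus "edge w \<subseteq> closure F'" unfolding e using h wcl by auto
    qed
    have upF: "up z1 \<in> faces (belyi_graph f)" "up z2 \<in> faces (belyi_graph f)"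
      using half_disc(1)[OF zX(1) upper_pt_diam_disc(1)] half_disc(1)[OF zX(3) upper_pt_diam_disc(1)] face_at_in_faces 
      by (auto simp: upper_pt_def up_def)
    have c: "{z\<in>X. tgt z = w \<and> up z = ?F} = {z\<in>{z1, z2}. up z = ?F}" using z(2) by blast
    have c': "{z\<in>{z1, z2}. up z = ?F} = (if up z1 = ?F then {z1} else {}) \<union> (if up z2 = ?F then {z2} else {})" by auto
    have ex: "(\<exists>F'\<in>faces (belyi_graph f). F' \<noteq> ?F \<and> edge w \<subseteq> closure F') \<longleftrightarrow> up z1 \<noteq> ?F \<or> up z2 \<noteq> ?F"
      using iff upF by auto
    show ?thesis unfolding c c' CP1_eq_euclidean euclidean_closure_of ex iff[OF F] using z(1) by auto
  qed
  show "face_degree (belyi_graph f) ?F = mul pole"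
    using sum_over_edges[where R = "\<lambda>e. e \<subseteq> CP1 closure_of ?F" and t = ?t and S = "\<lambda>z. up z = ?F", OF summand] card_up[OF pole]
    by (simp add: face_degree_def)
qed

end

section \<open>Homeomorphic graphs\<close>

locale sphere_homeo =
  fixes h h' :: "sphere \<Rightarrow> sphere"
  assumes cont: "continuous_on UNIV h" "continuous_on UNIV h'"
    and inv: "\<And>x. h' (h x) = x" "\<And>x. h (h' x) = x"
begin

lemma inj_h: "h x = h y \<longleftrightarrow> x = y"
  by (metis inv(1))

lemma inj: "inj_on h S"
  by (simp add: inj_on_def inj_h)

lemma inj_image: "inj_on ((`) h) S"
  by (auto simp: inj_on_def inj_image_eq_iff[OF inj])

lemma surj: "h ` UNIV = UNIV"
  using inv(2) by (metis surj_def)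

lemma closure_image: "closure (h ` S) = h ` closure S"
proof -
  have "h' ` closure (h ` S) \<subseteq> closure S"
    by (rule image_closure_subset) (use cont(2) inv closure_subset in \<open>auto intro: continuous_on_subset simp: image_image\<close>)
  hence "h ` h' ` closure (h ` S) \<subseteq> h ` closure S" by (rule image_mono)
  hence "closure (h ` S) \<subseteq> h ` closure S" by (simp add: image_image inv)
  moreover have "h ` closure S \<subseteq> closure (h ` S)"
  proof (rule image_closure_subset)
    show "continuous_on (closure S) h" using continuous_on_subset[OF cont(1)] by blast
  qed (simp_all add: closure_subset)
  ultimately show ?thesis by blast
qed

lemma connected_component_image:
  "connected_component (h ` S) (h x) (h y) \<longleftrightarrow> connected_component S x y"
proof
  assume "connected_component S x y"
  then obtain T where T: "connected T" "T \<subseteq> S" "x \<in> T" "y \<in> T" by (auto simp: connected_component_def)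
  have "connected (h ` T)" by (rule connected_continuous_image[OF continuous_on_subset[OF cont(1)] T(1)]) simp
  thus "connected_component (h ` S) (h x) (h y)" unfolding connected_component_def using T by blast
next
  assume "connected_component (h ` S) (h x) (h y)"
  then obtain T where T: "connected T" "T \<subseteq> h ` S" "h x \<in> T" "h y \<in> T" by (auto simp: connected_component_def)
  have "connected (h' ` T)" by (rule connected_continuous_image[OF continuous_on_subset[OF cont(2)] T(1)]) simp
  moreover have "h' ` T \<subseteq> S" using T(2) inv(1) by auto
  moreover have "x \<in> h' ` T" "y \<in> h' ` T" using T(3,4) inv(1) by (metis imageI)+
  ultimately show "connected_component S x y" unfolding connected_component_def by blast
qed

lemma components_image: "components (h ` S) = (`) h ` components S"
proof -
  have "connected_component_set (h ` S) (h x) = h ` connected_component_set S x" for x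
  proof -
    have "y \<in> connected_component_set (h ` S) (h x) \<longleftrightarrow> y \<in> h ` connected_component_set S x" for y
    proof -
      obtain z where y: "y = h z" using inv(2) by metis
      show ?thesis unfolding y using connected_component_image[of S x z] by (simp add: inj_image_mem_iff[OF inj])
    qed
    thus ?thesis by blast
  qed
  thus ?thesis by (simp add: components_def image_image)
qed

context
  fixes A B :: pgraph
  assumes verts: "h ` verts A = verts B" and edges: "(\<lambda>e. h ` e) ` edges A = edges B"
begin

lemma edge_ends_image: "edge_ends (h ` e) = h ` edge_ends e"
  unfolding edge_ends_def CP1_eq_euclidean euclidean_closure_of closure_image
  by (simp add: image_set_diff[OF inj])

lemma vertex_degree_image: "vertex_degree B (h v) = vertex_degree A v"
proof -
  have eq: "{e. e \<in> edges B \<and> h v \<in> edge_ends e} = (`) h ` {e. e \<in> edges A \<and> v \<in> edge_ends e}"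
    unfolding edges[symmetric] using edge_ends_image by (auto simp: inj_image_mem_iff[OF inj])
  have sing: "edge_ends (h ` e) = {h v} \<longleftrightarrow> edge_ends e = {v}" for e
    unfolding edge_ends_image using inj_image_eq_iff[OF inj, of _ "{v}"] by simp
  show ?thesis unfolding vertex_degree_def eq
    by (subst sum.reindex[OF inj_image]) (simp add: sing)
qed

lemma faces_image: "faces B = (`) h ` faces A"
proof -
  have "support B = h ` support A"
    unfolding support_def verts[symmetric] edges[symmetric] by (auto simp: image_Un image_Union)
  hence "UNIV - support B = h ` (UNIV - support A)"
    by (simp add: image_set_diff[OF inj] surj)
  thus ?thesis unfolding faces_def components_CP1 by (simp add: CP1_eq_euclidean components_image)
qed

lemma face_degree_image: "face_degree B (h ` F) = face_degree A F"
proof -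
  have cl: "h ` e \<subseteq> CP1 closure_of (h ` F') \<longleftrightarrow> e \<subseteq> CP1 closure_of F'" for e F'
    unfolding CP1_eq_euclidean euclidean_closure_of closure_image by (simp add: inj_image_subset_iff[OF inj])
  have eq: "{e. e \<in> edges B \<and> e \<subseteq> CP1 closure_of (h ` F)} = (`) h ` {e. e \<in> edges A \<and> e \<subseteq> CP1 closure_of F}"
    unfolding edges[symmetric] using cl by auto
  have ex: "(\<exists>F'\<in>faces B. F' \<noteq> h ` F \<and> h ` e \<subseteq> CP1 closure_of F') \<longleftrightarrow> (\<exists>F'\<in>faces A. F' \<noteq> F \<and> e \<subseteq> CP1 closure_of F')" for e
    unfolding faces_image using cl by (auto simp: inj_image_eq_iff[OF inj])
  show ?thesis unfolding face_degree_def eq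
    by (subst sum.reindex[OF inj_image]) (simp add: ex)
qed

lemma card_edges_image: "card (edges B) = card (edges A)"
  unfolding edges[symmetric] by (rule card_image[OF inj_image])

end

end

lemma pgraph_equiv_homeo:
  assumes "pgraph_equiv A B"
  obtains h h' where "sphere_homeo h h'" "h ` verts A = verts B" "(\<lambda>e. h ` e) ` edges A = edges B"
proof -
  obtain h where h: "homotopic_with (homeomorphic_map CP1 CP1) CP1 CP1 id h" 
     "h ` verts A = verts B" "(\<lambda>e. h ` e) ` edges A = edges B"
    using assms unfolding pgraph_equiv_def by blast
  have "homeomorphic_map CP1 CP1 h" using homotopic_with_imp_property[OF h(1)] by blast
  then obtain h' where "homeomorphic_maps CP1 CP1 h h'" using homeomorphic_map_maps by blast
  hence "sphere_homeo h h'"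
    unfolding CP1_eq_euclidean homeomorphic_maps_def by unfold_locales auto
  thus ?thesis using that h by blast
qed

lemma nonconst_rational_function:
  assumes "rational_function f" "\<nexists>c. \<forall>x. f x = c"
  obtains p q where "ratfun p q" "f = rat_map p q"
proof -
  obtain p q where pq: "q \<noteq> 0" "coprime p q" "f = rat_map p q" using assms(1) unfolding rational_function_def by blast
  have "max (degree p) (degree q) > 0"
  proof (rule ccontr)
    assume "\<not> ?thesis"
    hence "degree p = 0" "degree q = 0" by auto
    then obtain a b where ab: "p = [:a:]" "q = [:b:]" by (metis degree_eq_zeroE)
    hence "f x = Some (a / b)" for x using pq by (auto simp: rat_map_def split: option.splits)
    thus False using assms(2) by blast
  qed
  thus ?thesis using that pq by (simp add: ratfun_def)
qed

lemma clean_belyi_ratfun: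
  assumes "clean_belyi f"
  obtains p q where "clean_ratfun p q" "f = rat_map p q"
proof -
  have b: "rational_function f" "\<nexists>c. \<forall>x. f x = c" "\<And>y. critical_value f y \<Longrightarrow> y \<in> {Some 0, Some 1, None}"
    "\<And>x. f x = Some 1 \<Longrightarrow> mult_at f x = 2"
    using assms unfolding clean_belyi_def belyi_def by blast+
  obtain p q where pq: "ratfun p q" "f = rat_map p q" by (rule nonconst_rational_function[OF b(1,2)])
  interpret ratfun p q by fact
  have "clean_ratfun p q"
  proof unfold_locales
    fix x assume "mul x \<noteq> 1"
    hence "mult_at f x \<ge> 2" using mul_pos[of x] mult_at_eq_mul[of x] pq(2) by simp
    hence "critical_value f (f x)" unfolding critical_value_def by blast
    thus "rat_map p q x \<in> {Some 0, Some 1, None}" using b(3) pq(2) by blast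
  next
    fix x assume "rat_map p q x = Some 1"
    thus "mul x = 2" using b(4)[of x] mult_at_eq_mul[of x] pq(2) by simp
  qed
  thus ?thesis using that pq by blast
qed

lemma (in clean_ratfun) degrees_of_graph:
  assumes "pgraph_equiv (belyi_graph f) G"
  shows "f v = Some 0 \<Longrightarrow> \<exists>v'\<in>verts G. vertex_degree G v' = mul v"
    and "f x = None \<Longrightarrow> \<exists>F\<in>faces G. face_degree G F = mul x"
    and "2 * card (edges G) = N"
proof -
  obtain h h' where h: "sphere_homeo h h'" "h ` verts (belyi_graph f) = verts G" "(\<lambda>e. h ` e) ` edges (belyi_graph f) = edges G"
    by (rule pgraph_equiv_homeo[OF assms])
  interpret sphere_homeo h h' by fact
  show "f v = Some 0 \<Longrightarrow> \<exists>v'\<in>verts G. vertex_degree G v' = mul v"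
    using vertex_degree_image[OF h(2,3)] vertex_degree_eq_mul[of v] h(2) verts_belyi_graph by (metis (mono_tags, lifting) imageI mem_Collect_eq)
  show "\<exists>F\<in>faces G. face_degree G F = mul x" if "f x = None"
    using face_degree_image[OF h(2,3)] face_degree_eq_mul[OF that] faces_image[OF h(2,3)] by (metis imageI)
  show "2 * card (edges G) = N" using card_edges_image[OF h(2,3)] card_edges by simp
qed

section \<open>Rational functions of type (k,l)\<close>

definition (in ratfun) of_type :: "nat \<Rightarrow> nat \<Rightarrow> bool" where
  "of_type k l \<longleftrightarrow> (\<forall>x. f x = Some 0 \<longrightarrow> k dvd mul x) \<and> (\<forall>x. f x = None \<longrightarrow> l dvd mul x) \<and> (\<forall>x. f x = Some 1 \<longrightarrow> 2 dvd mul x)"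

definition (in ratfun) of_exact_type :: "nat \<Rightarrow> nat \<Rightarrow> bool" where
  "of_exact_type k l \<longleftrightarrow> (\<forall>x. mul x = (if f x = Some 0 then k else if f x = None then l else if f x = Some 1 then 2 else 1))"

text \<open>Over each value, the multiplicities of the first function divide those of the second.\<close>

lemma factor_through_exact_type:
  assumes "ratfun p q" "ratfun.of_exact_type p q k l" "ratfun P Q" "ratfun.of_type P Q k l"
  obtains \<psi> where "rational_function \<psi>" "rat_map P Q = rat_map p q \<circ> \<psi>"
proof -
  interpret F: ratfun p q by fact
  interpret G: ratfun P Q by fact
  interpret rat_lifting p q P Q ..
  have "compat z" for z
    unfolding compat_def
  proof (intro allI impI)
    fix y assume "rat_map p q y = rat_map P Q (Some z)"
    thus "F.mul y dvd G.mul (Some z)"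
      using assms(2)[unfolded F.of_exact_type_def, rule_format, of y] assms(4)[unfolded G.of_type_def] by auto
  qed
  thus ?thesis using factorization that by metis
qed

lemma card_fibre_le:
  fixes m :: "'a \<Rightarrow> nat"
  assumes "finite S" "\<And>x. x \<in> S \<Longrightarrow> k dvd m x \<and> m x > 0"
  shows "k * card S \<le> (\<Sum>x\<in>S. m x)" "\<exists>x\<in>S. m x \<noteq> k \<Longrightarrow> k * card S < (\<Sum>x\<in>S. m x)"
proof -
  have le: "k \<le> m x" if "x \<in> S" for x using assms(2)[OF that] dvd_imp_le by blast
  have "(\<Sum>x\<in>S. k) \<le> (\<Sum>x\<in>S. m x)" by (rule sum_mono) (rule le)
  thus "k * card S \<le> (\<Sum>x\<in>S. m x)" by (simp add: mult.commute)
  assume "\<exists>x\<in>S. m x \<noteq> k"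
  then obtain x where x: "x \<in> S" "m x \<noteq> k" by blast
  have "(\<Sum>x\<in>S. k) < (\<Sum>x\<in>S. m x)"
    by (rule sum_strict_mono_ex1[OF assms(1)]) (use le x in \<open>force+\<close>)
  thus "k * card S < (\<Sum>x\<in>S. m x)" by (simp add: mult.commute)
qed

context ratfun begin

text \<open>The three special fibres together have \<open>N + 2\<close> points or more, by Riemann--Hurwitz; each of them is small
  because its multiplicities are large. The last four statements locate a possible excess of multiplicity.\<close>

lemma special_fibres:
  assumes "of_type k l"
  defines "n0 \<equiv> card {x. f x = Some 0}" and "n1 \<equiv> card {x. f x = Some 1}" and "ni \<equiv> card {x. f x = None}"
  shows "k * n0 \<le> N" "2 * n1 \<le> N" "l * ni \<le> N" "N + 2 \<le> n0 + n1 + ni"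
    and "f x = Some 0 \<Longrightarrow> mul x \<noteq> k \<Longrightarrow> k * n0 < N"
    and "f x = Some 1 \<Longrightarrow> mul x \<noteq> 2 \<Longrightarrow> 2 * n1 < N"
    and "f x = None \<Longrightarrow> mul x \<noteq> l \<Longrightarrow> l * ni < N"
    and "f x \<notin> {Some 0, Some 1, None} \<Longrightarrow> mul x \<noteq> 1 \<Longrightarrow> N + 2 < n0 + n1 + ni"
proof -
  let ?zeros = "{x. f x = Some 0}" and ?ones = "{x. f x = Some 1}" and ?poles = "{x. f x = None}"
  have d: "\<And>x. x \<in> ?zeros \<Longrightarrow> k dvd mul x \<and> mul x > 0" "\<And>x. x \<in> ?ones \<Longrightarrow> 2 dvd mul x \<and> mul x > 0"
    "\<And>x. x \<in> ?poles \<Longrightarrow> l dvd mul x \<and> mul x > 0"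
    using assms(1) mul_pos unfolding of_type_def by auto
  note fin = finite_fibre
  show "k * n0 \<le> N" "2 * n1 \<le> N" "l * ni \<le> N"
    using card_fibre_le(1)[where m = mul, OF fin d(1)] card_fibre_le(1)[where m = mul, OF fin d(2)] card_fibre_le(1)[where m = mul, OF fin d(3)]
    by (simp_all add: sum_mul_fibre n0_def n1_def ni_def)
  show "f x = Some 0 \<Longrightarrow> mul x \<noteq> k \<Longrightarrow> k * n0 < N"
    using card_fibre_le(2)[where m = mul, OF fin d(1)] by (auto simp: sum_mul_fibre n0_def)
  show "f x = Some 1 \<Longrightarrow> mul x \<noteq> 2 \<Longrightarrow> 2 * n1 < N"
    using card_fibre_le(2)[where m = mul, OF fin d(2)] by (auto simp: sum_mul_fibre n1_def)
  show "f x = None \<Longrightarrow> mul x \<noteq> l \<Longrightarrow> l * ni < N"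
    using card_fibre_le(2)[where m = mul, OF fin d(3)] by (auto simp: sum_mul_fibre ni_def)
  have fibre: "(\<Sum>x | f x = y. mul x - 1) + card {x. f x = y} = N" for y
  proof -
    have "(\<Sum>x | f x = y. mul x - 1) + (\<Sum>x | f x = y. 1) = (\<Sum>x | f x = y. mul x - 1 + 1)"
      by (rule sum.distrib[symmetric])
    also have "\<dots> = (\<Sum>x | f x = y. mul x)" 
    proof (rule sum.cong[OF refl])
      fix x show "mul x - 1 + 1 = mul x" using mul_pos[of x] by simp
    qed
    finally show ?thesis by (simp add: sum_mul_fibre)
  qed
  let ?All = "?zeros \<union> ?ones \<union> ?poles"
  have finS: "finite ?All" using fin by blast
  have "(\<Sum>x\<in>?All. mul x - 1) = (\<Sum>x\<in>?zeros \<union> ?ones. mul x - 1) + (\<Sum>x\<in>?poles. mul x - 1)"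
    using fin by (intro sum.union_disjoint) auto
  also have "(\<Sum>x\<in>?zeros \<union> ?ones. mul x - 1) = (\<Sum>x\<in>?zeros. mul x - 1) + (\<Sum>x\<in>?ones. mul x - 1)"
    using fin by (intro sum.union_disjoint) auto
  finally have S: "(\<Sum>x\<in>?All. mul x - 1) + (n0 + n1 + ni) = 3 * N"
    using fibre[of "Some 0"] fibre[of "Some 1"] fibre[of None] by (simp add: n0_def n1_def ni_def)
  show "N + 2 \<le> n0 + n1 + ni" using riemann_hurwitz_le[OF finS] S N_pos by linarith
  assume x: "f x \<notin> {Some 0, Some 1, None}" "mul x \<noteq> 1"
  hence "(\<Sum>x\<in>insert x ?All. mul x - 1) = (mul x - 1) + (\<Sum>x\<in>?All. mul x - 1)"
    using finS by (intro sum.insert) auto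
  moreover have "(\<Sum>x\<in>insert x ?All. mul x - 1) \<le> 2 * N - 2" by (rule riemann_hurwitz_le) (use finS in simp)
  moreover have "mul x - 1 \<ge> 1" using x(2) mul_pos[of x] by simp
  ultimately show "N + 2 < n0 + n1 + ni" using S N_pos by linarith
qed

lemma spherical_type:
  assumes "of_type k l" "k \<ge> 2" "l \<ge> 2"
  shows "k * l < 2 * k + 2 * l"
proof -
  note s = special_fibres(1-4)[OF assms(1)]
  define a b c where "a = card {x. f x = Some 0}" and "b = card {x. f x = Some 1}" and "c = card {x. f x = None}"
  note s = s[folded a_def b_def c_def]
  have 1: "N + 4 \<le> 2 * a + 2 * c" using s(2,4) by linarith
  have "k * l * (N + 4) \<le> k * l * (2 * a + 2 * c)" using 1 by (rule mult_le_mono2)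
  also have "\<dots> = 2 * l * (k * a) + 2 * k * (l * c)" by (simp add: algebra_simps)
  also have "\<dots> \<le> 2 * l * N + 2 * k * N" using s(1,3) by (intro add_mono mult_le_mono2)
  finally have "k * l * N + 4 * (k * l) \<le> (2 * k + 2 * l) * N" by (simp add: algebra_simps)
  moreover have "k * l > 0" using assms by simp
  ultimately have "(k * l) * N < (2 * k + 2 * l) * N" by linarith
  thus ?thesis by (metis mult_less_cancel2)
qed

text \<open>For this degree all inequalities in \<open>special_fibres\<close> are equalities, because a combination of them with
  positive coefficients is one.\<close>

lemma exact_typeI:
  assumes t: "of_type k l" "k \<ge> 2" "l \<ge> 2" and deg: "int N * (2 * int k + 2 * int l - int k * int l) = 4 * int k * int l"
  shows "of_exact_type k l"
proof -
  define a b c where "a = card {x. f x = Some 0}" and "b = card {x. f x = Some 1}" and "c = card {x. f x = None}"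
  note s = special_fibres[OF t(1), folded a_def b_def c_def]
  define K L M where "K = int k" and "L = int l" and "M = int N"
  have pos: "K > 0" "L > 0" using t by (auto simp: K_def L_def)
  have le: "K * int a \<le> M" "2 * int b \<le> M" "L * int c \<le> M" "M + 2 \<le> int a + int b + int c"
    using s(1-4) unfolding K_def L_def M_def by (metis of_nat_le_iff of_nat_mult of_nat_numeral of_nat_add)+
  have deg': "2 * K * M + 2 * L * M + K * L * M = 2 * K * L * (M + 2)"
    using deg by (simp add: K_def L_def M_def algebra_simps)
  \<comment> \<open>a vanishing sum of nonnegative terms, one for each inequality\<close>
  have 1: "2 * L * (M - K * int a) + K * L * (M - 2 * int b) + 2 * K * (M - L * int c) + 2 * K * L * (int a + int b + int c - (M + 2)) = 0"
    using deg' by (simp add: algebra_simps)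
  have nn: "2 * L * (M - K * int a) \<ge> 0" "K * L * (M - 2 * int b) \<ge> 0" "2 * K * (M - L * int c) \<ge> 0"
    "2 * K * L * (int a + int b + int c - (M + 2)) \<ge> 0"
    using le pos by (auto intro!: mult_nonneg_nonneg)
  have "2 * L * (M - K * int a) = 0" "K * L * (M - 2 * int b) = 0" "2 * K * (M - L * int c) = 0"
    "2 * K * L * (int a + int b + int c - (M + 2)) = 0" using 1 nn by linarith+
  hence z: "M = K * int a" "M = 2 * int b" "M = L * int c" "M + 2 = int a + int b + int c" using pos by auto
  have eqs: "N = k * a" "N = 2 * b" "N = l * c" "N + 2 = a + b + c"
  proof -
    have "int N = int (k * a)" "int N = int (2 * b)" "int N = int (l * c)" "int (N + 2) = int (a + b + c)"
      using z by (simp_all add: K_def L_def M_def)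
    thus "N = k * a" "N = 2 * b" "N = l * c" "N + 2 = a + b + c" unfolding of_nat_eq_iff .
  qed
  have "mul x = (if f x = Some 0 then k else if f x = None then l else if f x = Some 1 then 2 else 1)" for x
    using s(5-8)[of x] eqs by (auto split: if_splits)
  thus ?thesis by (simp add: of_exact_type_def)
qed

lemma card_regular_fibre:
  assumes "y \<notin> f ` {x. mul x \<noteq> 1}"
  shows "card {x. f x = y} = N"
proof -
  have "N = (\<Sum>x | f x = y. mul x)" by (simp add: sum_mul_fibre)
  also have "\<dots> = (\<Sum>x | f x = y. 1)" using assms by (intro sum.cong) auto
  finally show ?thesis by simp
qed

end

lemma infinite_sphere: "infinite (UNIV :: sphere set)"
  by (metis finite_imageD finite_subset infinite_UNIV_char_0 inj_Some subset_UNIV)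

text \<open>Over a value that is critical for none of the maps involved, fibres are as large as the degrees.\<close>

lemma degree_composition:
  assumes F: "ratfun p q" and G: "ratfun P Q" and \<psi>: "rational_function \<psi>" "rat_map P Q = rat_map p q \<circ> \<psi>"
  shows "ratfun.N p q dvd ratfun.N P Q"
proof -
  interpret F: ratfun p q by fact
  interpret G: ratfun P Q by fact
  have "\<nexists>c. \<forall>x. \<psi> x = c"
  proof
    assume "\<exists>c. \<forall>x. \<psi> x = c"
    then obtain c where "\<And>x. \<psi> x = c" by blast
    hence "G.f x = F.f c" for x using \<psi>(2) by simp
    hence "{x. G.f x = F.f c} = UNIV" by simp
    thus False using G.finite_fibre[of "F.f c"] infinite_sphere by simp
  qed
  then obtain r s where rs: "ratfun r s" "\<psi> = rat_map r s" by (rule nonconst_rational_function[OF \<psi>(1)])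
  interpret H: ratfun r s by fact
  let ?bad = "F.f ` {x. F.mul x \<noteq> 1} \<union> G.f ` {x. G.mul x \<noteq> 1} \<union> F.f ` (H.f ` {x. H.mul x \<noteq> 1})"
  have "finite ?bad" 
    by (intro finite_UnI finite_imageI F.finite_ramified G.finite_ramified H.finite_ramified)
  then obtain y where y: "y \<notin> ?bad" using ex_new_if_finite[OF infinite_sphere] by metis
  have "G.N = card {x. G.f x = y}" using G.card_regular_fibre[of y] y by simp
  also have "{x. G.f x = y} = (\<Union>z\<in>{z. F.f z = y}. {x. H.f x = z})" using \<psi>(2) rs(2) by auto
  also have "card \<dots> = (\<Sum>z\<in>{z. F.f z = y}. card {x. H.f x = z})"
    using F.finite_fibre H.finite_fibre by (intro card_UN_disjoint) auto
  also have "\<dots> = (\<Sum>z\<in>{z. F.f z = y}. H.N)"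
  proof (rule sum.cong[OF refl])
    fix z assume "z \<in> {z. F.f z = y}"
    hence "z \<notin> H.f ` {x. H.mul x \<noteq> 1}" using y by blast
    thus "card {x. H.f x = z} = H.N" by (rule H.card_regular_fibre)
  qed
  also have "\<dots> = F.N * H.N" using F.card_regular_fibre[of y] y by simp
  finally show ?thesis by simp
qed

section \<open>The polyhedral functions\<close>

lemma coprime_if_no_common_root:
  fixes p q :: "complex poly"
  assumes "\<And>z. poly p z = 0 \<Longrightarrow> poly q z = 0 \<Longrightarrow> False" "p \<noteq> 0"
  shows "coprime p q"
proof (rule coprimeI)
  fix r assume r: "r dvd p" "r dvd q"
  have "r \<noteq> 0" using r(1) assms(2) by auto
  have "degree r = 0"
  proof (rule ccontr)
    assume "degree r \<noteq> 0"
    then obtain z where "poly r z = 0" using positive_degree_root by blast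
    hence "poly p z = 0" "poly q z = 0" using r by (auto elim!: dvdE)
    thus False using assms(1) by blast
  qed
  thus "is_unit r" using \<open>r \<noteq> 0\<close> by (simp add: is_unit_iff_degree)
qed

lemma dvd_order_power: "n dvd order z (smult a (A ^ n))" if "a \<noteq> 0" "A \<noteq> 0" for A :: "complex poly"
proof -
  have "order z (A ^ m) = m * order z A" for m
  proof (induction m)
    case 0 show ?case by (simp add: order_0I)
  next
    case (Suc m)
    thus ?case using that(2) by (simp add: order_mult)
  qed
  thus ?thesis using that(1) by (simp add: order_smult)
qed

text \<open>The relation says that the quotient of \<open>a * A^k\<close> by \<open>b * B^l\<close> differs from \<open>1\<close> by a multiple of a square,
  divided by the same denominator. The conditions on \<open>n\<close> concern the point at infinity.\<close>

lemma power_relation_type: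
  fixes A B C :: "complex poly"
  assumes rel: "smult a (A ^ k) - smult b (B ^ l) = smult c (C ^ 2)" and nz: "a \<noteq> 0" "b \<noteq> 0" "c \<noteq> 0"
    and kl: "k > 0" "l > 0"
    and nr: "\<And>z. poly A z = 0 \<Longrightarrow> poly B z = 0 \<Longrightarrow> False"
    and n: "n = max (k * degree A) (l * degree B)" "n > 0"
    and inf: "k dvd n - k * degree A" "l dvd n - l * degree B" "2 dvd n - 2 * degree C"
  shows "\<exists>p q. ratfun p q \<and> ratfun.N p q = n \<and> ratfun.of_type p q k l"
proof -
  let ?p = "smult a (A ^ k)" and ?q = "smult b (B ^ l)"
  have A0: "A \<noteq> 0"
  proof
    assume 0: "A = 0"
    hence "degree B > 0" using n kl by simp
    then obtain z where "poly B z = 0" by (rule positive_degree_root)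
    thus False using nr[of z] 0 by simp
  qed
  have B0: "B \<noteq> 0"
  proof
    assume 0: "B = 0"
    hence "degree A > 0" using n kl by simp
    then obtain z where "poly A z = 0" by (rule positive_degree_root)
    thus False using nr[of z] 0 by simp
  qed
  have deg: "degree ?p = k * degree A" "degree ?q = l * degree B"
    using nz A0 B0 by (simp_all add: degree_power_eq)
  have "coprime ?p ?q"
    by (rule coprime_if_no_common_root) (use nr nz A0 kl in auto)
  moreover have "max (degree ?p) (degree ?q) > 0" using n deg by simp
  ultimately interpret ratfun ?p ?q by unfold_locales
  have N: "N = n" by (simp only: N_def deg n)
  have C0: "C \<noteq> 0" using fib_nz[of "Some 1"] rel by (auto simp: fibpoly_def)
  have fib: "fibpoly (Some 0) = ?p" "fibpoly None = ?q" "fibpoly (Some 1) = smult c (C ^ 2)"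
    using rel by (simp_all add: fibpoly_def)
  have degC: "degree (smult c (C ^ 2)) = 2 * degree C" using nz C0 by (simp add: degree_power_eq)
  have d: "k dvd mul x" if "f x = Some 0" for x
    using that dvd_order_power[OF nz(1) A0] inf(1) by (cases x) (simp_all add: mul_def fib(1) N deg del: degree_smult_eq)
  have "l dvd mul x" if "f x = None" for x
    using that dvd_order_power[OF nz(2) B0] inf(2) by (cases x) (simp_all add: mul_def fib(2) N deg del: degree_smult_eq)
  moreover have "2 dvd mul x" if "f x = Some 1" for x
    using that dvd_order_power[OF nz(3) C0] inf(3) degC by (cases x) (simp_all add: mul_def fib(3) N del: degree_smult_eq)
  ultimately have "of_type k l" using d unfolding of_type_def by blast
  thus ?thesis using N ratfun_axioms by blast
qed

text \<open>Exchanging the roles of \<open>A\<close> and \<open>B\<close> exchanges zeros and poles.\<close>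

lemma power_relation_types:
  fixes A B C :: "complex poly"
  assumes rel: "smult a (A ^ k) - smult b (B ^ l) = smult c (C ^ 2)" and nz: "a \<noteq> 0" "b \<noteq> 0" "c \<noteq> 0"
    and kl: "k > 0" "l > 0"
    and nr: "\<And>z. poly A z = 0 \<Longrightarrow> poly B z \<noteq> 0"
    and n: "n = max (k * degree A) (l * degree B)" "n > 0"
    and inf: "k dvd n - k * degree A" "l dvd n - l * degree B" "2 dvd n - 2 * degree C"
  shows "\<exists>p q. ratfun p q \<and> ratfun.N p q = n \<and> ratfun.of_type p q k l"
    and "\<exists>p q. ratfun p q \<and> ratfun.N p q = n \<and> ratfun.of_type p q l k"
proof -
  show "\<exists>p q. ratfun p q \<and> ratfun.N p q = n \<and> ratfun.of_type p q k l"
    by (rule power_relation_type[OF rel nz kl _ n inf]) (use nr in blast)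
  have rel': "smult b (B ^ l) - smult a (A ^ k) = smult (- c) (C ^ 2)"
    using rel by (simp add: algebra_simps)
  show "\<exists>p q. ratfun p q \<and> ratfun.N p q = n \<and> ratfun.of_type p q l k"
    by (rule power_relation_type[OF rel' nz(2,1) _ kl(2,1) _ _ n(2) inf(2,1,3)])
       (use nr nz n in \<open>auto simp: max.commute\<close>)
qed

lemma degree_comp_monom: "degree (pcompose P (monom 1 m)) = degree P * m" for P :: "complex poly"
  by (simp add: degree_pcompose degree_monom_eq)

lemma degree_X_comp_monom:
  fixes P :: "complex poly"
  assumes "degree P > 0" "m > 0"
  shows "degree (pCons 0 (pcompose P (monom 1 m))) = Suc (degree P * m)"
proof -
  have "degree (pcompose P (monom 1 m)) > 0" using assms by (simp add: degree_comp_monom)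
  hence "pcompose P (monom 1 m) \<noteq> 0" by auto
  thus ?thesis by (simp add: degree_comp_monom)
qed

text \<open>The relation \<open>(z^r + 1)^2 - 4 * z^r = (z^r - 1)^2\<close> of the dihedral groups.\<close>

lemma dihedral_relation:
  assumes "r > 0"
  shows "\<exists>p q. ratfun p q \<and> ratfun.N p q = 2 * r \<and> ratfun.of_type p q 2 r"
    and "\<exists>p q. ratfun p q \<and> ratfun.N p q = 2 * r \<and> ratfun.of_type p q r 2"
proof -
  let ?A = "pcompose [:1, 1:] (monom 1 r) :: complex poly" and ?B = "[:0, 1:] :: complex poly"
    and ?C = "pcompose [:-1, 1:] (monom 1 r) :: complex poly"
  have rel: "smult 1 (?A ^ 2) - smult 4 (?B ^ r) = smult 1 (?C ^ 2)"
  proof (rule poly_eq_poly_eq_iff[THEN iffD1], rule ext)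
    fix z :: complex
    show "poly (smult 1 (?A ^ 2) - smult 4 (?B ^ r)) z = poly (smult 1 (?C ^ 2)) z"
      by (simp add: poly_pcompose poly_monom) algebra
  qed
  have nr: "poly ?A z = 0 \<Longrightarrow> poly ?B z \<noteq> 0" for z
    using assms by (auto simp: poly_pcompose poly_monom power_0_left)
  have deg: "degree ?A = r" "degree ?B = 1" "degree ?C = r" by (simp_all add: degree_comp_monom)
  have n: "2 * r = max (2 * degree ?A) (r * degree ?B)" unfolding deg by simp
  note * = power_relation_types[OF rel _ _ _ _ assms nr n, unfolded deg]
  show "\<exists>p q. ratfun p q \<and> ratfun.N p q = 2 * r \<and> ratfun.of_type p q 2 r"
    by (rule *(1)) (use assms in simp_all)
  show "\<exists>p q. ratfun p q \<and> ratfun.N p q = 2 * r \<and> ratfun.of_type p q r 2"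
    by (rule *(2)) (use assms in simp_all)
qed

text \<open>Klein's relations for the tetrahedron, octahedron and icosahedron. The roots of \<open>A\<close>, \<open>B\<close>, \<open>C\<close>, together
  with infinity where the degrees demand it, are the vertices, the face centres and the edge midpoints.
  Apart from a factor \<open>z\<close> they are polynomials in \<open>z^3\<close>, \<open>z^4\<close> and \<open>z^5\<close>, respectively.\<close>

lemma tetrahedral_relation: "\<exists>p q. ratfun p q \<and> ratfun.N p q = 12 \<and> ratfun.of_type p q 3 3"
proof -
  let ?A = "pCons 0 (pcompose [:8, 1:] (monom 1 3)) :: complex poly" and ?B = "pcompose [:-1, 1:] (monom 1 3) :: complex poly"
    and ?C = "pcompose [:-8, -20, 1:] (monom 1 3) :: complex poly"
  have id: "u * (8 + u) ^ 3 - 64 * (u - 1) ^ 3 = (u * (u - 20) - 8)\<^sup>2" for u :: complex by algebra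
  have rel: "smult 1 (?A ^ 3) - smult 64 (?B ^ 3) = smult 1 (?C ^ 2)"
  proof (rule poly_eq_poly_eq_iff[THEN iffD1], rule ext)
    fix z :: complex
    show "poly (smult 1 (?A ^ 3) - smult 64 (?B ^ 3)) z = poly (smult 1 (?C ^ 2)) z"
      using id[of "z ^ 3"] by (simp add: poly_pcompose poly_monom power_mult_distrib)
  qed
  have nr: "poly ?A z = 0 \<Longrightarrow> poly ?B z \<noteq> 0" for z
  proof
    assume "poly ?A z = 0" "poly ?B z = 0"
    hence "z = 0 \<or> 8 + z ^ 3 = 0" "z ^ 3 = 1" by (auto simp: poly_pcompose poly_monom)
    thus False by auto
  qed
  have deg: "degree ?A = 4" "degree ?B = 3" "degree ?C = 6"
    by (subst degree_X_comp_monom degree_comp_monom; simp)+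
  have n: "12 = max (3 * degree ?A) (3 * degree ?B)" unfolding deg by simp
  show ?thesis
    by (rule power_relation_types(1)[OF rel _ _ _ _ _ nr n]) (simp_all add: deg)
qed

lemma octahedral_relation:
  "\<exists>p q. ratfun p q \<and> ratfun.N p q = 24 \<and> ratfun.of_type p q 3 4"
  "\<exists>p q. ratfun p q \<and> ratfun.N p q = 24 \<and> ratfun.of_type p q 4 3"
proof -
  let ?A = "pcompose [:1, 14, 1:] (monom 1 4) :: complex poly" and ?B = "pCons 0 (pcompose [:-1, 1:] (monom 1 4)) :: complex poly"
    and ?C = "pcompose [:1, -33, -33, 1:] (monom 1 4) :: complex poly"
  have id: "(1 + u * (14 + u)) ^ 3 - 108 * (u * (u - 1) ^ 4) = (1 + u * (u * (u - 33) - 33))\<^sup>2" for u :: complex by algebra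
  have rel: "smult 1 (?A ^ 3) - smult 108 (?B ^ 4) = smult 1 (?C ^ 2)"
  proof (rule poly_eq_poly_eq_iff[THEN iffD1], rule ext)
    fix z :: complex
    show "poly (smult 1 (?A ^ 3) - smult 108 (?B ^ 4)) z = poly (smult 1 (?C ^ 2)) z"
      using id[of "z ^ 4"] by (simp add: poly_pcompose poly_monom power_mult_distrib)
  qed
  have nr: "poly ?A z = 0 \<Longrightarrow> poly ?B z \<noteq> 0" for z
  proof
    assume "poly ?A z = 0" "poly ?B z = 0"
    hence "1 + z ^ 4 * (14 + z ^ 4) = 0" "z = 0 \<or> z ^ 4 = 1" by (auto simp: poly_pcompose poly_monom)
    thus False by auto
  qed
  have deg: "degree ?A = 8" "degree ?B = 5" "degree ?C = 12"
    by (subst degree_X_comp_monom degree_comp_monom; simp)+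
  have n: "24 = max (3 * degree ?A) (4 * degree ?B)" unfolding deg by simp
  note * = power_relation_types[OF rel _ _ _ _ _ nr n]
  show "\<exists>p q. ratfun p q \<and> ratfun.N p q = 24 \<and> ratfun.of_type p q 3 4" by (rule *(1)) (simp_all add: deg)
  show "\<exists>p q. ratfun p q \<and> ratfun.N p q = 24 \<and> ratfun.of_type p q 4 3" by (rule *(2)) (simp_all add: deg)
qed

lemma icosahedral_relation:
  "\<exists>p q. ratfun p q \<and> ratfun.N p q = 60 \<and> ratfun.of_type p q 3 5"
  "\<exists>p q. ratfun p q \<and> ratfun.N p q = 60 \<and> ratfun.of_type p q 5 3"
proof -
  let ?A = "pcompose [:-1, -228, -494, 228, -1:] (monom 1 5) :: complex poly"
    and ?B = "pCons 0 (pcompose [:-1, 11, 1:] (monom 1 5)) :: complex poly"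
    and ?C = "pcompose [:1, -522, -10005, 0, -10005, 522, 1:] (monom 1 5) :: complex poly"
  have id: "(u * (u * (u * (228 - u) - 494) - 228) - 1) ^ 3 - 1728 * (u * (u * (11 + u) - 1) ^ 5)
     = - ((1 + u * (u * (u * (u * (u * (522 + u) - 10005)) - 10005) - 522))\<^sup>2)" for u :: complex by algebra
  have rel: "smult 1 (?A ^ 3) - smult 1728 (?B ^ 5) = smult (-1) (?C ^ 2)"
  proof (rule poly_eq_poly_eq_iff[THEN iffD1], rule ext)
    fix z :: complex
    show "poly (smult 1 (?A ^ 3) - smult 1728 (?B ^ 5)) z = poly (smult (-1) (?C ^ 2)) z"
      using id[of "z ^ 5"] by (simp add: poly_pcompose poly_monom power_mult_distrib)
  qed
  have nr: "poly ?A z = 0 \<Longrightarrow> poly ?B z \<noteq> 0" for z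
  proof
    assume z: "poly ?A z = 0" "poly ?B z = 0"
    define u where "u = z ^ 5"
    have "poly ?A z = u * (u * (u * (228 - u) - 494) - 228) - 1"
      by (simp add: poly_pcompose poly_monom u_def algebra_simps)
    hence A: "u * (u * (u * (228 - u) - 494) - 228) - 1 = 0" using z by simp
    have "poly ?B z = z * (u * (11 + u) - 1)"
      by (simp add: poly_pcompose poly_monom u_def algebra_simps)
    moreover have "z \<noteq> 0" using A by (auto simp: u_def)
    ultimately have B: "u * (11 + u) - 1 = 0" using z by simp
    \<comment> \<open>reducing the quartic modulo \<open>u^2 = 1 - 11 * u\<close> leaves \<open>3125 * (11 * u - 1)\<close>, and \<open>u = 1/11\<close> is not a root of the quadratic\<close>
    have "3125 * (11 * u - 1) = 0" using A B by algebra
    hence "11 * u - 1 = 0" by simp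
    with B have "(125::complex) = 0 \<or> (1::complex) = 0" by algebra
    thus False by simp
  qed
  have deg: "degree ?A = 20" "degree ?B = 11" "degree ?C = 30"
    by (subst degree_X_comp_monom degree_comp_monom; simp)+
  have n: "60 = max (3 * degree ?A) (5 * degree ?B)" unfolding deg by simp
  note * = power_relation_types[OF rel _ _ _ _ _ nr n]
  show "\<exists>p q. ratfun p q \<and> ratfun.N p q = 60 \<and> ratfun.of_type p q 3 5" by (rule *(1)) (simp_all add: deg)
  show "\<exists>p q. ratfun p q \<and> ratfun.N p q = 60 \<and> ratfun.of_type p q 5 3" by (rule *(2)) (simp_all add: deg)
qed

lemma polyhedral_function_exists:
  assumes kl: "k \<ge> 2" "l \<ge> 2" "k * l < 2 * k + 2 * l"
  obtains p q where "ratfun p q" "ratfun.of_exact_type p q k l"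
    "int (ratfun.N p q) * (2 * int k + 2 * int l - int k * int l) = 4 * int k * int l"
proof -
  have cases: "k = 2 \<or> l = 2 \<or> (k, l) \<in> {(3, 3), (3, 4), (4, 3), (3, 5), (5, 3)}"
  proof (rule ccontr)
    assume n: "\<not> ?thesis"
    \<comment> \<open>the remaining inequality is \<open>(k - 2) * (l - 2) < 4\<close>\<close>
    define a b where "a = k - 3" and "b = l - 3"
    have ab: "k = a + 3" "l = b + 3" using n kl by (auto simp: a_def b_def)
    have "a * b + a + b < 3" using kl(3) unfolding ab by (simp add: algebra_simps)
    moreover from this have "a < 3" "b < 3" by linarith+
    ultimately have "(a, b) \<in> {(0,0), (0,1), (1,0), (0,2), (2,0)}"
      by (cases a; cases b) (auto simp: less_Suc_eq numeral_eq_Suc)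
    thus False using n ab by auto
  qed
  have "\<exists>p q n. ratfun p q \<and> ratfun.N p q = n \<and> ratfun.of_type p q k l \<and>
     int n * (2 * int k + 2 * int l - int k * int l) = 4 * int k * int l"
  proof -
    consider "k = 2" | "l = 2" | "k = 3" "l = 3" | "k = 3" "l = 4" | "k = 4" "l = 3" | "k = 3" "l = 5" | "k = 5" "l = 3"
      using cases by auto
    thus ?thesis
    proof cases
      case 1
      obtain p q where "ratfun p q" "ratfun.N p q = 2 * l" "ratfun.of_type p q 2 l" 
        using dihedral_relation(1)[of l] kl by auto
      thus ?thesis using 1 by (intro exI[of _ p] exI[of _ q] exI[of _ "2 * l"]) (simp add: algebra_simps)
    next
      case 2
      obtain p q where "ratfun p q" "ratfun.N p q = 2 * k" "ratfun.of_type p q k 2" 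
        using dihedral_relation(2)[of k] kl by auto
      thus ?thesis using 2 by (intro exI[of _ p] exI[of _ q] exI[of _ "2 * k"]) (simp add: algebra_simps)
    next
      case 3 thus ?thesis using tetrahedral_relation by fastforce
    next
      case 4 thus ?thesis using octahedral_relation(1) by fastforce
    next
      case 5 thus ?thesis using octahedral_relation(2) by fastforce
    next
      case 6 thus ?thesis using icosahedral_relation(1) by fastforce
    next
      case 7 thus ?thesis using icosahedral_relation(2) by fastforce
    qed
  qed
  then obtain p q where pq: "ratfun p q" "ratfun.of_type p q k l"
    "int (ratfun.N p q) * (2 * int k + 2 * int l - int k * int l) = 4 * int k * int l" by auto
  show ?thesis by (rule that[OF pq(1) ratfun.exact_typeI[OF pq(1,2) kl(1,2) pq(3)] pq(3)])
qed

section \<open>Uniform graphs\<close>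

theorem theorem4p1:
  fixes k l :: nat and G :: pgraph and \<beta> :: "sphere \<Rightarrow> sphere"
  assumes "k \<ge> 2" and "l \<ge> 2"
    and "uniform_graph k l G"
    and "clean_belyi_function_of G \<beta>"
  shows "(\<forall>\<beta>\<^sub>k\<^sub>l. platonic_belyi k l \<beta>\<^sub>k\<^sub>l \<longrightarrow>
            (\<exists>\<psi>. rational_function \<psi> \<and> \<beta> = \<beta>\<^sub>k\<^sub>l \<circ> \<psi>)) \<and>
         (\<exists>m::nat. real (card (edges G)) = real m * platonic_edges k l)"
proof -
  have \<beta>: "clean_belyi \<beta>" "pgraph_equiv (belyi_graph \<beta>) G"
    using assms(4) unfolding clean_belyi_function_of_def by auto
  obtain P Q where PQ: "clean_ratfun P Q" "\<beta> = rat_map P Q" by (rule clean_belyi_ratfun[OF \<beta>(1)])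
  interpret B: clean_ratfun P Q by fact
  note deg = B.degrees_of_graph[OF \<beta>(2)[unfolded PQ(2)]]
  have type: "B.of_type k l"
    unfolding B.of_type_def
  proof (intro conjI allI impI)
    fix x assume "rat_map P Q x = Some 0"
    thus "k dvd B.mul x" using deg(1)[of x] assms(3) unfolding uniform_graph_def by metis
  next
    fix x assume "rat_map P Q x = None"
    thus "l dvd B.mul x" using deg(2)[of x] assms(3) unfolding uniform_graph_def by metis
  next
    fix x assume "rat_map P Q x = Some 1"
    thus "2 dvd B.mul x" by (simp add: B.over_1)
  qed
  have "\<exists>\<psi>. rational_function \<psi> \<and> \<beta> = \<beta>' \<circ> \<psi>" if pl: "platonic_belyi k l \<beta>'" for \<beta>'
  proof -
    obtain H where H: "platonic_graph k l H" "clean_belyi \<beta>'" "pgraph_equiv (belyi_graph \<beta>') H"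
      using pl unfolding platonic_belyi_def clean_belyi_function_of_def by metis
    obtain p q where pq: "clean_ratfun p q" "\<beta>' = rat_map p q" by (rule clean_belyi_ratfun[OF H(2)])
    interpret A: clean_ratfun p q by fact
    note deg = A.degrees_of_graph[OF H(3)[unfolded pq(2)]]
    have 0: "A.mul x = k" if "rat_map p q x = Some 0" for x
      using deg(1)[OF that] H(1) unfolding platonic_graph_def by metis
    have i: "A.mul x = l" if "rat_map p q x = None" for x
      using deg(2)[OF that] H(1) unfolding platonic_graph_def by metis
    have "A.of_exact_type k l"
      unfolding A.of_exact_type_def
    proof
      fix x
      show "A.mul x = (if rat_map p q x = Some 0 then k else if rat_map p q x = None then l else if rat_map p q x = Some 1 then 2 else 1)"
        using 0[of x] i[of x] A.over_1[of x] A.ramified[of x] by (cases "A.mul x = 1") auto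
    qed
    then obtain \<psi> where "rational_function \<psi>" "rat_map P Q = rat_map p q \<circ> \<psi>"
      using factor_through_exact_type[OF A.ratfun_axioms _ B.ratfun_axioms type] by metis
    thus ?thesis using pq(2) PQ(2) by blast
  qed
  moreover have "\<exists>m::nat. real (card (edges G)) = real m * platonic_edges k l"
  proof -
    have sph: "k * l < 2 * k + 2 * l" by (rule B.spherical_type[OF type assms(1,2)])
    obtain p q where pq: "ratfun p q" "ratfun.of_exact_type p q k l"
      "int (ratfun.N p q) * (2 * int k + 2 * int l - int k * int l) = 4 * int k * int l"
      by (rule polyhedral_function_exists[OF assms(1,2) sph])
    obtain \<psi> where "rational_function \<psi>" "rat_map P Q = rat_map p q \<circ> \<psi>"
      by (rule factor_through_exact_type[OF pq(1,2) B.ratfun_axioms type])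
    hence "ratfun.N p q dvd B.N" by (rule degree_composition[OF pq(1) B.ratfun_axioms])
    then obtain m where m: "B.N = ratfun.N p q * m" by (rule dvdE)
    define D where "D = 2 * real k + 2 * real l - real k * real l"
    have "real (k * l) < real (2 * k + 2 * l)" using sph by (simp only: of_nat_less_iff)
    hence D: "D > 0" by (simp add: D_def)
    have "real_of_int (int (ratfun.N p q) * (2 * int k + 2 * int l - int k * int l)) = real_of_int (4 * int k * int l)"
      using pq(3) by (rule arg_cong)
    hence "real (ratfun.N p q) * D = 4 * real k * real l" by (simp add: D_def)
    hence "real (ratfun.N p q) = 2 * platonic_edges k l" 
      using D by (simp add: platonic_edges_def flip: D_def) (simp add: field_simps)
    moreover have "2 * real (card (edges G)) = real (ratfun.N p q) * real m"
      using deg(3) m by (metis of_nat_mult of_nat_numeral)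
    ultimately have "real (card (edges G)) = real m * platonic_edges k l" by simp
    thus ?thesis by blast
  qed
  ultimately show ?thesis by blast
qed

end
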